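(* Let $\alpha\in(0,1)$, $\beta>0$, $\gamma\in(\gamma_0,\frac1\alpha)$ where $\gamma_0=\frac{5\alpha+1}{2\alpha(2\alpha+1)}$, and $a>0$, and let $t_{a,\gamma}=e^{aN^\gamma}$. With $\mathbb P_{\mathbf J}$-probability $1-o(1)$, for any $t_{a,\gamma}$-metastable well $\mathcal C_i$, the mixing time of the Glauber dynamics restricted to $\mathcal C_i$ is $o(t_{a,\gamma})$; in fact it is at most $e^{-N^\eta}t_{a,\gamma}$ for some $\eta>0$. On the other hand, the escape time from $\mathcal C_i$ is at least $\Theta(t_{a,\gamma})$.
   Context: Model. For each $N$, $\mathbf J=(J_{ij})_{1\le i<j\le N}$, $J_{ji}=J_{ij}$, are i.i.d. with density $\frac{\alpha}{2N}|x|^{-(1+\alpha)}\mathbf 1\{|x|\ge N^{-1/\alpha}\}$; $\mathbb P_{\mathbf J}$ is the law of $\mathbf J$. $\Sigma_N=\{\pm1\}^N$, $H(\sigma)=\sum_{i<j}J_{ij}\sigma_i\sigma_j$, and $\pi_{\beta,\mathbf J}(\sigma)\propto e^{\beta H(\sigma)}$. Asymptotic notation is as $N\to\infty$. Glauber dynamics. Continuous-time chain on $\Sigma_N$: each site has a rate-1 Poisson clock; when the clock at $v$ rings, $\sigma_v$ is resampled from $\pi_{\beta,\mathbf J}(\sigma_v\in\cdot\mid(\sigma_w)_{w\ne v})$, other spins unchanged. The dynamics restricted to a well $\mathcal C$ is started in $\mathcal C$ and rejects all updates that would leave $\mathcal C$; its stationary law is $\pi_{\beta,\mathbf J}(\cdot\mid\mathcal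 C)$. The mixing time of a chain with stationary law $\pi$ is $\inf\{t>0:\max_{x_0}d_{TV}(\mathbb P_{x_0}(X_t\in\cdot),\pi)<1/4\}$. The escape time from $\mathcal C$ is the time it takes the (unrestricted) Glauber dynamics started in $\mathcal C$ to leave $\mathcal C$. Wells. Let $E_{a,\gamma}=\{(i,j):|J_{ij}|\ge\frac{a}{2\beta}N^\gamma\}$ and $K=|E_{a,\gamma}|$; with $\mathbb P_{\mathbf J}$-probability $1-o(1)$ the edges in $E_{a,\gamma}$ are vertex-disjoint, and one works on this event. Let $\mathsf{Sat}(\sigma)=\{(i,j):\sigma_i\sigma_j=\mathrm{sign}(J_{ij})\}$. The set $\{\sigma:\mathsf{Sat}(\sigma)\supset E_{a,\gamma}\}$ splits into $2^K$ connected components of the hypercube; these are the $t_{a,\gamma}$-metastable wells $\mathcal C_i$. *)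

theory Defs
  imports "HOL-Probability.Probability"
begin

text \<open>
  Sites are \<open>1, \<dots>, N\<close>. A coupling array is a function on ordered pairs \<open>(i, j)\<close> with \<open>i < j\<close>;
  the symmetric convention never has to be invoked, because every formula below only reads
  entries with \<open>i < j\<close>.
\<close>

definition pairs :: "nat \<Rightarrow> (nat \<times> nat) set" where
  "pairs N = {(i, j). 1 \<le> i \<and> i < j \<and> j \<le> N}"

definition levy_density :: "real \<Rightarrow> nat \<Rightarrow> real \<Rightarrow> real" where
  "levy_density \<alpha> N x =
     (if \<bar>x\<bar> \<ge> real N powr (- 1 / \<alpha>) then \<alpha> / (2 * real N) * \<bar>x\<bar> powr (- (1 + \<alpha>)) else 0)"

definition coupling_law :: "real \<Rightarrow> nat \<Rightarrow> (nat \<times> nat \<Rightarrow> real) measure" where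
  "coupling_law \<alpha> N = (\<Pi>\<^sub>M e\<in>pairs N. density lborel (\<lambda>x. ennreal (levy_density \<alpha> N x)))"

definition configs :: "nat \<Rightarrow> (nat \<Rightarrow> real) set" where
  "configs N = {1..N} \<rightarrow>\<^sub>E {-1, 1}"

definition hamiltonian :: "nat \<Rightarrow> (nat \<times> nat \<Rightarrow> real) \<Rightarrow> (nat \<Rightarrow> real) \<Rightarrow> real" where
  "hamiltonian N J \<sigma> = (\<Sum>(i, j)\<in>pairs N. J (i, j) * \<sigma> i * \<sigma> j)"

definition gibbs :: "nat \<Rightarrow> real \<Rightarrow> (nat \<times> nat \<Rightarrow> real) \<Rightarrow> (nat \<Rightarrow> real) \<Rightarrow> real" where
  "gibbs N \<beta> J \<sigma> =
     exp (\<beta> * hamiltonian N J \<sigma>) / (\<Sum>\<tau>\<in>configs N. exp (\<beta> * hamiltonian N J \<tau>))"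

text \<open>Conditional probability of the event \<open>B\<close> given \<open>A\<close>, for sets of configurations \<open>A, B\<close>.\<close>

definition gibbs_given ::
    "nat \<Rightarrow> real \<Rightarrow> (nat \<times> nat \<Rightarrow> real) \<Rightarrow> (nat \<Rightarrow> real) set \<Rightarrow> (nat \<Rightarrow> real) set \<Rightarrow> real" where
  "gibbs_given N \<beta> J A B = (\<Sum>\<sigma>\<in>A \<inter> B. gibbs N \<beta> J \<sigma>) / (\<Sum>\<sigma>\<in>A. gibbs N \<beta> J \<sigma>)"

definition prob_plus :: "nat \<Rightarrow> real \<Rightarrow> (nat \<times> nat \<Rightarrow> real) \<Rightarrow> nat \<Rightarrow> (nat \<Rightarrow> real) \<Rightarrow> real" where
  "prob_plus N \<beta> J v \<sigma> =
     gibbs_given N \<beta> J {\<tau>\<in>configs N. \<forall>w. w \<noteq> v \<longrightarrow> \<tau> w = \<sigma> w} {\<tau>. \<tau> v = 1}"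

text \<open>
  The randomness driving the dynamics: for the \<open>k\<close>-th ring of the clock at \<open>v\<close>, the sample point
  \<open>\<omega> v k\<close> holds the exponential waiting time since the previous ring of that clock and a uniform
  variable on \<open>[0,1]\<close> used for resampling the spin. All of these are independent.
\<close>

definition clock_space :: "nat \<Rightarrow> (nat \<Rightarrow> nat \<Rightarrow> real \<times> real) measure" where
  "clock_space N = (\<Pi>\<^sub>M v\<in>{1..N}. \<Pi>\<^sub>M k\<in>UNIV.
     density lborel (\<lambda>x. ennreal (exponential_density 1 x)) \<Otimes>\<^sub>M uniform_measure lborel {0..1})"

definition ring_time :: "(nat \<Rightarrow> nat \<Rightarrow> real \<times> real) \<Rightarrow> nat \<times> nat \<Rightarrow> real" where
  "ring_time \<omega> = (\<lambda>(v, k). \<Sum>j\<le>k. fst (\<omega> v j))"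

text \<open>
  The rings up to time \<open>t\<close>, in chronological order. Almost surely there are finitely many and no
  two of them are simultaneous, so that exactly one list qualifies; on the exceptional null set
  the value is an arbitrary list.
\<close>

definition rings_until :: "nat \<Rightarrow> (nat \<Rightarrow> nat \<Rightarrow> real \<times> real) \<Rightarrow> real \<Rightarrow> (nat \<times> nat) list" where
  "rings_until N \<omega> t =
     (THE rs. sorted_wrt (\<lambda>r s. ring_time \<omega> r < ring_time \<omega> s) rs \<and>
        set rs = {(v, k). v \<in> {1..N} \<and> ring_time \<omega> (v, k) \<le> t})"

text \<open>Resampling at \<open>v\<close> with uniform variable \<open>u\<close>, rejecting updates that would leave \<open>C\<close>.\<close>

definition resample ::
    "nat \<Rightarrow> real \<Rightarrow> (nat \<times> nat \<Rightarrow> real) \<Rightarrow> (nat \<Rightarrow> real) set \<Rightarrow> nat \<Rightarrow> real \<Rightarrow> (nat \<Rightarrow> real) \<Rightarrow> nat \<Rightarrow> real"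
  where
  "resample N \<beta> J C v u \<sigma> =
     (let \<sigma>' = \<sigma>(v := if u \<le> prob_plus N \<beta> J v \<sigma> then 1 else - 1)
      in if \<sigma>' \<in> C then \<sigma>' else \<sigma>)"

text \<open>
  State at time \<open>t\<close> of the dynamics restricted to \<open>C\<close> and started at \<open>x\<close>. The unrestricted Glauber
  dynamics is the case \<open>C = configs N\<close>, in which no update is rejected.
\<close>

definition glauber ::
    "nat \<Rightarrow> real \<Rightarrow> (nat \<times> nat \<Rightarrow> real) \<Rightarrow> (nat \<Rightarrow> real) set \<Rightarrow> (nat \<Rightarrow> real)
      \<Rightarrow> (nat \<Rightarrow> nat \<Rightarrow> real \<times> real) \<Rightarrow> real \<Rightarrow> nat \<Rightarrow> real" where
  "glauber N \<beta> J C x \<omega> t =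
     fold (\<lambda>(v, k). resample N \<beta> J C v (snd (\<omega> v k))) (rings_until N \<omega> t) x"

definition tv_dist :: "'s set \<Rightarrow> ('s set \<Rightarrow> real) \<Rightarrow> ('s set \<Rightarrow> real) \<Rightarrow> real" where
  "tv_dist S \<mu> \<nu> = (MAX A\<in>Pow S. \<bar>\<mu> A - \<nu> A\<bar>)"

definition mixing_time ::
    "nat \<Rightarrow> real \<Rightarrow> (nat \<times> nat \<Rightarrow> real) \<Rightarrow> (nat \<Rightarrow> real) set \<Rightarrow> ereal" where
  "mixing_time N \<beta> J C =
     Inf (ereal ` {t. 0 < t \<and>
       (MAX x\<in>C. tv_dist (configs N)
          (\<lambda>A. measure (clock_space N) {\<omega>\<in>space (clock_space N). glauber N \<beta> J C x \<omega> t \<in> A})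
          (gibbs_given N \<beta> J C)) < 1 / 4})"

text \<open>The escape time is infinite on paths that never leave \<open>C\<close>.\<close>

definition escape_time ::
    "nat \<Rightarrow> real \<Rightarrow> (nat \<times> nat \<Rightarrow> real) \<Rightarrow> (nat \<Rightarrow> real) set \<Rightarrow> (nat \<Rightarrow> real)
      \<Rightarrow> (nat \<Rightarrow> nat \<Rightarrow> real \<times> real) \<Rightarrow> ereal" where
  "escape_time N \<beta> J C x \<omega> =
     Inf (ereal ` {t. 0 \<le> t \<and> glauber N \<beta> J (configs N) x \<omega> t \<notin> C})"

definition heavy_edges ::
    "nat \<Rightarrow> real \<Rightarrow> (nat \<times> nat \<Rightarrow> real) \<Rightarrow> real \<Rightarrow> real \<Rightarrow> (nat \<times> nat) set" where
  "heavy_edges N \<beta> J a \<gamma> = {e\<in>pairs N. \<bar>J e\<bar> \<ge> a / (2 * \<beta>) * real N powr \<gamma>}"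

definition Sat :: "nat \<Rightarrow> (nat \<times> nat \<Rightarrow> real) \<Rightarrow> (nat \<Rightarrow> real) \<Rightarrow> (nat \<times> nat) set" where
  "Sat N J \<sigma> = {(i, j)\<in>pairs N. \<sigma> i * \<sigma> j = sgn (J (i, j))}"

definition hypercube_components :: "nat \<Rightarrow> (nat \<Rightarrow> real) set \<Rightarrow> (nat \<Rightarrow> real) set set" where
  "hypercube_components N S =
     (\<lambda>\<sigma>. {(\<tau>, \<rho>). \<tau> \<in> S \<and> \<rho> \<in> S \<and> (\<exists>v\<in>{1..N}. \<rho> = \<tau>(v := - \<tau> v))}\<^sup>* `` {\<sigma>}) ` S"

definition metastable_wells ::
    "nat \<Rightarrow> real \<Rightarrow> (nat \<times> nat \<Rightarrow> real) \<Rightarrow> real \<Rightarrow> real \<Rightarrow> (nat \<Rightarrow> real) set set" where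
  "metastable_wells N \<beta> J a \<gamma> =
     hypercube_components N {\<sigma>\<in>configs N. heavy_edges N \<beta> J a \<gamma> \<subseteq> Sat N J \<sigma>}"

definition t_scale :: "real \<Rightarrow> real \<Rightarrow> nat \<Rightarrow> real" where
  "t_scale a \<gamma> N = exp (a * real N powr \<gamma>)"

text \<open>
  ``With probability \<open>1 - o(1)\<close>, \<open>P\<close> holds'': \<open>P\<close> holds on measurable events whose probability tends
  to 1. For measurable \<open>P\<close> this is the same as the probability of \<open>P\<close> itself tending to 1.
\<close>

definition with_prob_tending_to_1 :: "(nat \<Rightarrow> 'b measure) \<Rightarrow> (nat \<Rightarrow> 'b \<Rightarrow> bool) \<Rightarrow> bool" where
  "with_prob_tending_to_1 M P \<longleftrightarrow>
     (\<exists>A. (\<forall>N. A N \<in> sets (M N) \<and> (\<forall>J\<in>A N. P N J)) \<and> (\<lambda>N. measure (M N) (A N)) \<longlonglongrightarrow> 1)"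

end

theory Submission
  imports Defs "HOL-Real_Asymp.Real_Asymp"
begin

text \<open>
  Choose exponents \<open>1 / (2 * \<alpha>) < d\<close> and \<open>1 + d * (1 - \<alpha>) < r < k < \<gamma> * (1 + \<alpha>) - 1\<close>; the hypothesis on
  \<open>\<gamma>\<close> leaves room for them. With high probability the couplings of modulus at least \<open>N\<^sup>d\<close> form a
  matching, all other couplings together have modulus at most \<open>N\<^sup>r\<close>, and no coupling is within
  distance \<open>N\<^sup>k\<close> of the threshold \<open>a / (2 * \<beta>) * N\<^sup>\<gamma>\<close>.

  On this event a well is a subcube on which the spins of the heavy edges are frozen. Canonical
  paths that flip the two ends of every remaining matching edge consecutively only have to climb
  over one matching edge and the light couplings, so the relaxation time is at most
  \<open>exp (a * N\<^sup>\<gamma> - 2 * \<beta> * N\<^sup>k + O(N\<^sup>r))\<close> up to a polynomial factor. Conversely an update of a frozen site leaves the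
  well with probability at most \<open>exp (- a * N\<^sup>\<gamma> - 2 * \<beta> * (N\<^sup>k - N\<^sup>r))\<close>, whatever the other spins are.

  The graphical construction is tied to the generator by computing, from the lack of memory of the
  exponential clocks, the probability that the rings up to time \<open>t\<close> occur along a prescribed list of
  sites; these probabilities are Poisson weights, so the law at time \<open>t\<close> is the exponential series of
  the sum of the single-site operators.
\<close>

section \<open>Poincare inequality for heat-bath chains\<close>

text \<open>The exponents come from three expectations. About \<open>N^3\<close> pairs of couplings
  share a site, and both exceed \<open>N^d\<close> with probability
  \<open>N^(-2-2*\<alpha>*d)\<close>; hence \<open>d > 1/(2*\<alpha>)\<close>. The
  \<open>N^2\<close> couplings below \<open>N^d\<close> have truncated mean modulus at most of order
  \<open>N^(d*(1-\<alpha>)-1)\<close>, and their sum is bounded without using cancellations; hence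
  \<open>r > 1+d*(1-\<alpha>)\<close>. The density near \<open>N^\<gamma>\<close> leaves a window of
  width \<open>N^k\<close> empty if \<open>1+k < \<gamma>*(1+\<alpha>)\<close>. Finally
  \<open>r < k\<close>: barriers inside a well and the barrier out of it are set by couplings on the
  two sides of the threshold, and the gap between these must beat the error from the light
  couplings. With \<open>d\<close> at its limit this asks for
  \<open>\<gamma>*(1+\<alpha>) > (1+3*\<alpha>)/(2*\<alpha>)\<close>. The dynamics is given by
  clocks and not by a semigroup, so its law has to be recovered from the rings. Disjoint path events
  give lower bounds only, but their total Poisson mass is one, which makes the bounds exact.\<close>

definition flip :: "'a \<Rightarrow> ('a \<Rightarrow> real) \<Rightarrow> 'a \<Rightarrow> real" where
  "flip v \<sigma> = \<sigma>(v := - \<sigma> v)"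

lemma flip_flip [simp]: "flip v (flip v \<sigma>) = \<sigma>"
  by (simp add: flip_def)

text \<open>The weights are unnormalised: sums over \<open>C\<close> replace expectations, and the
  total mass appears only where it is estimated. A flip that would leave \<open>C\<close> is
  rejected.\<close>

locale heat_bath =
  fixes V :: "'a set" and C :: "('a \<Rightarrow> real) set" and w :: "('a \<Rightarrow> real) \<Rightarrow> real"
  assumes finite_V: "finite V" and finite_C: "finite C"
    and w_pos: "\<And>\<sigma>. \<sigma> \<in> C \<Longrightarrow> 0 < w \<sigma>"
begin

definition flippable :: "'a \<Rightarrow> ('a \<Rightarrow> real) set" where
  "flippable v = {\<sigma> \<in> C. flip v \<sigma> \<in> C}"

text \<open>For spins +1 and -1 this is conditional expectation given all spins except the one at
  \<open>v\<close>, for the weight restricted to \<open>C\<close>; hence an orthogonal projection in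
  \<open>L2(w)\<close>.\<close>

definition heat :: "'a \<Rightarrow> (('a \<Rightarrow> real) \<Rightarrow> real) \<Rightarrow> ('a \<Rightarrow> real) \<Rightarrow> real" where
  "heat v f \<sigma> =
     (if flip v \<sigma> \<in> C
      then (w \<sigma> * f \<sigma> + w (flip v \<sigma>) * f (flip v \<sigma>)) / (w \<sigma> + w (flip v \<sigma>))
      else f \<sigma>)"

definition sweep :: "(('a \<Rightarrow> real) \<Rightarrow> real) \<Rightarrow> ('a \<Rightarrow> real) \<Rightarrow> real" where
  "sweep f \<sigma> = (\<Sum>v\<in>V. heat v f \<sigma>)"

lemma flippable_pos: "\<sigma> \<in> flippable v \<Longrightarrow> 0 < w \<sigma>" "\<sigma> \<in> flippable v \<Longrightarrow> 0 < w (flip v \<sigma>)"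
  by (auto simp: flippable_def w_pos)

lemma sum_flippable_flip: "(\<Sum>\<sigma>\<in>flippable v. F (flip v \<sigma>)) = (\<Sum>\<sigma>\<in>flippable v. F \<sigma>)"
  by (rule sum.reindex_bij_witness[of _ "flip v" "flip v"]) (auto simp: flippable_def)

lemma sum_split_flippable:
  "(\<Sum>\<sigma>\<in>C. F \<sigma>) = (\<Sum>\<sigma>\<in>flippable v. F \<sigma>) + (\<Sum>\<sigma>\<in>C - flippable v. F \<sigma> :: real)"
  by (subst sum.subset_diff[of "flippable v"]) (auto simp: flippable_def finite_C)

lemma heat_flip: "\<sigma> \<in> C \<Longrightarrow> flip v \<sigma> \<in> C \<Longrightarrow> heat v f (flip v \<sigma>) = heat v f \<sigma>"
  by (simp add: heat_def add.commute)

text \<open>Averaging moves mass only within a pair \<open>{\<sigma>, flip v \<sigma>}\<close>,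
  where \<open>g\<close> is constant. With \<open>g = 1\<close> this is stationarity, with
  \<open>g = heat v f\<close> it is the projection identity.\<close>

lemma heat_symmetrized:
  assumes g: "\<And>\<sigma>. \<sigma> \<in> C \<Longrightarrow> flip v \<sigma> \<in> C \<Longrightarrow> g (flip v \<sigma>) = g \<sigma>"
  shows "(\<Sum>\<sigma>\<in>C. w \<sigma> * heat v f \<sigma> * g \<sigma>) = (\<Sum>\<sigma>\<in>C. w \<sigma> * f \<sigma> * g \<sigma>)"
proof -
  let ?F = "flippable v"
  have half: "(\<Sum>\<sigma>\<in>?F. w \<sigma> * f \<sigma> * g \<sigma>)
    = (\<Sum>\<sigma>\<in>?F. (w \<sigma> * f \<sigma> + w (flip v \<sigma>) * f (flip v \<sigma>)) * g \<sigma> / 2)" for f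
  proof -
    have "(\<Sum>\<sigma>\<in>?F. w (flip v \<sigma>) * f (flip v \<sigma>) * g \<sigma>) =
          (\<Sum>\<sigma>\<in>?F. w (flip v \<sigma>) * f (flip v \<sigma>) * g (flip v \<sigma>))"
      by (rule sum.cong) (auto simp: flippable_def g)
    also have "\<dots> = (\<Sum>\<sigma>\<in>?F. w \<sigma> * f \<sigma> * g \<sigma>)"
      by (rule sum_flippable_flip[of "\<lambda>\<sigma>. w \<sigma> * f \<sigma> * g \<sigma>"])
    finally show ?thesis
      by (simp add: sum_divide_distrib[symmetric] distrib_right sum.distrib)
  qed
  have "(\<Sum>\<sigma>\<in>?F. w \<sigma> * heat v f \<sigma> * g \<sigma>) = (\<Sum>\<sigma>\<in>?F. w \<sigma> * f \<sigma> * g \<sigma>)"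
    unfolding half[of "heat v f"] half[of f]
  proof (rule sum.cong[OF refl])
    fix \<sigma> assume s: "\<sigma> \<in> ?F"
    have "w \<sigma> + w (flip v \<sigma>) > 0" using flippable_pos[OF s] by simp
    then have "(w \<sigma> + w (flip v \<sigma>)) * heat v f \<sigma> = w \<sigma> * f \<sigma> + w (flip v \<sigma>) * f (flip v \<sigma>)"
      using s by (simp add: heat_def flippable_def)
    moreover have "heat v f (flip v \<sigma>) = heat v f \<sigma>"
      using s heat_flip by (simp add: flippable_def)
    ultimately show "(w \<sigma> * heat v f \<sigma> + w (flip v \<sigma>) * heat v f (flip v \<sigma>)) * g \<sigma> / 2 =
       (w \<sigma> * f \<sigma> + w (flip v \<sigma>) * f (flip v \<sigma>)) * g \<sigma> / 2"
      by (simp add: distrib_right)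
  qed
  moreover have "(\<Sum>\<sigma>\<in>C - ?F. w \<sigma> * heat v f \<sigma> * g \<sigma>) = (\<Sum>\<sigma>\<in>C - ?F. w \<sigma> * f \<sigma> * g \<sigma>)"
    by (rule sum.cong) (auto simp: heat_def flippable_def)
  ultimately show ?thesis
    by (simp add: sum_split_flippable[of _ v])
qed

lemma heat_mean: "(\<Sum>\<sigma>\<in>C. w \<sigma> * heat v f \<sigma>) = (\<Sum>\<sigma>\<in>C. w \<sigma> * f \<sigma>)"
  using heat_symmetrized[of v "\<lambda>_. 1" f] by simp

lemma heat_projection: "(\<Sum>\<sigma>\<in>C. w \<sigma> * (heat v f \<sigma>)\<^sup>2) = (\<Sum>\<sigma>\<in>C. w \<sigma> * f \<sigma> * heat v f \<sigma>)"
  using heat_symmetrized[of v "heat v f" f] heat_flip by (simp add: power2_eq_square mult.assoc)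

lemma min_le_twice_harmonic:
  fixes x y :: real
  assumes "0 < x" "0 < y"
  shows "min x y \<le> 2 * (x * y / (x + y))"
proof -
  have "min x y * (x + y) \<le> 2 * (x * y)"
    using assms by (auto simp: min_def algebra_simps)
  then show ?thesis using assms by (simp add: field_simps)
qed

text \<open>With \<open>h = w * w' / (w + w')\<close> for the two weights of a flip pair, the form
  at \<open>v\<close> is half the sum of \<open>h * (f - f')^2\<close> over
  \<open>flippable v\<close>, and \<open>min w w' \<le> 2 * h\<close>. The constant 4 collects both
  factors.\<close>

lemma dirichlet_form_ge:
  "(\<Sum>\<sigma>\<in>flippable v. min (w \<sigma>) (w (flip v \<sigma>)) * (f \<sigma> - f (flip v \<sigma>))\<^sup>2)
     \<le> 4 * (\<Sum>\<sigma>\<in>C. w \<sigma> * f \<sigma> * (f \<sigma> - heat v f \<sigma>))"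
proof -
  let ?F = "flippable v"
  let ?h = "\<lambda>\<sigma>. w \<sigma> * w (flip v \<sigma>) / (w \<sigma> + w (flip v \<sigma>))"
  let ?d = "\<lambda>\<sigma>. f \<sigma> - f (flip v \<sigma>)"
  have "(\<Sum>\<sigma>\<in>C. w \<sigma> * f \<sigma> * (f \<sigma> - heat v f \<sigma>)) = (\<Sum>\<sigma>\<in>?F. w \<sigma> * f \<sigma> * (f \<sigma> - heat v f \<sigma>))"
    unfolding sum_split_flippable[of _ v]
    by (simp add: sum.neutral heat_def flippable_def)
  also have "\<dots> = (\<Sum>\<sigma>\<in>?F. ?h \<sigma> * f \<sigma> * ?d \<sigma>)"
  proof (rule sum.cong[OF refl])
    fix \<sigma> assume s: "\<sigma> \<in> ?F"
    have "w \<sigma> + w (flip v \<sigma>) > 0" using flippable_pos[OF s] by simp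
    then show "w \<sigma> * f \<sigma> * (f \<sigma> - heat v f \<sigma>) = ?h \<sigma> * f \<sigma> * ?d \<sigma>"
      using s by (simp add: heat_def flippable_def field_simps)
  qed
  finally have 1: "(\<Sum>\<sigma>\<in>C. w \<sigma> * f \<sigma> * (f \<sigma> - heat v f \<sigma>)) = (\<Sum>\<sigma>\<in>?F. ?h \<sigma> * f \<sigma> * ?d \<sigma>)" .
  \<comment> \<open>Reindexing by the flip keeps \<open>?h\<close> and reverses the sign of
    \<open>?d\<close>; adding both forms of the sum completes the square.\<close>
  have 2: "(\<Sum>\<sigma>\<in>?F. ?h \<sigma> * f \<sigma> * ?d \<sigma>) = (\<Sum>\<sigma>\<in>?F. - (?h \<sigma> * f (flip v \<sigma>) * ?d \<sigma>))"
    by (subst sum_flippable_flip[symmetric], intro sum.cong refl)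
       (simp add: add.commute mult.commute[of "w (flip v _)"] flip: minus_divide_left mult_minus_right,
        simp add: minus_divide_left mult_minus_right[symmetric] del: mult_minus_right)
  have "2 * (\<Sum>\<sigma>\<in>?F. ?h \<sigma> * f \<sigma> * ?d \<sigma>) = (\<Sum>\<sigma>\<in>?F. ?h \<sigma> * (?d \<sigma>)\<^sup>2)"
  proof -
    have "2 * (\<Sum>\<sigma>\<in>?F. ?h \<sigma> * f \<sigma> * ?d \<sigma>) = 
      (\<Sum>\<sigma>\<in>?F. ?h \<sigma> * f \<sigma> * ?d \<sigma>) + (\<Sum>\<sigma>\<in>?F. - (?h \<sigma> * f (flip v \<sigma>) * ?d \<sigma>))"
      using 2 by simp
    also have "\<dots> = (\<Sum>\<sigma>\<in>?F. ?h \<sigma> * f \<sigma> * ?d \<sigma> - ?h \<sigma> * f (flip v \<sigma>) * ?d \<sigma>)"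
      by (simp add: sum.distrib[symmetric])
    also have "\<dots> = (\<Sum>\<sigma>\<in>?F. ?h \<sigma> * (?d \<sigma>)\<^sup>2)"
      by (intro sum.cong refl) (simp only: power2_eq_square, simp only: algebra_simps)
    finally show ?thesis .
  qed
  moreover have "(\<Sum>\<sigma>\<in>?F. min (w \<sigma>) (w (flip v \<sigma>)) * (?d \<sigma>)\<^sup>2) \<le> (\<Sum>\<sigma>\<in>?F. 2 * ?h \<sigma> * (?d \<sigma>)\<^sup>2)"
    by (intro sum_mono mult_right_mono)
       (use min_le_twice_harmonic flippable_pos in auto)
  moreover have "\<dots> = 2 * (\<Sum>\<sigma>\<in>?F. ?h \<sigma> * (?d \<sigma>)\<^sup>2)"
    unfolding sum_distrib_left by (simp add: mult.assoc)
  ultimately show ?thesis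
    using 1 by linarith
qed

section \<open>Decay of powers of the sweep operator in L2\<close>

lemma sweep_mean: "(\<Sum>\<sigma>\<in>C. w \<sigma> * sweep f \<sigma>) = card V * (\<Sum>\<sigma>\<in>C. w \<sigma> * f \<sigma>)"
proof -
  have "(\<Sum>\<sigma>\<in>C. w \<sigma> * sweep f \<sigma>) = (\<Sum>v\<in>V. \<Sum>\<sigma>\<in>C. w \<sigma> * heat v f \<sigma>)"
    unfolding sweep_def sum_distrib_left by (rule sum.swap)
  then show ?thesis by (simp add: heat_mean)
qed

text \<open>Cauchy-Schwarz over the sites gives \<open>card V\<close> times the sum of the squared
  norms of the projections \<open>heat v f\<close>, and the squared norm of a projection of
  \<open>f\<close> is its inner product with \<open>f\<close>.\<close>

lemma sweep_norm:
  "(\<Sum>\<sigma>\<in>C. w \<sigma> * (sweep f \<sigma>)\<^sup>2) \<le> card V * (\<Sum>\<sigma>\<in>C. w \<sigma> * f \<sigma> * sweep f \<sigma>)"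
proof -
  have "(\<Sum>\<sigma>\<in>C. w \<sigma> * (sweep f \<sigma>)\<^sup>2) \<le> (\<Sum>\<sigma>\<in>C. w \<sigma> * (card V * (\<Sum>v\<in>V. (heat v f \<sigma>)\<^sup>2)))"
    using Cauchy_Schwarz_ineq_sum[of "\<lambda>_. 1" _ V] w_pos
    by (intro sum_mono mult_left_mono) (auto simp: sweep_def less_imp_le)
  also have "\<dots> = (\<Sum>\<sigma>\<in>C. \<Sum>v\<in>V. card V * (w \<sigma> * (heat v f \<sigma>)\<^sup>2))"
    by (simp add: sum_distrib_left mult_ac)
  also have "\<dots> = card V * (\<Sum>v\<in>V. \<Sum>\<sigma>\<in>C. w \<sigma> * (heat v f \<sigma>)\<^sup>2)"
    by (subst sum.swap) (simp add: sum_distrib_left)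
  also have "\<dots> = card V * (\<Sum>\<sigma>\<in>C. \<Sum>v\<in>V. w \<sigma> * f \<sigma> * heat v f \<sigma>)"
    by (subst sum.swap) (simp add: heat_projection)
  finally show ?thesis by (simp add: sweep_def sum_distrib_left)
qed

text \<open>Let \<open>m = card V\<close> and \<open>S = sweep\<close>. For mean zero
  \<open>f\<close> the Poincare inequality says \<open><f, S f> \<le> (m - g) |f|^2\<close>, so
  \<open>sweep_norm\<close> yields
  \<open>|S f|^2 \<le> m (m - g) |f|^2 \<le> (m - g/2)^2 |f|^2\<close>. Giving up half the gap makes
  the factor a square, which iterates well. The vanishing mean is carried along because every step
  uses it.\<close>

lemma sweep_powers_bound:
  fixes g :: real
  assumes poincare: "\<And>f. (\<Sum>\<sigma>\<in>C. w \<sigma> * f \<sigma>) = 0 \<Longrightarrow>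
      g * (\<Sum>\<sigma>\<in>C. w \<sigma> * (f \<sigma>)\<^sup>2) \<le> (\<Sum>v\<in>V. \<Sum>\<sigma>\<in>C. w \<sigma> * f \<sigma> * (f \<sigma> - heat v f \<sigma>))"
    and g: "0 \<le> g" "g \<le> card V"
    and f: "(\<Sum>\<sigma>\<in>C. w \<sigma> * f \<sigma>) = 0"
  shows "(\<Sum>\<sigma>\<in>C. w \<sigma> * ((sweep ^^ n) f \<sigma>)\<^sup>2) \<le> (card V - g / 2) ^ (2 * n) * (\<Sum>\<sigma>\<in>C. w \<sigma> * (f \<sigma>)\<^sup>2)
    \<and> (\<Sum>\<sigma>\<in>C. w \<sigma> * (sweep ^^ n) f \<sigma>) = 0"
proof (induction n)
  case 0
  then show ?case using f by simp
next
  case (Suc n)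
  let ?h = "(sweep ^^ n) f" and ?n = "real (card V)"
  let ?A = "\<Sum>\<sigma>\<in>C. w \<sigma> * (?h \<sigma>)\<^sup>2"
  have A: "?A \<ge> 0" using w_pos by (intro sum_nonneg) (simp add: less_imp_le)
  have "(\<Sum>v\<in>V. \<Sum>\<sigma>\<in>C. w \<sigma> * ?h \<sigma> * (?h \<sigma> - heat v ?h \<sigma>))
     = ?n * ?A - (\<Sum>\<sigma>\<in>C. w \<sigma> * ?h \<sigma> * sweep ?h \<sigma>)"
    unfolding sweep_def sum_distrib_left
    by (subst (2) sum.swap)
       (simp add: right_diff_distrib sum_subtractf power2_eq_square mult.assoc sum_distrib_left)
  with poincare[of ?h] Suc.IH have "(\<Sum>\<sigma>\<in>C. w \<sigma> * ?h \<sigma> * sweep ?h \<sigma>) \<le> (?n - g) * ?A"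
    by (simp add: algebra_simps)
  then have "(\<Sum>\<sigma>\<in>C. w \<sigma> * (sweep ?h \<sigma>)\<^sup>2) \<le> ?n * ((?n - g) * ?A)"
    by (intro order_trans[OF sweep_norm] mult_left_mono) auto
  also have "\<dots> \<le> (?n - g / 2)\<^sup>2 * ?A"
  proof -
    have "?n * (?n - g) \<le> (?n - g / 2)\<^sup>2" by (simp add: power2_eq_square algebra_simps)
    then have "?n * (?n - g) * ?A \<le> (?n - g / 2)\<^sup>2 * ?A" using A by (rule mult_right_mono)
    then show ?thesis by (simp add: mult.assoc)
  qed
  also have "\<dots> \<le> (?n - g / 2)\<^sup>2 * ((?n - g / 2) ^ (2 * n) * (\<Sum>\<sigma>\<in>C. w \<sigma> * (f \<sigma>)\<^sup>2))"
    using Suc.IH by (intro mult_left_mono) auto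
  finally show ?case
    using Suc.IH by (simp add: sweep_mean power2_eq_square mult.assoc)
qed

text \<open>Keeping only the term at \<open>x\<close> of the weighted square sum turns the norm
  bound into a bound at \<open>x\<close>. The price is \<open>1 / w x\<close> under the root; in the
  application only its logarithm matters, and that is polynomial in \<open>N\<close>.\<close>

lemma sweep_powers_pointwise:
  fixes g :: real
  assumes poincare: "\<And>f. (\<Sum>\<sigma>\<in>C. w \<sigma> * f \<sigma>) = 0 \<Longrightarrow>
      g * (\<Sum>\<sigma>\<in>C. w \<sigma> * (f \<sigma>)\<^sup>2) \<le> (\<Sum>v\<in>V. \<Sum>\<sigma>\<in>C. w \<sigma> * f \<sigma> * (f \<sigma> - heat v f \<sigma>))"
    and g: "0 \<le> g" "g \<le> card V"
    and f: "(\<Sum>\<sigma>\<in>C. w \<sigma> * f \<sigma>) = 0" "\<And>\<sigma>. \<sigma> \<in> C \<Longrightarrow> \<bar>f \<sigma>\<bar> \<le> 1"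
    and x: "x \<in> C"
  shows "\<bar>(sweep ^^ n) f x\<bar> \<le> (card V - g / 2) ^ n * sqrt ((\<Sum>\<sigma>\<in>C. w \<sigma>) / w x)"
proof -
  let ?Z = "\<Sum>\<sigma>\<in>C. w \<sigma>" and ?q = "real (card V) - g / 2"
  have "w x * ((sweep ^^ n) f x)\<^sup>2 \<le> (\<Sum>\<sigma>\<in>C. w \<sigma> * ((sweep ^^ n) f \<sigma>)\<^sup>2)"
    using x finite_C w_pos by (intro member_le_sum) (auto simp: less_imp_le)
  also have "\<dots> \<le> ?q ^ (2 * n) * (\<Sum>\<sigma>\<in>C. w \<sigma> * (f \<sigma>)\<^sup>2)"
    using sweep_powers_bound[OF poincare g f(1)] by blast
  also have "\<dots> \<le> ?q ^ (2 * n) * ?Z"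
  proof (intro mult_left_mono sum_mono)
    fix \<sigma> assume "\<sigma> \<in> C"
    then show "w \<sigma> * (f \<sigma>)\<^sup>2 \<le> w \<sigma>"
      using f(2)[of \<sigma>] w_pos[of \<sigma>] by (simp add: abs_square_le_1 mult_left_le less_imp_le)
  qed (simp add: power_mult)
  finally have "((sweep ^^ n) f x)\<^sup>2 \<le> ?q ^ (2 * n) * (?Z / w x)"
    using w_pos[OF x] by (simp add: field_simps)
  then have "sqrt (((sweep ^^ n) f x)\<^sup>2) \<le> sqrt (?q ^ (2 * n)) * sqrt (?Z / w x)"
    unfolding real_sqrt_mult[symmetric] by (rule real_sqrt_le_mono)
  moreover have "sqrt (?q ^ (2 * n)) = ?q ^ n"
    using g by (simp add: power_mult power_even_eq real_sqrt_power)
  ultimately show ?thesis by simp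
qed

text \<open>Exchanging the sites of \<open>S\<close> between the endpoints \<open>\<sigma>\<close>
  and \<open>\<tau>\<close> is an involution of \<open>C \<times> C\<close>. One of the new
  configurations is an end of the edge crossed at \<open>v\<close>, the other records what the path
  has forgotten. So the sum over paths becomes a sum over edges at \<open>v\<close> times the sum of
  the weights of the records, which is the total mass.\<close>

lemma canonical_path_congestion:
  assumes vals: "\<And>\<sigma>. \<sigma> \<in> C \<Longrightarrow> \<sigma> v \<in> {-1, 1}"
    and mix: "\<And>\<sigma> \<tau> S. \<sigma> \<in> C \<Longrightarrow> \<tau> \<in> C \<Longrightarrow> override_on \<sigma> \<tau> S \<in> C"
    and v: "v \<notin> P" and S: "S = P \<or> S = insert v P" and M: "0 \<le> M"
    and le: "\<And>\<sigma> \<tau>. \<sigma> \<in> C \<Longrightarrow> \<tau> \<in> C \<Longrightarrow> w \<sigma> * w \<tau> \<le> M * w (override_on \<tau> \<sigma> S) *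
          min (w (override_on \<sigma> \<tau> P)) (w (override_on \<sigma> \<tau> (insert v P)))"
  shows "(\<Sum>(\<sigma>, \<tau>)\<in>C \<times> C. w \<sigma> * w \<tau> *
            (f (override_on \<sigma> \<tau> P) - f (override_on \<sigma> \<tau> (insert v P)))\<^sup>2)
         \<le> M * (\<Sum>\<sigma>\<in>C. w \<sigma>) *
            (\<Sum>\<sigma>\<in>flippable v. min (w \<sigma>) (w (flip v \<sigma>)) * (f \<sigma> - f (flip v \<sigma>))\<^sup>2)"
proof -
  \<comment> \<open>The edge is read off the encoded pair: \<open>\<xi>\<close> is one end, and
    \<open>\<eta> v\<close> is the spin at \<open>v\<close> of the other end. With
    \<open>S = P\<close> the edge is seen forwards, with \<open>S = insert v P\<close> backwards;
    the last factors are symmetric in the two ends, so both cuts are served.\<close>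
  define G where "G = (\<lambda>(\<xi>, \<eta>). M * w \<eta> * (min (w \<xi>) (w (\<xi>(v := \<eta> v))) * (f \<xi> - f (\<xi>(v := \<eta> v)))\<^sup>2))"
  define \<phi> where "\<phi> = (\<lambda>(\<sigma> :: 'a \<Rightarrow> real, \<tau> :: 'a \<Rightarrow> real). (override_on \<sigma> \<tau> S, override_on \<tau> \<sigma> S))"
  have \<phi>\<phi>: "\<phi> (\<phi> p) = p" for p
    by (cases p) (auto simp: \<phi>_def override_on_def fun_eq_iff)
  have \<phi>C: "\<phi> p \<in> C \<times> C" if "p \<in> C \<times> C" for p
    using that by (auto simp: \<phi>_def mix)
  have "(\<Sum>(\<sigma>, \<tau>)\<in>C \<times> C. w \<sigma> * w \<tau> *
            (f (override_on \<sigma> \<tau> P) - f (override_on \<sigma> \<tau> (insert v P)))\<^sup>2)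
        \<le> (\<Sum>p\<in>C \<times> C. G (\<phi> p))"
  proof (rule sum_mono, clarify)
    fix \<sigma> \<tau> assume st: "\<sigma> \<in> C" "\<tau> \<in> C"
    let ?\<xi> = "override_on \<sigma> \<tau> P" and ?\<xi>' = "override_on \<sigma> \<tau> (insert v P)"
    let ?\<zeta> = "override_on \<sigma> \<tau> S" and ?\<eta> = "override_on \<tau> \<sigma> S"
    have ins: "?\<xi>(v := \<tau> v) = ?\<xi>'" "?\<xi>'(v := \<sigma> v) = ?\<xi>"
      using v by (auto simp: override_on_def fun_eq_iff)
    have "w \<sigma> * w \<tau> * (f ?\<xi> - f ?\<xi>')\<^sup>2 \<le> M * w ?\<eta> * (min (w ?\<xi>) (w ?\<xi>') * (f ?\<xi> - f ?\<xi>')\<^sup>2)"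
      using mult_right_mono[OF le[OF st], of "(f ?\<xi> - f ?\<xi>')\<^sup>2"] by (simp add: mult.assoc)
    also have "\<dots> \<le> M * w ?\<eta> * (min (w ?\<zeta>) (w (?\<zeta>(v := ?\<eta> v))) * (f ?\<zeta> - f (?\<zeta>(v := ?\<eta> v)))\<^sup>2)"
    proof (cases "S = P")
      case True
      then have "?\<zeta>(v := ?\<eta> v) = ?\<xi>'" using v ins(1) by simp
      then show ?thesis using True by simp
    next
      case False
      then have S': "S = insert v P" using S by blast
      then have "?\<zeta>(v := ?\<eta> v) = ?\<xi>" using ins(2) by simp
      then show ?thesis using S' by (simp add: min.commute power2_commute)
    qed
    finally show "w \<sigma> * w \<tau> * (f ?\<xi> - f ?\<xi>')\<^sup>2 \<le> G (\<phi> (\<sigma>, \<tau>))"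
      by (simp add: G_def \<phi>_def)
  qed
  also have "\<dots> = (\<Sum>p\<in>C \<times> C. G p)"
    by (rule sum.reindex_bij_witness[of _ \<phi> \<phi>]) (use \<phi>\<phi> \<phi>C in auto)
  also have "\<dots> \<le> (\<Sum>(\<xi>, \<eta>)\<in>C \<times> C. M * w \<eta> * (if flip v \<xi> \<in> C
        then min (w \<xi>) (w (flip v \<xi>)) * (f \<xi> - f (flip v \<xi>))\<^sup>2 else 0))"
  proof (rule sum_mono, clarify)
    fix \<xi> \<eta> assume xe: "\<xi> \<in> C" "\<eta> \<in> C"
    show "G (\<xi>, \<eta>) \<le> M * w \<eta> * (if flip v \<xi> \<in> C
        then min (w \<xi>) (w (flip v \<xi>)) * (f \<xi> - f (flip v \<xi>))\<^sup>2 else 0)"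
    proof (cases "\<eta> v = \<xi> v")
      case True
      then show ?thesis using M w_pos xe by (simp add: G_def less_imp_le)
    next
      case False
      then have "\<eta> v = - \<xi> v" using vals[OF xe(1)] vals[OF xe(2)] by auto
      then have "\<xi>(v := \<eta> v) = flip v \<xi>" by (simp add: flip_def)
      moreover have "\<xi>(v := \<eta> v) = override_on \<xi> \<eta> {v}"
        by (auto simp: override_on_def fun_eq_iff)
      ultimately show ?thesis using mix[OF xe, of "{v}"] by (simp add: G_def)
    qed
  qed
  also have "\<dots> = M * (\<Sum>\<sigma>\<in>C. w \<sigma>) * (\<Sum>\<xi>\<in>C. if flip v \<xi> \<in> C
        then min (w \<xi>) (w (flip v \<xi>)) * (f \<xi> - f (flip v \<xi>))\<^sup>2 else 0)"
    by (subst sum.cartesian_product[symmetric])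
       (simp add: sum_distrib_right[symmetric] sum_distrib_left[symmetric] mult.assoc)
  also have "(\<Sum>\<xi>\<in>C. if flip v \<xi> \<in> C
        then min (w \<xi>) (w (flip v \<xi>)) * (f \<xi> - f (flip v \<xi>))\<^sup>2 else 0)
     = (\<Sum>\<sigma>\<in>flippable v. min (w \<sigma>) (w (flip v \<sigma>)) * (f \<sigma> - f (flip v \<sigma>))\<^sup>2)"
    using finite_C by (simp add: sum.If_cases flippable_def Int_def)
  finally show ?thesis .
qed

lemma variance_eq_double_sum:
  assumes "(\<Sum>\<sigma>\<in>C. w \<sigma> * f \<sigma>) = 0"
  shows "(\<Sum>(\<sigma>, \<tau>)\<in>C \<times> C. w \<sigma> * w \<tau> * (f \<sigma> - f \<tau>)\<^sup>2)
    = 2 * (\<Sum>\<sigma>\<in>C. w \<sigma>) * (\<Sum>\<sigma>\<in>C. w \<sigma> * (f \<sigma>)\<^sup>2)"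
proof -
  have "(\<Sum>(\<sigma>, \<tau>)\<in>C \<times> C. w \<sigma> * w \<tau> * (f \<sigma> - f \<tau>)\<^sup>2) =
     (\<Sum>\<sigma>\<in>C. \<Sum>\<tau>\<in>C. (w \<sigma> * (f \<sigma>)\<^sup>2) * w \<tau> + w \<sigma> * (w \<tau> * (f \<tau>)\<^sup>2)
        - 2 * ((w \<sigma> * f \<sigma>) * (w \<tau> * f \<tau>)))"
    by (subst sum.cartesian_product[symmetric])
       (intro sum.cong refl, simp add: power2_eq_square algebra_simps)
  also have "\<dots> = 2 * (\<Sum>\<sigma>\<in>C. w \<sigma>) * (\<Sum>\<sigma>\<in>C. w \<sigma> * (f \<sigma>)\<^sup>2)
        - 2 * ((\<Sum>\<sigma>\<in>C. w \<sigma> * f \<sigma>) * (\<Sum>\<sigma>\<in>C. w \<sigma> * f \<sigma>))"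
    by (simp add: sum.distrib sum_subtractf sum_distrib_left[symmetric] sum_distrib_right[symmetric])
  finally show ?thesis using assms by simp
qed

text \<open>
  Canonical paths with the sites flipped one at a time in the order of \<open>key\<close>. The mixture that
  encodes a path through the edge at \<open>v\<close> may be cut just before or just after \<open>v\<close>; this freedom is
  what makes a coupling between consecutive sites cost \<open>2\<bar>J\<bar>\<close> instead of \<open>4\<bar>J\<bar>\<close>.
\<close>

lemma poincare_canonical_paths:
  fixes key :: "'a \<Rightarrow> nat"
  defines "P \<equiv> \<lambda>v. {u \<in> V. key u < key v}"
  assumes inj: "inj_on key V" and key_less: "\<And>v. v \<in> V \<Longrightarrow> key v < B"
    and vals: "\<And>\<sigma> v. \<sigma> \<in> C \<Longrightarrow> v \<in> V \<Longrightarrow> \<sigma> v \<in> {-1, 1}"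
    and outside: "\<And>\<sigma> \<tau> v. \<sigma> \<in> C \<Longrightarrow> \<tau> \<in> C \<Longrightarrow> v \<notin> V \<Longrightarrow> \<sigma> v = \<tau> v"
    and mix: "\<And>\<sigma> \<tau> S. \<sigma> \<in> C \<Longrightarrow> \<tau> \<in> C \<Longrightarrow> override_on \<sigma> \<tau> S \<in> C"
    and M: "0 \<le> M"
    and le: "\<And>v. v \<in> V \<Longrightarrow> \<exists>S\<in>{P v, insert v (P v)}. \<forall>\<sigma>\<in>C. \<forall>\<tau>\<in>C.
        w \<sigma> * w \<tau> \<le> M * w (override_on \<tau> \<sigma> S) *
          min (w (override_on \<sigma> \<tau> (P v))) (w (override_on \<sigma> \<tau> (insert v (P v))))"
    and mean: "(\<Sum>\<sigma>\<in>C. w \<sigma> * f \<sigma>) = 0"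
  shows "(\<Sum>\<sigma>\<in>C. w \<sigma> * (f \<sigma>)\<^sup>2) \<le> 2 * B * M * (\<Sum>v\<in>V. \<Sum>\<sigma>\<in>C. w \<sigma> * f \<sigma> * (f \<sigma> - heat v f \<sigma>))"
proof (cases "C = {}")
  case False
  \<comment> \<open>The path is indexed by all values below \<open>B\<close>, not by the sites; at a
    value that is not a key nothing moves and the term vanishes. This is why \<open>B\<close> is the
    factor from Cauchy-Schwarz.\<close>
  define Q where "Q n = {u \<in> V. key u < n}" for n
  define a where "a n = (\<Sum>(\<sigma>, \<tau>)\<in>C \<times> C. w \<sigma> * w \<tau> *
     (f (override_on \<sigma> \<tau> (Q n)) - f (override_on \<sigma> \<tau> (Q (Suc n))))\<^sup>2)" for n
  let ?Z = "\<Sum>\<sigma>\<in>C. w \<sigma>" and ?D = "\<lambda>v. \<Sum>\<sigma>\<in>C. w \<sigma> * f \<sigma> * (f \<sigma> - heat v f \<sigma>)"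
  have Z: "?Z > 0" using False finite_C w_pos by (intro sum_pos) auto
  have QS: "Q (Suc (key v)) = insert v (P v)" "Q (key v) = P v" if "v \<in> V" for v
    using that inj by (auto simp: Q_def P_def less_Suc_eq dest: inj_onD)
  have Q0: "Q (Suc n) = Q n" if "n \<notin> key ` V" for n
    using that by (auto simp: Q_def less_Suc_eq)
  have "2 * ?Z * (\<Sum>\<sigma>\<in>C. w \<sigma> * (f \<sigma>)\<^sup>2) = (\<Sum>(\<sigma>, \<tau>)\<in>C \<times> C. w \<sigma> * w \<tau> * (f \<sigma> - f \<tau>)\<^sup>2)"
    using variance_eq_double_sum[OF mean] by simp
  also have "\<dots> \<le> (\<Sum>(\<sigma>, \<tau>)\<in>C \<times> C. w \<sigma> * w \<tau> * (B * (\<Sum>n<B.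
     (f (override_on \<sigma> \<tau> (Q n)) - f (override_on \<sigma> \<tau> (Q (Suc n))))\<^sup>2)))"
  proof (rule sum_mono, clarify)
    fix \<sigma> \<tau> assume st: "\<sigma> \<in> C" "\<tau> \<in> C"
    let ?d = "\<lambda>n. f (override_on \<sigma> \<tau> (Q n)) - f (override_on \<sigma> \<tau> (Q (Suc n)))"
    have "override_on \<sigma> \<tau> (Q 0) = \<sigma>" by (simp add: Q_def)
    moreover have "Q B = V" using key_less by (auto simp: Q_def)
    then have "override_on \<sigma> \<tau> (Q B) = \<tau>" 
      using outside[OF st] by (auto simp: override_on_def fun_eq_iff)
    ultimately have "f \<sigma> - f \<tau> = (\<Sum>n<B. ?d n)"
      using sum_lessThan_telescope'[of "\<lambda>n. f (override_on \<sigma> \<tau> (Q n))" B] by simp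
    then have "(f \<sigma> - f \<tau>)\<^sup>2 \<le> B * (\<Sum>n<B. (?d n)\<^sup>2)"
      using Cauchy_Schwarz_ineq_sum[of "\<lambda>_. 1" ?d "{..<B}"] by simp
    then show "w \<sigma> * w \<tau> * (f \<sigma> - f \<tau>)\<^sup>2 \<le> w \<sigma> * w \<tau> * (B * (\<Sum>n<B. (?d n)\<^sup>2))"
      using w_pos st by (intro mult_left_mono) (auto simp: less_imp_le)
  qed
  also have "\<dots> = B * (\<Sum>n<B. a n)"
    unfolding a_def by (subst sum.swap)
      (simp add: sum_distrib_left case_prod_unfold mult.left_commute)
  also have "(\<Sum>n<B. a n) = (\<Sum>n\<in>key ` V. a n)"
    using key_less Q0 by (intro sum.mono_neutral_right) (auto simp: a_def case_prod_unfold)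
  also have "\<dots> = (\<Sum>v\<in>V. a (key v))"
    using inj by (simp add: sum.reindex)
  also have "\<dots> \<le> (\<Sum>v\<in>V. M * ?Z * (4 * ?D v))"
  proof (rule sum_mono)
    fix v assume v: "v \<in> V"
    then obtain S where S: "S = P v \<or> S = insert v (P v)" and leS:
      "\<And>\<sigma> \<tau>. \<sigma> \<in> C \<Longrightarrow> \<tau> \<in> C \<Longrightarrow> w \<sigma> * w \<tau> \<le> M * w (override_on \<tau> \<sigma> S) *
          min (w (override_on \<sigma> \<tau> (P v))) (w (override_on \<sigma> \<tau> (insert v (P v))))"
      using le[OF v] by blast
    have "a (key v) \<le> M * ?Z *
       (\<Sum>\<sigma>\<in>flippable v. min (w \<sigma>) (w (flip v \<sigma>)) * (f \<sigma> - f (flip v \<sigma>))\<^sup>2)"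
      unfolding a_def QS[OF v]
      by (rule canonical_path_congestion) (use vals v mix S M leS in \<open>auto simp: P_def\<close>)
    also have "\<dots> \<le> M * ?Z * (4 * ?D v)"
      using M Z by (intro mult_left_mono dirichlet_form_ge) simp
    finally show "a (key v) \<le> M * ?Z * (4 * ?D v)" .
  qed
  also have "(\<Sum>v\<in>V. M * ?Z * (4 * ?D v)) = M * ?Z * (4 * (\<Sum>v\<in>V. ?D v))"
    by (simp only: sum_distrib_left)
  finally have "2 * ?Z * (\<Sum>\<sigma>\<in>C. w \<sigma> * (f \<sigma>)\<^sup>2) \<le> B * (M * ?Z * (4 * (\<Sum>v\<in>V. ?D v)))"
    by (simp add: mult_left_mono)
  also have "\<dots> = 2 * ?Z * (2 * B * M * (\<Sum>v\<in>V. ?D v))" by simp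
  finally have "2 * ?Z * (\<Sum>\<sigma>\<in>C. w \<sigma> * (f \<sigma>)\<^sup>2) \<le> 2 * ?Z * (2 * B * M * (\<Sum>v\<in>V. ?D v))" .
  then show ?thesis by (subst (asm) mult_le_cancel_left_pos) (use Z in auto)
qed simp

end

section \<open>The Poisson clocks\<close>

abbreviation mark_law :: "(real \<times> real) measure" where
  "mark_law \<equiv> density lborel (\<lambda>x. ennreal (exponential_density 1 x)) \<Otimes>\<^sub>M uniform_measure lborel {0..1}"

lemma prob_space_uniform01: "prob_space (uniform_measure lborel {0..1::real})"
  by (rule prob_space_uniform_measure) auto

interpretation mark: prob_space mark_law
proof -
  have "prob_space (density lborel (\<lambda>x. ennreal (exponential_density 1 x)))"
    by (rule prob_space_exponential_density) simp
  then show "prob_space mark_law"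
    using prob_space_uniform01 by (rule prob_space_pair)
qed

interpretation marks: sequence_space mark_law ..

abbreviation mark_seq :: "(nat \<Rightarrow> real \<times> real) measure" where
  "mark_seq \<equiv> \<Pi>\<^sub>M k\<in>UNIV. mark_law"

lemma prob_space_mark_seq: "prob_space mark_seq"
  by (rule prob_space_PiM) (rule mark.prob_space_axioms)

interpretation seqs: product_prob_space "\<lambda>_. mark_seq" "UNIV :: nat set"
  by (intro product_prob_spaceI prob_space_mark_seq)

lemma clock_space_eq: "clock_space N = (\<Pi>\<^sub>M v\<in>{1..N}. mark_seq)"
  by (simp add: clock_space_def)

lemma prob_space_clock: "prob_space (clock_space N)"
  unfolding clock_space_eq by (rule prob_space_PiM) (rule prob_space_mark_seq)

section \<open>Splitting off the first mark of a clock\<close>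

definition push :: "nat \<Rightarrow> real \<times> real \<Rightarrow> (nat \<Rightarrow> nat \<Rightarrow> real \<times> real) \<Rightarrow> nat \<Rightarrow> nat \<Rightarrow> real \<times> real" where
  "push v y \<omega> = (\<omega>)(v := case_nat y (\<omega> v))"

definition pop :: "nat \<Rightarrow> (nat \<Rightarrow> nat \<Rightarrow> real \<times> real) \<Rightarrow> nat \<Rightarrow> nat \<Rightarrow> real \<times> real" where
  "pop v \<omega> = (\<omega>)(v := \<lambda>k. \<omega> v (Suc k))"

lemma pop_push [simp]: "pop v (push v y \<omega>) = \<omega>"
  by (auto simp: push_def pop_def fun_eq_iff)

lemma push_head [simp]: "push v y \<omega> v 0 = y"
  by (simp add: push_def)

lemma sets_mark_law [measurable_cong]: "sets mark_law = sets borel"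
  by (simp add: borel_prod[symmetric] cong: sets_pair_measure_cong)

lemma space_mark_seq [simp]: "space mark_seq = UNIV"
  by (simp add: space_PiM space_pair_measure)

lemma measurable_clock_component:
  "(\<lambda>\<omega>. \<omega> v k) \<in> clock_space N \<rightarrow>\<^sub>M borel"
proof (cases "v \<in> {1..N}")
  case True
  then have "(\<lambda>\<omega>. \<omega> v) \<in> clock_space N \<rightarrow>\<^sub>M mark_seq"
    unfolding clock_space_eq by (rule measurable_component_singleton)
  from measurable_compose[OF this measurable_component_singleton[of k]]
  show ?thesis using measurable_cong_sets[OF refl sets_mark_law] by blast
next
  case False
  \<comment> \<open>Points of the product are extensional, so a coordinate outside the sites is
    constant. Later measurability proofs can then quantify over all \<open>v\<close>.\<close>
  then have "\<omega> v = undefined" if "\<omega> \<in> space (clock_space N)" for \<omega>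
    using that by (auto simp: clock_space_eq space_PiM PiE_def extensional_def)
  then show ?thesis by (subst measurable_cong[of _ _ "\<lambda>_. undefined k"]) auto
qed

lemma measurable_push:
  assumes v: "v \<in> {1..N}"
  shows "(\<lambda>(y, \<omega>). push v y \<omega>) \<in> mark_law \<Otimes>\<^sub>M clock_space N \<rightarrow>\<^sub>M clock_space N"
  unfolding push_def clock_space_eq
proof (rule measurable_PiM_single')
  fix i assume i: "i \<in> {1..N}"
  show "(\<lambda>x. (case x of (y, \<omega>) \<Rightarrow> (\<omega>)(v := case_nat y (\<omega> v))) i) \<in> mark_law \<Otimes>\<^sub>M (\<Pi>\<^sub>M v\<in>{1..N}. mark_seq) \<rightarrow>\<^sub>M mark_seq"
  proof (cases "i = v")
    case True
    show ?thesis unfolding True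
      using v by (auto simp: case_prod_unfold)
  next
    case False
    then show ?thesis using i by (simp add: case_prod_unfold)
  qed
next
  show "(\<lambda>(y, \<omega>). (\<omega>)(v := case_nat y (\<omega> v))) \<in> space (mark_law \<Otimes>\<^sub>M (\<Pi>\<^sub>M v\<in>{1..N}. mark_seq)) \<rightarrow> (\<Pi>\<^sub>E i\<in>{1..N}. space mark_seq)"
    using v by (auto simp: space_pair_measure space_PiM PiE_def extensional_def split: nat.splits)
qed

text \<open>The marks of a clock are i.i.d., so a fresh mark followed by an old sequence has the law
  of the sequence, and the other clocks are untouched. This is what lets the first ring be
  integrated out by Fubini. Rectangles determine the law, as there are finitely many sites.\<close>

lemma distr_push:
  assumes v: "v \<in> {1..N}"
  shows "distr (mark_law \<Otimes>\<^sub>M clock_space N) (clock_space N) (\<lambda>(y, \<omega>). push v y \<omega>) = clock_space N"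
    (is "?D = _")
proof (subst (3) clock_space_eq, rule seqs.PiM_eqI)
  interpret C: prob_space "clock_space N" by (rule prob_space_clock)
  interpret MC: pair_prob_space mark_law "clock_space N" ..
  show "finite {1..N}" by simp
  show "sets ?D = sets (\<Pi>\<^sub>M v\<in>{1..N}. mark_seq)" by (simp add: clock_space_eq)
  fix A assume A: "\<And>i. i \<in> {1..N} \<Longrightarrow> A i \<in> sets mark_seq"
  have pw: "push v y \<omega> \<in> Pi\<^sub>E {1..N} A \<longleftrightarrow>
      \<omega> \<in> Pi\<^sub>E {1..N} (A(v := {f \<in> space mark_seq. case_nat y f \<in> A v}))"
    if "\<omega> \<in> space (clock_space N)" for y \<omega>
    using that v by (auto simp: push_def PiE_iff clock_space_eq space_PiM extensional_def)
  have cn: "(\<lambda>f. case_nat y f) \<in> mark_seq \<rightarrow>\<^sub>M mark_seq" for y :: "real \<times> real"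
    by (rule measurable_case_nat') (auto simp: space_pair_measure)
  show "emeasure ?D (Pi\<^sub>E {1..N} A) = (\<Prod>i\<in>{1..N}. emeasure mark_seq (A i))"
  proof -
    let ?f = "\<lambda>(y, \<omega>). push v y \<omega>" and ?P = "Pi\<^sub>E {1..N} A"
    let ?B = "\<lambda>y. {f \<in> space mark_seq. case_nat y f \<in> A v}"
    let ?c = "\<Prod>i\<in>{1..N} - {v}. emeasure mark_seq (A i)"
    have P: "?P \<in> sets (clock_space N)"
      unfolding clock_space_eq using A by (intro sets_PiM_I_finite) auto
    have B: "?B y \<in> sets mark_seq" for y
      using measurable_sets[OF cn A[OF v], of y] by (simp add: vimage_def Int_def conj_commute)
    have AB: "(A(v := ?B y)) i \<in> sets mark_seq" if "i \<in> {1..N}" for i y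
      using A B that by auto
    have slice: "Pair y -` (?f -` ?P \<inter> space (mark_law \<Otimes>\<^sub>M clock_space N)) = Pi\<^sub>E {1..N} (A(v := ?B y))"
      for y
    proof -
      have "Pi\<^sub>E {1..N} (A(v := ?B y)) \<subseteq> space (clock_space N)"
        by (auto simp: clock_space_eq space_PiM[of _ "\<lambda>_. mark_seq"] PiE_iff simp del: atLeastAtMost_iff)
      moreover have "\<omega> \<in> Pair y -` (?f -` ?P \<inter> space (mark_law \<Otimes>\<^sub>M clock_space N)) \<longleftrightarrow>
          push v y \<omega> \<in> ?P \<and> \<omega> \<in> space (clock_space N)" for \<omega>
        by (simp add: space_pair_measure mem_Times_iff del: PiE_iff)
      ultimately show ?thesis
        using pw[of _ y] by (intro set_eqI) (meson subsetD)
    qed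
    let ?X = "(\<lambda>(y, f). case_nat y f) -` A v \<inter> space (mark_law \<Otimes>\<^sub>M mark_seq)"
    have X: "?X \<in> sets (mark_law \<Otimes>\<^sub>M mark_seq)"
      using A[OF v] by measurable
    have sliceX: "Pair y -` ?X = ?B y" for y
      by (auto simp: space_pair_measure)
    have "emeasure mark_seq (A v) = emeasure (distr (mark_law \<Otimes>\<^sub>M mark_seq) mark_seq (\<lambda>(y, f). case_nat y f)) (A v)"
      by (simp only: marks.PiM_iter)
    also have "\<dots> = emeasure (mark_law \<Otimes>\<^sub>M mark_seq) ?X"
      using A[OF v] by (subst emeasure_distr) auto
    also have "\<dots> = (\<integral>\<^sup>+ y. emeasure mark_seq (Pair y -` ?X) \<partial>mark_law)"
      by (rule marks.P.emeasure_pair_measure_alt[OF X])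
    also have "\<dots> = (\<integral>\<^sup>+ y. emeasure mark_seq (?B y) \<partial>mark_law)"
      by (simp only: sliceX)
    finally have iter: "(\<integral>\<^sup>+ y. emeasure mark_seq (?B y) \<partial>mark_law) = emeasure mark_seq (A v)" ..
    have "emeasure ?D ?P = emeasure (mark_law \<Otimes>\<^sub>M clock_space N) (?f -` ?P \<inter> space (mark_law \<Otimes>\<^sub>M clock_space N))"
      by (rule emeasure_distr[OF measurable_push[OF v] P])
    also have "\<dots> = (\<integral>\<^sup>+ y. emeasure (clock_space N) (Pi\<^sub>E {1..N} (A(v := ?B y))) \<partial>mark_law)"
      using C.emeasure_pair_measure_alt[OF measurable_sets[OF measurable_push[OF v] P]]
      by (simp only: slice)
    also have "\<dots> = (\<integral>\<^sup>+ y. emeasure mark_seq (?B y) * ?c \<partial>mark_law)"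
    proof (rule nn_integral_cong)
      fix y
      have "emeasure (clock_space N) (Pi\<^sub>E {1..N} (A(v := ?B y))) = (\<Prod>i\<in>{1..N}. emeasure mark_seq ((A(v := ?B y)) i))"
        unfolding clock_space_eq by (rule seqs.emeasure_PiM) (use AB in auto)
      also have "\<dots> = emeasure mark_seq (?B y) * ?c"
        using v by (subst prod.remove[of _ v]) (auto intro!: arg_cong2[where f = "(*)"] prod.cong)
      finally show "emeasure (clock_space N) (Pi\<^sub>E {1..N} (A(v := ?B y))) = emeasure mark_seq (?B y) * ?c" .
    qed
    also have "\<dots> = (\<integral>\<^sup>+ y. emeasure mark_seq (?B y) \<partial>mark_law) * ?c"
      using marks.P.measurable_emeasure_Pair[OF X] by (intro nn_integral_multc) (simp only: sliceX)
    also have "\<dots> = (\<Prod>i\<in>{1..N}. emeasure mark_seq (A i))"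
      unfolding iter using v by (simp add: prod.remove[of _ v])
    finally show ?thesis .
  qed
qed

text \<open>
  \<open>follows N t vs r s \<omega>\<close>: if the pending waiting time at \<open>u\<close> started at time \<open>s u\<close>, then the rings in
  \<open>{r<..t}\<close> occur, in this order, at the sites \<open>vs\<close>.
\<close>

fun follows :: "nat \<Rightarrow> real \<Rightarrow> nat list \<Rightarrow> real \<Rightarrow> (nat \<Rightarrow> real) \<Rightarrow> (nat \<Rightarrow> nat \<Rightarrow> real \<times> real) \<Rightarrow> bool" where
  "follows N t [] r s \<omega> \<longleftrightarrow> (\<forall>u\<in>{1..N}. t < s u + fst (\<omega> u 0))"
| "follows N t (v # vs) r s \<omega> \<longleftrightarrow>
     r < s v + fst (\<omega> v 0) \<and> s v + fst (\<omega> v 0) \<le> t \<and>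
     follows N t vs (s v + fst (\<omega> v 0)) (s(v := s v + fst (\<omega> v 0))) (pop v \<omega>)"

text \<open>An update with two outcomes, chosen by comparing a uniform variable with a threshold. It
  is instantiated by the restricted dynamics, the unrestricted dynamics and an auxiliary chain on
  \<open>bool\<close>.\<close>

locale two_way_step =
  fixes p :: "nat \<Rightarrow> 's \<Rightarrow> real" and G1 G2 :: "nat \<Rightarrow> 's \<Rightarrow> 's"
  assumes p: "0 \<le> p v \<sigma>" "p v \<sigma> \<le> 1"
begin

definition step :: "nat \<Rightarrow> real \<Rightarrow> 's \<Rightarrow> 's" where
  "step v u \<sigma> = (if u \<le> p v \<sigma> then G1 v \<sigma> else G2 v \<sigma>)"

text \<open>Uses the first mark of a site and deletes it, so that the recursion runs parallel to
  \<open>follows\<close>. \<open>follows_label\<close> relates it to the fold over indexed rings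
  that defines \<open>glauber\<close>.\<close>

fun replay :: "nat list \<Rightarrow> 's \<Rightarrow> (nat \<Rightarrow> nat \<Rightarrow> real \<times> real) \<Rightarrow> 's" where
  "replay [] \<sigma> \<omega> = \<sigma>"
| "replay (v # vs) \<sigma> \<omega> = replay vs (step v (snd (\<omega> v 0)) \<sigma>) (pop v \<omega>)"

definition avg :: "nat \<Rightarrow> ('s \<Rightarrow> real) \<Rightarrow> 's \<Rightarrow> real" where
  "avg v f \<sigma> = p v \<sigma> * f (G1 v \<sigma>) + (1 - p v \<sigma>) * f (G2 v \<sigma>)"

end

section \<open>Probability that the rings follow a prescribed list of sites\<close>

lemma measurable_fst_borel: "(fst :: real \<times> real \<Rightarrow> real) \<in> borel_measurable borel"
  and measurable_snd_borel: "(snd :: real \<times> real \<Rightarrow> real) \<in> borel_measurable borel"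
  by (simp_all add: borel_prod[symmetric])

text \<open>The start times and the clocks are themselves functions of the sample point, because
  each step of the recursion replaces them by random quantities.\<close>

lemma measurable_follows:
  assumes "set vs \<subseteq> {1..N}" and "r \<in> borel_measurable M"
    and "\<And>u. (\<lambda>z. s z u) \<in> borel_measurable M"
    and "\<And>u k. (\<lambda>z. W z u k) \<in> M \<rightarrow>\<^sub>M borel"
  shows "Measurable.pred M (\<lambda>z. follows N t vs (r z) (s z) (W z))"
  using assms
proof (induction vs arbitrary: r s W)
  case Nil
  have [measurable]: "(\<lambda>z. fst (W z u k)) \<in> borel_measurable M" for u k
    by (rule measurable_compose[OF Nil(4) measurable_fst_borel])
  note Nil(3)[measurable]
  show ?case by simp
next
  case (Cons v vs)
  have [measurable]: "(\<lambda>z. fst (W z u k)) \<in> borel_measurable M" for u k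
    by (rule measurable_compose[OF Cons(5) measurable_fst_borel])
  note Cons(3)[measurable] Cons(4)[measurable]
  have [measurable]: "Measurable.pred M (\<lambda>z. follows N t vs (s z v + fst (W z v 0))
      ((s z)(v := s z v + fst (W z v 0))) (pop v (W z)))"
  proof (rule Cons.IH)
    show "(\<lambda>z. ((s z)(v := s z v + fst (W z v 0))) u) \<in> borel_measurable M" for u
      by (cases "u = v") simp_all
    show "(\<lambda>z. pop v (W z) u k) \<in> M \<rightarrow>\<^sub>M borel" for u k
      using Cons(5) by (cases "u = v") (simp_all add: pop_def)
  qed (use Cons(2) in auto)
  show ?case by simp
qed

lemma (in two_way_step) measurable_replay:
  assumes "\<And>u k. (\<lambda>z. W z u k) \<in> M \<rightarrow>\<^sub>M borel"
  shows "Measurable.pred M (\<lambda>z. replay vs \<sigma> (W z) \<in> A)"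
  using assms
proof (induction vs arbitrary: \<sigma> W)
  case (Cons v vs)
  have [measurable]: "(\<lambda>z. snd (W z u k)) \<in> borel_measurable M" for u k
    by (rule measurable_compose[OF Cons(2) measurable_snd_borel])
  have [measurable]: "Measurable.pred M (\<lambda>z. replay vs \<sigma>' (pop v (W z)) \<in> A)" for \<sigma>'
  proof (rule Cons.IH)
    show "(\<lambda>z. pop v (W z) u k) \<in> M \<rightarrow>\<^sub>M borel" for u k
      using Cons(2) by (cases "u = v") (simp_all add: pop_def)
  qed
  have "(replay (v # vs) \<sigma> (W z) \<in> A) \<longleftrightarrow>
     (if snd (W z v 0) \<le> p v \<sigma> then replay vs (G1 v \<sigma>) (pop v (W z)) \<in> A
      else replay vs (G2 v \<sigma>) (pop v (W z)) \<in> A)" for z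
    by (simp add: step_def)
  then show ?case by simp
qed simp

lemma emeasure_exponential_gt:
  assumes "0 \<le> c"
  shows "emeasure (density lborel (\<lambda>x. ennreal (exponential_density 1 x))) {c<..} = ennreal (exp (- c))"
proof -
  let ?E = "density lborel (\<lambda>x. ennreal (exponential_density 1 x))"
  interpret E: prob_space ?E by (rule prob_space_exponential_density) simp
  have "distributed ?E lborel (\<lambda>x. x) (exponential_density 1)"
    by (auto simp: distributed_def intro!: distr_id2)
  from E.exponential_distributedD_gt[OF this assms]
  have "measure ?E {c<..} = exp (- c)" by (simp add: greaterThan_def)
  then show ?thesis by (simp add: E.emeasure_eq_measure)
qed

lemma emeasure_mark_gt:
  assumes "0 \<le> c"
  shows "emeasure mark_law {y. c < fst y} = ennreal (exp (- c))"
proof -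
  interpret U: prob_space "uniform_measure lborel {0..1::real}" by (rule prob_space_uniform01)
  have "{y :: real \<times> real. c < fst y} = {c<..} \<times> UNIV" by auto
  then have "emeasure mark_law {y. c < fst y} =
     emeasure (density lborel (\<lambda>x. ennreal (exponential_density 1 x))) {c<..} *
     emeasure (uniform_measure lborel {0..1::real}) UNIV"
    by (simp add: U.emeasure_pair_measure_Times)
  then show ?thesis
    using emeasure_exponential_gt[OF assms] U.emeasure_space_1 by simp
qed

lemma emeasure_no_ring:
  assumes "\<And>u. u \<in> {1..N} \<Longrightarrow> s u \<le> t"
  shows "emeasure (clock_space N) {\<omega> \<in> space (clock_space N). \<forall>u\<in>{1..N}. t < s u + fst (\<omega> u 0)}
     = ennreal (exp (- (\<Sum>u\<in>{1..N}. t - s u)))"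
proof -
  let ?A = "\<lambda>u. {f \<in> space mark_seq. f 0 \<in> {y. t - s u < fst y}}"
  have B: "{y :: real \<times> real. c < fst y} \<in> sets mark_law" for c
    unfolding sets_mark_law
    using measurable_sets[OF measurable_fst_borel, of "{c<..}"] by (simp add: vimage_def)
  have A: "?A u \<in> sets mark_seq" for u
    using B[of "t - s u"] by measurable
  have comp: "emeasure mark_seq (?A u) = ennreal (exp (- (t - s u)))" if "u \<in> {1..N}" for u
  proof -
    have "emeasure mark_law {y. t - s u < fst y} = emeasure (distr mark_seq mark_law (\<lambda>f. f 0)) {y. t - s u < fst y}"
      by (subst marks.PiM_component) auto
    also have "\<dots> = emeasure mark_seq (?A u)"
      using B[of "t - s u"] by (subst emeasure_distr) (auto intro!: arg_cong[where f = "emeasure mark_seq"])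
    finally show ?thesis using emeasure_mark_gt[of "t - s u"] assms[OF that] by simp
  qed
  have "{\<omega> \<in> space (clock_space N). \<forall>u\<in>{1..N}. t < s u + fst (\<omega> u 0)} = Pi\<^sub>E {1..N} ?A"
    by (auto simp: clock_space_eq space_PiM[of _ "\<lambda>_. mark_seq"] PiE_iff extensional_def algebra_simps)
  then have "emeasure (clock_space N) {\<omega> \<in> space (clock_space N). \<forall>u\<in>{1..N}. t < s u + fst (\<omega> u 0)}
     = (\<Prod>u\<in>{1..N}. emeasure mark_seq (?A u))"
    using A unfolding clock_space_eq by (simp add: seqs.emeasure_PiM)
  also have "\<dots> = (\<Prod>u\<in>{1..N}. ennreal (exp (- (t - s u))))"
    by (intro prod.cong refl comp)
  finally show ?thesis
    by (simp add: prod_ennreal exp_sum[symmetric] sum_negf[symmetric] del: minus_diff_eq)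
qed

text \<open>The iterated integral behind the Poisson weights: one more ring turns
  \<open>(b - x)^n / n!\<close> into \<open>(b - a)^(n+1) / (n+1)!\<close>.\<close>

lemma nn_integral_power_segment:
  fixes a b c :: real
  assumes "a \<le> b" "0 \<le> c"
  shows "(\<integral>\<^sup>+ x. ennreal (c * (b - x) ^ n / fact n) * indicator {a<..b} x \<partial>lborel)
     = ennreal (c * (b - a) ^ Suc n / fact (Suc n))"
proof -
  let ?F = "\<lambda>x. - (c * (b - x) ^ Suc n / fact (Suc n))"
  have D: "(?F has_real_derivative c * (b - x) ^ n / fact n) (at x)" for x
  proof -
    have "((\<lambda>x. b - x) has_real_derivative - 1) (at x)"
      by (auto intro!: derivative_eq_intros)
    from DERIV_minus[OF DERIV_cdivide[OF DERIV_cmult[OF DERIV_power[OF this, of "Suc n"], of c], of "fact (Suc n)"]]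
    have "(?F has_real_derivative - (c * (real (Suc n) * (- 1 * (b - x) ^ n)) / fact (Suc n))) (at x)"
      by (simp only: diff_Suc_Suc diff_zero)
    also have "- (c * (real (Suc n) * (- 1 * (b - x) ^ n)) / fact (Suc n)) = c * (b - x) ^ n / fact n"
      by (simp add: field_simps del: of_nat_Suc)
    finally show ?thesis .
  qed
  have "(\<integral>\<^sup>+ x. ennreal (c * (b - x) ^ n / fact n) * indicator {a<..b} x \<partial>lborel) =
     (\<integral>\<^sup>+ x. ennreal (c * (b - x) ^ n / fact n) * indicator {a..b} x \<partial>lborel)"
    by (rule nn_integral_cong_AE)
       (use AE_lborel_singleton[of a] in eventually_elim, auto split: split_indicator)
  also have "\<dots> = ennreal (?F b - ?F a)"
    using assms D by (intro nn_integral_FTC_Icc) (auto intro: DERIV_subset)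
  finally show ?thesis by simp
qed

context two_way_step
begin

lemma nn_integral_step:
  assumes f: "\<And>\<sigma>. 0 \<le> f \<sigma>"
  shows "(\<integral>\<^sup>+ u. ennreal (f (step v u \<sigma>)) \<partial>uniform_measure lborel {0..1}) = ennreal (avg v f \<sigma>)"
proof -
  let ?U = "uniform_measure lborel {0..1::real}"
  have 1: "emeasure ?U {..c} = ennreal c" if "0 \<le> c" "c \<le> 1" for c
  proof -
    have "{0..1} \<inter> {..c} = {0..c}" using that by auto
    then show ?thesis using that by (simp add: emeasure_uniform_measure divide_ennreal_def)
  qed
  have 2: "emeasure ?U {c<..} = ennreal (1 - c)" if "0 \<le> c" "c \<le> 1" for c
  proof -
    have "{0..1} \<inter> {c<..} = {c<..1}" using that by auto
    then show ?thesis using that by (simp add: emeasure_uniform_measure divide_ennreal_def)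
  qed
  let ?c = "p v \<sigma>"
  have "(\<integral>\<^sup>+ u. ennreal (f (step v u \<sigma>)) \<partial>?U) =
     (\<integral>\<^sup>+ u. ennreal (f (G1 v \<sigma>)) * indicator {..?c} u + ennreal (f (G2 v \<sigma>)) * indicator {?c<..} u \<partial>?U)"
    by (intro nn_integral_cong) (auto simp: step_def split: split_indicator)
  also have "\<dots> = ennreal (f (G1 v \<sigma>)) * emeasure ?U {..?c} + ennreal (f (G2 v \<sigma>)) * emeasure ?U {?c<..}"
    by (subst nn_integral_add) (simp_all add: nn_integral_cmult_indicator del: emeasure_uniform_measure)
  also have "\<dots> = ennreal (f (G1 v \<sigma>)) * ennreal ?c + ennreal (f (G2 v \<sigma>)) * ennreal (1 - ?c)"
    by (simp only: 1[OF p] 2[OF p])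
  also have "\<dots> = ennreal (avg v f \<sigma>)"
    using p f by (simp add: avg_def ennreal_mult'' ennreal_plus mult.commute)
  finally show ?thesis .
qed

lemma avg_nonneg: "(\<And>\<sigma>. 0 \<le> f \<sigma>) \<Longrightarrow> 0 \<le> avg v f \<sigma>"
  using p by (simp add: avg_def)

lemma foldr_avg_nonneg: "(\<And>\<sigma>. 0 \<le> f \<sigma>) \<Longrightarrow> 0 \<le> foldr avg vs f \<sigma>"
  by (induction vs arbitrary: \<sigma>) (auto intro: avg_nonneg)

text \<open>
  By lack of memory, integrating out the pending waiting time at the next site reproduces the same
  formula for the shorter list; the total rate only enters through \<open>\<Sum>u. t - s u\<close>.
\<close>

lemma emeasure_follows_replay:
  assumes "set vs \<subseteq> {1..N}" and "\<And>u. u \<in> {1..N} \<Longrightarrow> s u \<le> r" and "r \<le> t"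
  shows "emeasure (clock_space N)
      {\<omega> \<in> space (clock_space N). follows N t vs r s \<omega> \<and> replay vs \<sigma> \<omega> \<in> A}
    = ennreal (exp (- (\<Sum>u\<in>{1..N}. t - s u)) * (t - r) ^ length vs / fact (length vs)
        * foldr avg vs (indicator A) \<sigma>)"
  using assms
proof (induction vs arbitrary: r s \<sigma>)
  case Nil
  have "emeasure (clock_space N) {\<omega> \<in> space (clock_space N). \<forall>u\<in>{1..N}. t < s u + fst (\<omega> u 0)}
     = ennreal (exp (- (\<Sum>u\<in>{1..N}. t - s u)))"
  proof (rule emeasure_no_ring)
    show "s u \<le> t" if "u \<in> {1..N}" for u
      using Nil(2)[OF that] Nil(3) by linarith
  qed
  then show ?case by (cases "\<sigma> \<in> A") simp_all
next
  case (Cons v vs)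
  let ?C = "clock_space N" and ?n = "length vs" and ?f = "foldr avg vs (indicator A)"
  let ?E = "density lborel (\<lambda>x. ennreal (exponential_density 1 x))" and ?U = "uniform_measure lborel {0..1::real}"
  interpret C: prob_space ?C by (rule prob_space_clock)
  interpret U: prob_space ?U by (rule prob_space_uniform01)
  have v: "v \<in> {1..N}" and vs: "set vs \<subseteq> {1..N}" using Cons.prems by auto
  have sv: "s v \<le> r" using Cons.prems(2)[OF v] .
  define S where "S = (\<Sum>u\<in>{1..N}. t - s u)"
  define X where "X = {\<omega> \<in> space ?C. follows N t (v # vs) r s \<omega> \<and> replay (v # vs) \<sigma> \<omega> \<in> A}"
  define c where "c x = exp (- S) * exp x * (t - s v - x) ^ ?n / fact ?n" for x
  have X: "X \<in> sets ?C"
  proof -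
    have [measurable]: "Measurable.pred ?C (\<lambda>\<omega>. follows N t (v # vs) r s \<omega>)"
      by (rule measurable_follows[OF Cons.prems(1)]) (auto simp: measurable_clock_component)
    have [measurable]: "Measurable.pred ?C (\<lambda>\<omega>. replay (v # vs) \<sigma> \<omega> \<in> A)"
      by (rule measurable_replay) (rule measurable_clock_component)
    show ?thesis unfolding X_def by measurable
  qed
  let ?Y = "(\<lambda>(y, \<omega>). push v y \<omega>) -` X \<inter> space (mark_law \<Otimes>\<^sub>M ?C)"
  have Y: "?Y \<in> sets (mark_law \<Otimes>\<^sub>M ?C)"
    using measurable_push[OF v] X by (rule measurable_sets)
  have slice: "emeasure ?C (Pair y -` ?Y) =
      ennreal (c (fst y)) * indicator {r - s v<..t - s v} (fst y) * ennreal (?f (step v (snd y) \<sigma>))" for y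
  proof -
    obtain x u where y: "y = (x, u)" by (cases y)
    have Y_slice: "Pair y -` ?Y = {\<omega> \<in> space ?C. r < s v + x \<and> s v + x \<le> t \<and>
        follows N t vs (s v + x) (s(v := s v + x)) \<omega> \<and> replay vs (step v u \<sigma>) \<omega> \<in> A}"
      using measurable_space[OF measurable_push[OF v]] unfolding X_def y
      by (auto simp: space_pair_measure)
    have "emeasure ?C {\<omega> \<in> space ?C. r < s v + x \<and> s v + x \<le> t \<and>
        follows N t vs (s v + x) (s(v := s v + x)) \<omega> \<and> replay vs (step v u \<sigma>) \<omega> \<in> A} =
       ennreal (c x) * indicator {r - s v<..t - s v} x * ennreal (?f (step v u \<sigma>))"
    proof (cases "r < s v + x \<and> s v + x \<le> t")
      case True
      have sum: "(\<Sum>w\<in>{1..N}. t - (s(v := s v + x)) w) = S - x"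
      proof -
        have "(\<Sum>w\<in>{1..N} - {v}. t - (s(v := s v + x)) w) = (\<Sum>w\<in>{1..N} - {v}. t - s w)"
          by (intro sum.cong) auto
        then show ?thesis
          unfolding S_def using sum.remove[OF _ v, of "\<lambda>w. t - (s(v := s v + x)) w"]
            sum.remove[OF _ v, of "\<lambda>w. t - s w"] by simp
      qed
      have "emeasure ?C {\<omega> \<in> space ?C. follows N t vs (s v + x) (s(v := s v + x)) \<omega> \<and>
          replay vs (step v u \<sigma>) \<omega> \<in> A} = ennreal (exp (- (S - x)) * (t - (s v + x)) ^ ?n / fact ?n
          * ?f (step v u \<sigma>))"
        unfolding sum[symmetric]
      proof (rule Cons.IH[OF vs])
        fix u assume "u \<in> {1..N}"
        then show "(s(v := s v + x)) u \<le> s v + x"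
          using True Cons.prems(2)[of u] by (cases "u = v") auto
      qed (use True in simp)
      also have "\<dots> = ennreal (c x) * ennreal (?f (step v u \<sigma>))"
      proof -
        have "exp (- (S - x)) = exp (- S) * exp x" "t - (s v + x) = t - s v - x"
          by (simp_all add: exp_add[symmetric])
        then have "exp (- (S - x)) * (t - (s v + x)) ^ ?n / fact ?n = c x"
          by (simp only: c_def)
        moreover have "0 \<le> c x" using True by (simp add: c_def)
        ultimately show ?thesis
          by (simp only: ennreal_mult foldr_avg_nonneg indicator_pos_le)
      qed
      moreover have "indicator {r - s v<..t - s v} x = (1 :: ennreal)"
        using True by (auto simp: indicator_def)
      ultimately show ?thesis
        using True by (simp only: simp_thms mult_1_right)
    next
      case False
      then have "indicator {r - s v<..t - s v} x = (0 :: ennreal)" by (auto simp: indicator_def)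
      moreover have "{\<omega> \<in> space ?C. r < s v + x \<and> s v + x \<le> t \<and> follows N t vs (s v + x) (s(v := s v + x)) \<omega> \<and>
          replay vs (step v u \<sigma>) \<omega> \<in> A} = {}"
        using False by blast
      ultimately show ?thesis by (simp only: emeasure_empty mult_zero_right mult_zero_left)
    qed
    then show ?thesis by (simp only: Y_slice) (simp only: y fst_conv snd_conv)
  qed
  have "emeasure ?C X = emeasure (distr (mark_law \<Otimes>\<^sub>M ?C) ?C (\<lambda>(y, \<omega>). push v y \<omega>)) X"
    by (simp only: distr_push[OF v])
  also have "\<dots> = emeasure (mark_law \<Otimes>\<^sub>M ?C) ?Y"
    by (rule emeasure_distr[OF measurable_push[OF v] X])
  also have "\<dots> = (\<integral>\<^sup>+ y. emeasure ?C (Pair y -` ?Y) \<partial>mark_law)"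
    by (rule C.emeasure_pair_measure_alt[OF Y])
  also have "\<dots> = (\<integral>\<^sup>+ x. \<integral>\<^sup>+ u. emeasure ?C (Pair (x, u) -` ?Y) \<partial>?U \<partial>?E)"
    by (rule U.nn_integral_fst[symmetric]) (rule C.measurable_emeasure_Pair[OF Y])
  also have "\<dots> = (\<integral>\<^sup>+ x. ennreal (c x) * indicator {r - s v<..t - s v} x * ennreal (avg v ?f \<sigma>) \<partial>?E)"
  proof (rule nn_integral_cong)
    fix x
    have [measurable]: "(\<lambda>u. ennreal (?f (step v u \<sigma>))) \<in> borel_measurable ?U"
      unfolding step_def by measurable
    show "(\<integral>\<^sup>+ u. emeasure ?C (Pair (x, u) -` ?Y) \<partial>?U) =
      ennreal (c x) * indicator {r - s v<..t - s v} x * ennreal (avg v ?f \<sigma>)"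
      unfolding slice fst_conv snd_conv
      by (subst nn_integral_cmult) (measurable, simp add: nn_integral_step foldr_avg_nonneg)
  qed
  also have "\<dots> = (\<integral>\<^sup>+ x. ennreal (c x) * indicator {r - s v<..t - s v} x \<partial>?E) * ennreal (avg v ?f \<sigma>)"
    by (rule nn_integral_multc) (simp add: c_def)
  finally have X_eq: "emeasure ?C X =
     (\<integral>\<^sup>+ x. ennreal (c x) * indicator {r - s v<..t - s v} x \<partial>?E) * ennreal (avg v ?f \<sigma>)" .
  have "(\<integral>\<^sup>+ x. ennreal (c x) * indicator {r - s v<..t - s v} x \<partial>?E) =
     (\<integral>\<^sup>+ x. ennreal (exponential_density 1 x) * (ennreal (c x) * indicator {r - s v<..t - s v} x) \<partial>lborel)"
    by (rule nn_integral_density) (auto simp: c_def)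
  also have "\<dots> = (\<integral>\<^sup>+ x. ennreal (exp (- S) * (t - s v - x) ^ ?n / fact ?n) * indicator {r - s v<..t - s v} x \<partial>lborel)"
  proof (rule nn_integral_cong)
    fix x
    show "ennreal (exponential_density 1 x) * (ennreal (c x) * indicator {r - s v<..t - s v} x) =
       ennreal (exp (- S) * (t - s v - x) ^ ?n / fact ?n) * indicator {r - s v<..t - s v} x"
    proof (cases "x \<in> {r - s v<..t - s v}")
      case True
      then have "0 \<le> x" using sv by auto
      then have "exponential_density 1 x * c x = exp (- S) * (t - s v - x) ^ ?n / fact ?n"
        by (simp add: c_def exponential_density_def exp_minus)
      then show ?thesis
        using True \<open>0 \<le> x\<close> by (simp add: c_def ennreal_mult[symmetric])
    qed simp
  qed
  also have "\<dots> = ennreal (exp (- S) * ((t - s v) - (r - s v)) ^ Suc ?n / fact (Suc ?n))"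
    using Cons.prems(3) by (intro nn_integral_power_segment) auto
  finally have "emeasure ?C X = ennreal (exp (- S) * ((t - s v) - (r - s v)) ^ Suc ?n / fact (Suc ?n))
      * ennreal (avg v ?f \<sigma>)"
    using X_eq by (simp only:)
  also have "\<dots> = ennreal (exp (- S) * (t - r) ^ Suc ?n / fact (Suc ?n) * avg v ?f \<sigma>)"
    using Cons.prems(3) by (simp add: ennreal_mult[symmetric] avg_nonneg foldr_avg_nonneg)
  finally show ?case by (simp add: X_def S_def)
qed

end

section \<open>Chronological lists of rings\<close>

lemma sorted_wrt_key_unique:
  fixes f :: "'a \<Rightarrow> 'b :: linorder"
  assumes "sorted_wrt (\<lambda>x y. f x < f y) xs" "sorted_wrt (\<lambda>x y. f x < f y) ys" "set xs = set ys"
  shows "xs = ys"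
proof -
  have s: "sorted_wrt (<) (map f xs)" "sorted_wrt (<) (map f ys)"
    using assms by (simp_all add: sorted_wrt_map)
  then have "map f xs = map f ys"
    using assms(3) by (intro strict_sorted_equal) auto
  moreover have "inj_on f (set xs \<union> set ys)"
    using s(1) assms(3) by (simp add: strict_sorted_iff distinct_map)
  ultimately show ?thesis by (simp add: inj_on_map_eq_map)
qed

definition rings_set :: "nat \<Rightarrow> (nat \<Rightarrow> nat \<Rightarrow> real \<times> real) \<Rightarrow> real \<Rightarrow> (nat \<times> nat) set" where
  "rings_set N \<omega> t = {(v, k). v \<in> {1..N} \<and> ring_time \<omega> (v, k) \<le> t}"

definition is_rings :: "nat \<Rightarrow> (nat \<Rightarrow> nat \<Rightarrow> real \<times> real) \<Rightarrow> real \<Rightarrow> (nat \<times> nat) list \<Rightarrow> bool" where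
  "is_rings N \<omega> t rs \<longleftrightarrow>
     sorted_wrt (\<lambda>r s. ring_time \<omega> r < ring_time \<omega> s) rs \<and> set rs = rings_set N \<omega> t"

lemma rings_until_alt: "rings_until N \<omega> t = (THE rs. is_rings N \<omega> t rs)"
  by (simp add: rings_until_def is_rings_def rings_set_def)

lemma is_rings_unique: "is_rings N \<omega> t rs \<Longrightarrow> is_rings N \<omega> t rs' \<Longrightarrow> rs = rs'"
  unfolding is_rings_def using sorted_wrt_key_unique[of "ring_time \<omega>" rs rs'] by simp

lemma rings_until_eq: "is_rings N \<omega> t rs \<Longrightarrow> rings_until N \<omega> t = rs"
  unfolding rings_until_alt by (rule the_equality) (auto dest: is_rings_unique)

text \<open>When no list qualifies, \<open>rings_until\<close> is the fixed unknown list
  \<open>THE rs. False\<close>. Making this value explicit keeps statements about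
  \<open>rings_until\<close> measurable at every sample point, exceptional ones included.\<close>

lemma rings_until_eq_iff:
  "rings_until N \<omega> t = rs \<longleftrightarrow>
     is_rings N \<omega> t rs \<or> (\<forall>rs'. \<not> is_rings N \<omega> t rs') \<and> rs = (THE rs. False)"
proof (cases "\<exists>rs'. is_rings N \<omega> t rs'")
  case True
  then show ?thesis using rings_until_eq by blast
next
  case False
  then have "is_rings N \<omega> t = (\<lambda>rs. False)" by auto
  then show ?thesis by (auto simp: rings_until_alt)
qed

lemma rings_until_prefix:
  assumes "is_rings N \<omega> t rs" "t' \<le> t"
  shows "is_rings N \<omega> t' (filter (\<lambda>x. ring_time \<omega> x \<le> t') rs)"
  using assms by (auto simp: is_rings_def rings_set_def intro: sorted_wrt_filter)

lemma borel_measurable_ring_time [measurable]: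
  "(\<lambda>\<omega>. ring_time \<omega> x) \<in> borel_measurable (clock_space N)"
proof -
  have "(\<lambda>\<omega>. fst (\<omega> v k)) \<in> borel_measurable (clock_space N)" for v k
    by (rule measurable_compose[OF measurable_clock_component measurable_fst_borel])
  then show ?thesis by (cases x) (simp add: ring_time_def)
qed

lemma measurable_is_rings:
  assumes [measurable]: "\<tau> \<in> borel_measurable (clock_space N)"
  shows "Measurable.pred (clock_space N) (\<lambda>\<omega>. is_rings N \<omega> (\<tau> \<omega>) rs)"
proof -
  have eq: "is_rings N \<omega> (\<tau> \<omega>) rs \<longleftrightarrow>
     (\<forall>j<length rs. \<forall>i<j. ring_time \<omega> (rs ! i) < ring_time \<omega> (rs ! j)) \<and>
     (\<forall>x. x \<in> set rs \<longleftrightarrow> fst x \<in> {1..N} \<and> ring_time \<omega> x \<le> \<tau> \<omega>)" for \<omega>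
    unfolding is_rings_def sorted_wrt_iff_nth_less rings_set_def set_eq_iff
    by (rule arg_cong2[where f = "(\<and>)"]) (blast, simp add: case_prod_unfold)
  have "Measurable.pred (clock_space N) (\<lambda>\<omega>. \<not> \<tau> \<omega> < ring_time \<omega> x)"
    "Measurable.pred (clock_space N) (\<lambda>\<omega>. ring_time \<omega> x < ring_time \<omega> y)" for x y
    by (intro pred_intros_logic(2) borel_measurable_pred_less borel_measurable_ring_time assms)+
  then show ?thesis
    unfolding eq not_less Ball_def by (intro pred_intros_logic(3,4,6) pred_intros_countable(1)) simp_all
qed

lemma measurable_rings_until:
  assumes [measurable]: "\<tau> \<in> borel_measurable (clock_space N)"
  shows "Measurable.pred (clock_space N) (\<lambda>\<omega>. rings_until N \<omega> (\<tau> \<omega>) = rs)"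
proof -
  have "Measurable.pred (clock_space N) (\<lambda>\<omega>. is_rings N \<omega> (\<tau> \<omega>) rs)" for rs
    by (rule measurable_is_rings) (rule assms)
  then show ?thesis
    unfolding rings_until_eq_iff by (intro pred_intros_logic(2,3,5) pred_intros_countable(1)) simp_all
qed

lemma (in two_way_step) measurable_fold_step:
  "Measurable.pred (clock_space N) (\<lambda>\<omega>. fold (\<lambda>(v, k). step v (snd (\<omega> v k))) rs \<sigma> \<in> A)"
proof (induction rs arbitrary: \<sigma>)
  case (Cons x rs)
  obtain v k where x: "x = (v, k)" by (cases x)
  note Cons.IH[measurable]
  have [measurable]: "(\<lambda>\<omega>. snd (\<omega> v k)) \<in> borel_measurable (clock_space N)"
    by (rule measurable_compose[OF measurable_clock_component measurable_snd_borel])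
  have eq: "fold (\<lambda>(v, k). step v (snd (\<omega> v k))) (x # rs) \<sigma> \<in> A \<longleftrightarrow>
     (if snd (\<omega> v k) \<le> p v \<sigma> then fold (\<lambda>(v, k). step v (snd (\<omega> v k))) rs (G1 v \<sigma>) \<in> A
      else fold (\<lambda>(v, k). step v (snd (\<omega> v k))) rs (G2 v \<sigma>) \<in> A)" for \<omega>
    by (simp add: step_def x)
  show ?case unfolding eq by measurable
qed simp

text \<open>There are countably many lists of rings, so the event splits according to the list. The
  time \<open>\<tau>\<close> is random because the dynamics will be observed at ring times.\<close>

lemma (in two_way_step) measurable_fold_rings_until:
  assumes [measurable]: "\<tau> \<in> borel_measurable (clock_space N)"
  shows "Measurable.pred (clock_space N)
    (\<lambda>\<omega>. fold (\<lambda>(v, k). step v (snd (\<omega> v k))) (rings_until N \<omega> (\<tau> \<omega>)) \<sigma> \<in> A)"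
proof -
  have "Measurable.pred (clock_space N) (\<lambda>\<omega>. \<exists>rs. rings_until N \<omega> (\<tau> \<omega>) = rs \<and>
     fold (\<lambda>(v, k). step v (snd (\<omega> v k))) rs \<sigma> \<in> A)"
    by (intro pred_intros_countable(2) pred_intros_logic(3) measurable_rings_until[OF assms] measurable_fold_step)
  then show ?thesis by simp
qed

section \<open>From lists of sites to indexed rings\<close>

fun label :: "(nat \<Rightarrow> nat) \<Rightarrow> nat list \<Rightarrow> (nat \<times> nat) list" where
  "label c [] = []"
| "label c (v # vs) = (v, c v) # label (c(v := Suc (c v))) vs"

lemma map_fst_label [simp]: "map fst (label c vs) = vs"
  by (induction vs arbitrary: c) auto

lemma ring_time_eq: "ring_time \<omega> (v, k) = (\<Sum>j<k. fst (\<omega> v j)) + fst (\<omega> v k)"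
  by (simp only: ring_time_def prod.case lessThan_Suc_atMost[symmetric] sum.lessThan_Suc)

lemma ring_time_mono:
  assumes "\<And>k. 0 < fst (\<omega> v k)" "j \<le> k"
  shows "ring_time \<omega> (v, j) \<le> ring_time \<omega> (v, k)"
  using assms by (auto simp: ring_time_def less_imp_le intro!: sum_mono2)

context two_way_step
begin

text \<open>The counter \<open>c u\<close> is the number of rings of \<open>u\<close> already used:
  the pending wait began at the sum of the first \<open>c u\<close> waits, and its mark has index
  \<open>c u\<close>. The conjunct on times after \<open>r\<close> carries sortedness through the
  induction. Positive waits ensure that no ring after the pending one precedes it.\<close>

lemma follows_label:
  assumes "\<And>v k. v \<in> {1..N} \<Longrightarrow> 0 < fst (\<omega> v k)" and "set vs \<subseteq> {1..N}"
    and "follows N t vs r (\<lambda>u. \<Sum>j<c u. fst (\<omega> u j)) (\<lambda>u k. \<omega> u (c u + k))"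
  shows "sorted_wrt (\<lambda>x y. ring_time \<omega> x < ring_time \<omega> y) (label c vs) \<and>
    (\<forall>x\<in>set (label c vs). r < ring_time \<omega> x) \<and>
    set (label c vs) = {(v, k). v \<in> {1..N} \<and> c v \<le> k \<and> ring_time \<omega> (v, k) \<le> t} \<and>
    fold (\<lambda>(v, k). step v (snd (\<omega> v k))) (label c vs) \<sigma> = replay vs \<sigma> (\<lambda>u k. \<omega> u (c u + k))"
  using assms
proof (induction vs arbitrary: c r \<sigma>)
  case Nil
  have "t < ring_time \<omega> (v, k)" if "v \<in> {1..N}" "c v \<le> k" for v k
  proof -
    have "t < ring_time \<omega> (v, c v)"
      using Nil(3) that(1) by (simp add: ring_time_eq)
    also have "\<dots> \<le> ring_time \<omega> (v, k)"
      using Nil(1) that by (intro ring_time_mono) auto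
    finally show ?thesis .
  qed
  then have "{(v, k). v \<in> {1..N} \<and> c v \<le> k \<and> ring_time \<omega> (v, k) \<le> t} = {}"
    by (auto simp: not_le[symmetric])
  then show ?case by simp
next
  case (Cons v vs)
  let ?c = "c(v := Suc (c v))"
  let ?r = "ring_time \<omega> (v, c v)"
  have r: "(\<Sum>j<c v. fst (\<omega> v j)) + fst (\<omega> v (c v)) = ?r"
    by (simp add: ring_time_eq)
  have s: "(\<lambda>u. \<Sum>j<c u. fst (\<omega> u j))(v := ?r) = (\<lambda>u. \<Sum>j<?c u. fst (\<omega> u j))"
    by (simp add: fun_eq_iff ring_time_eq)
  have W: "pop v (\<lambda>u k. \<omega> u (c u + k)) = (\<lambda>u k. \<omega> u (?c u + k))"
    by (auto simp: fun_eq_iff pop_def)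
  have "r < ?r" "?r \<le> t" and
    f: "follows N t vs ?r (\<lambda>u. \<Sum>j<?c u. fst (\<omega> u j)) (\<lambda>u k. \<omega> u (?c u + k))"
    using Cons.prems(3) by (simp_all only: follows.simps r s W add_0_right)
  have v: "v \<in> {1..N}" and vs: "set vs \<subseteq> {1..N}" using Cons.prems(2) by auto
  note IH = Cons.IH[where c = ?c and r = ?r and \<sigma> = "step v (snd (\<omega> v (c v))) \<sigma>", OF Cons.prems(1) vs f]
  let ?R = "\<lambda>c. {(u, k). u \<in> {1..N} \<and> c u \<le> k \<and> ring_time \<omega> (u, k) \<le> t}"
  have R: "?R c = insert (v, c v) (?R ?c)"
  proof (rule set_eqI, clarify)
    fix u k
    show "(u, k) \<in> ?R c \<longleftrightarrow> (u, k) \<in> insert (v, c v) (?R ?c)"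
    proof (cases "(u, k) = (v, c v)")
      case True
      then show ?thesis using v \<open>?r \<le> t\<close> by simp
    next
      case False
      then have "c u \<le> k \<longleftrightarrow> ?c u \<le> k" by (cases "u = v") auto
      then show ?thesis using False by (simp del: fun_upd_apply) blast
    qed
  qed
  have replay: "replay (v # vs) \<sigma> (\<lambda>u k. \<omega> u (c u + k)) =
     replay vs (step v (snd (\<omega> v (c v))) \<sigma>) (\<lambda>u k. \<omega> u (?c u + k))"
    by (simp only: replay.simps W add_0_right)
  note sorted = IH[THEN conjunct1] and later = IH[THEN conjunct2, THEN conjunct1]
    and rings = IH[THEN conjunct2, THEN conjunct2, THEN conjunct1]
    and fold = IH[THEN conjunct2, THEN conjunct2, THEN conjunct2]
  have label: "label c (v # vs) = (v, c v) # label ?c vs" by simp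
  have "sorted_wrt (\<lambda>x y. ring_time \<omega> x < ring_time \<omega> y) (label c (v # vs))"
    unfolding label sorted_wrt.simps using later sorted by (rule conjI)
  moreover have "\<forall>x\<in>set (label c (v # vs)). r < ring_time \<omega> x"
    unfolding label list.set using later \<open>r < ?r\<close> by (blast intro: less_trans)
  moreover have "set (label c (v # vs)) = ?R c"
    unfolding label list.set R by (rule arg_cong[OF rings])
  moreover have "fold (\<lambda>(v, k). step v (snd (\<omega> v k))) (label c (v # vs)) \<sigma> =
      replay (v # vs) \<sigma> (\<lambda>u k. \<omega> u (c u + k))"
    unfolding label replay fold_simps prod.case by (rule fold)
  ultimately show ?case by (rule conjI[OF _ conjI[OF _ conjI]])
qed

lemma follows_rings:
  assumes "\<And>v k. v \<in> {1..N} \<Longrightarrow> 0 < fst (\<omega> v k)" and "set vs \<subseteq> {1..N}"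
    and "follows N t vs 0 (\<lambda>_. 0) \<omega>"
  shows "is_rings N \<omega> t (label (\<lambda>_. 0) vs)"
    and "fold (\<lambda>(v, k). step v (snd (\<omega> v k))) (label (\<lambda>_. 0) vs) \<sigma> = replay vs \<sigma> \<omega>"
  using follows_label[OF assms(1,2), where r = 0 and c = "\<lambda>_. 0" and t = t and \<sigma> = \<sigma>] assms(3)
  by (auto simp: is_rings_def rings_set_def)

text \<open>\<open>total N f - N * f\<close> is the generator applied to \<open>f\<close>, so the
  powers of \<open>total\<close> are the jump terms in the exponential series of the
  semigroup.\<close>

definition total :: "nat \<Rightarrow> ('s \<Rightarrow> real) \<Rightarrow> 's \<Rightarrow> real" where
  "total N f \<sigma> = (\<Sum>v\<in>{1..N}. avg v f \<sigma>)"

lemma avg_sum: "avg v (\<lambda>\<sigma>. \<Sum>i\<in>I. f i \<sigma>) \<sigma> = (\<Sum>i\<in>I. avg v (f i) \<sigma>)"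
  by (simp add: avg_def sum.distrib sum_distrib_left)

lemma total_add: "total N (\<lambda>\<sigma>. f \<sigma> + g \<sigma>) = (\<lambda>\<sigma>. total N f \<sigma> + total N g \<sigma>)"
  by (rule ext) (simp add: total_def avg_def sum.distrib[symmetric] algebra_simps)

lemma total_pow_add: "(total N ^^ n) (\<lambda>\<sigma>. f \<sigma> + g \<sigma>) = (\<lambda>\<sigma>. (total N ^^ n) f \<sigma> + (total N ^^ n) g \<sigma>)"
  by (induction n) (simp_all add: total_add)

lemma total_pow_const: "(total N ^^ n) (\<lambda>_. c) = (\<lambda>_. c * real N ^ n)"
proof (induction n)
  case (Suc n)
  have "total N (\<lambda>_. d) = (\<lambda>_. d * real N)" for d
    by (rule ext) (simp add: total_def avg_def algebra_simps)
  then show ?case using Suc by (simp add: mult_ac)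
qed simp

lemma total_pow_nonneg: "(\<And>\<sigma>. 0 \<le> f \<sigma>) \<Longrightarrow> 0 \<le> (total N ^^ n) f \<sigma>"
  by (induction n arbitrary: \<sigma>) (auto simp: total_def intro!: sum_nonneg avg_nonneg)

text \<open>Expansion of a power of a sum of noncommuting operators into words.\<close>

lemma sum_foldr_avg:
  "(\<Sum>vs | set vs \<subseteq> {1..N} \<and> length vs = n. foldr avg vs f \<sigma>) = (total N ^^ n) f \<sigma>"
proof (induction n arbitrary: \<sigma>)
  case 0
  have "{vs. set vs \<subseteq> {1..N} \<and> length vs = 0} = {[]}" by auto
  then show ?case by simp
next
  case (Suc n)
  let ?L = "{vs. set vs \<subseteq> {1..N} \<and> length vs = n}"
  have "(\<Sum>vs | set vs \<subseteq> {1..N} \<and> length vs = Suc n. foldr avg vs f \<sigma>) =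
     (\<Sum>(v, vs)\<in>{1..N} \<times> ?L. avg v (foldr avg vs f) \<sigma>)"
    by (rule sum.reindex_bij_witness[of _ "\<lambda>(v, vs). v # vs" "\<lambda>vs. (hd vs, tl vs)"])
       (auto simp: length_Suc_conv)
  also have "\<dots> = (\<Sum>v\<in>{1..N}. avg v (\<lambda>\<sigma>. \<Sum>vs\<in>?L. foldr avg vs f \<sigma>) \<sigma>)"
    by (simp add: sum.cartesian_product[symmetric] avg_sum)
  also have "\<dots> = total N ((total N ^^ n) f) \<sigma>"
    unfolding Suc.IH by (simp only: total_def[of N "(total N ^^ n) f"])
  finally show ?case by simp
qed

end

section \<open>The law of the graphical construction at a fixed time\<close>

lemma AE_waiting_times_pos: "AE \<omega> in clock_space N. \<forall>v\<in>{1..N}. \<forall>k. 0 < fst (\<omega> v k)"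
proof -
  have "{y :: real \<times> real. 0 < fst y} \<in> sets mark_law"
    unfolding sets_mark_law
    using measurable_sets[OF measurable_fst_borel, of "{0<..}"] by (simp add: vimage_def)
  then have mark: "AE y in mark_law. 0 < fst y"
    using emeasure_mark_gt[of 0] mark.AE_in_set_eq_1[of "{y. 0 < fst y}"]
    by (simp add: mark.emeasure_eq_measure)
  have "AE f in mark_seq. 0 < fst (f k)" for k
    by (rule AE_PiM_component[of UNIV "\<lambda>_. mark_law" k "\<lambda>y. 0 < fst y"]) (auto intro: mark.prob_space_axioms mark)
  then have "AE f in mark_seq. \<forall>k. 0 < fst (f k)" by (simp add: AE_all_countable)
  then have "AE \<omega> in clock_space N. \<forall>k. 0 < fst (\<omega> v k)" if "v \<in> {1..N}" for v
    unfolding clock_space_eq using that by (intro AE_PiM_component prob_space_mark_seq)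
  then show ?thesis by (simp add: AE_finite_all)
qed

context two_way_step
begin

text \<open>Different site lists give disjoint events, because the chronological list of rings is
  unique once all waits are positive. The bound is one-sided and allows any \<open>B\<close>
  containing the path events; thus the paths may come from one chain while \<open>B\<close> concerns
  another.\<close>

lemma measure_ge_path_sum:
  assumes B: "B \<in> sets (clock_space N)" and t: "0 \<le> t"
    and incl: "\<And>vs \<omega>. \<omega> \<in> space (clock_space N) \<Longrightarrow> (\<And>v k. v \<in> {1..N} \<Longrightarrow> 0 < fst (\<omega> v k)) \<Longrightarrow>
      set vs \<subseteq> {1..N} \<Longrightarrow> follows N t vs 0 (\<lambda>_. 0) \<omega> \<Longrightarrow> replay vs \<sigma> \<omega> \<in> A \<Longrightarrow> \<omega> \<in> B"
  shows "(\<Sum>n<m. exp (- (N * t)) * t ^ n / fact n * (total N ^^ n) (indicator A) \<sigma>) \<le> measure (clock_space N) B"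
proof -
  let ?C = "clock_space N"
  interpret C: prob_space ?C by (rule prob_space_clock)
  define G where "G = {\<omega> \<in> space ?C. \<forall>v\<in>{1..N}. \<forall>k. 0 < fst (\<omega> v k)}"
  define E where "E vs = {\<omega> \<in> space ?C. follows N t vs 0 (\<lambda>_. 0) \<omega> \<and> replay vs \<sigma> \<omega> \<in> A}" for vs
  define Ls where "Ls n = {vs. set vs \<subseteq> {1..N} \<and> length vs = n}" for n
  have finL: "finite (Ls n)" for n by (simp add: Ls_def finite_lists_length_eq)
  have [measurable]: "(\<lambda>\<omega>. fst (\<omega> v k)) \<in> borel_measurable ?C" for v k
    by (rule measurable_compose[OF measurable_clock_component measurable_fst_borel])
  have G: "G \<in> sets ?C" unfolding G_def by measurable
  have E: "E vs \<in> sets ?C" if "set vs \<subseteq> {1..N}" for vs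
  proof -
    have [measurable]: "Measurable.pred ?C (\<lambda>\<omega>. follows N t vs 0 (\<lambda>_. 0) \<omega>)"
      by (rule measurable_follows[OF that]) (auto simp: measurable_clock_component)
    have [measurable]: "Measurable.pred ?C (\<lambda>\<omega>. replay vs \<sigma> \<omega> \<in> A)"
      by (rule measurable_replay) (rule measurable_clock_component)
    show ?thesis unfolding E_def by measurable
  qed
  have EG: "measure ?C (E vs \<inter> G) = exp (- (N * t)) * t ^ length vs / fact (length vs) * foldr avg vs (indicator A) \<sigma>"
    if "set vs \<subseteq> {1..N}" for vs
  proof -
    have "measure ?C (E vs \<inter> G) = measure ?C (E vs)"
      using AE_waiting_times_pos[of N] E[OF that] G
      by (intro C.finite_measure_eq_AE) (auto simp: G_def E_def elim!: eventually_mono)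
    also have "\<dots> = exp (- (N * t)) * t ^ length vs / fact (length vs) * foldr avg vs (indicator A) \<sigma>"
      using emeasure_follows_replay[OF that, of "\<lambda>_. 0" 0 t \<sigma> A] t
      by (simp add: E_def[symmetric] measure_def foldr_avg_nonneg)
    finally show ?thesis .
  qed
  let ?I = "\<Union>n<m. Ls n"
  have I: "set vs \<subseteq> {1..N}" if "vs \<in> ?I" for vs using that by (auto simp: Ls_def)
  have "(\<Sum>n<m. exp (- (N * t)) * t ^ n / fact n * (total N ^^ n) (indicator A) \<sigma>)
     = (\<Sum>n<m. \<Sum>vs\<in>Ls n. measure ?C (E vs \<inter> G))"
    by (intro sum.cong refl) (simp add: sum_foldr_avg[symmetric] sum_distrib_left EG Ls_def)
  also have "\<dots> = (\<Sum>vs\<in>?I. measure ?C (E vs \<inter> G))"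
    using finL by (subst sum.UNION_disjoint) (auto simp: Ls_def)
  also have "\<dots> = measure ?C (\<Union>vs\<in>?I. E vs \<inter> G)"
  proof (rule C.finite_measure_finite_Union[symmetric])
    show "(\<lambda>vs. E vs \<inter> G) ` ?I \<subseteq> sets ?C" using E G I by blast
    show "disjoint_family_on (\<lambda>vs. E vs \<inter> G) ?I"
      unfolding disjoint_family_on_def
    proof (intro ballI impI)
      fix vs vs' assume *: "vs \<in> ?I" "vs' \<in> ?I" "vs \<noteq> vs'"
      show "(E vs \<inter> G) \<inter> (E vs' \<inter> G) = {}"
      proof (rule ccontr)
        assume "(E vs \<inter> G) \<inter> (E vs' \<inter> G) \<noteq> {}"
        then obtain \<omega> where "\<omega> \<in> E vs" "\<omega> \<in> E vs'" "\<omega> \<in> G" by blast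
        then have "is_rings N \<omega> t (label (\<lambda>_. 0) vs)" "is_rings N \<omega> t (label (\<lambda>_. 0) vs')"
          using follows_rings(1) I *(1,2) by (auto simp: E_def G_def)
        then have "map fst (label (\<lambda>_. 0) vs) = map fst (label (\<lambda>_. 0) vs')"
          using is_rings_unique by metis
        then show False using *(3) by simp
      qed
    qed
  qed (use finL in auto)
  also have "\<dots> \<le> measure ?C B"
  proof (intro C.finite_measure_mono B subsetI)
    fix \<omega> assume "\<omega> \<in> (\<Union>vs\<in>?I. E vs \<inter> G)"
    then obtain vs where vs: "vs \<in> ?I" and \<omega>: "\<omega> \<in> E vs" "\<omega> \<in> G" by blast
    show "\<omega> \<in> B"
      by (rule incl[of \<omega> vs]) (use \<omega> I[OF vs] in \<open>simp_all add: E_def G_def\<close>)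
  qed
  finally show ?thesis .
qed

text \<open>Path sums bound the probabilities of \<open>A\<close> and of its complement from below.
  The two bounds add up to the full Poisson mass 1, as the two probabilities do, so both are
  equalities. This also disposes of sample points with infinitely many or simultaneous
  rings.\<close>

lemma fold_rings_law:
  assumes t: "0 \<le> t"
  shows "(\<lambda>n. exp (- (N * t)) * t ^ n / fact n * (total N ^^ n) (indicator A) \<sigma>) sums
    measure (clock_space N) {\<omega> \<in> space (clock_space N).
      fold (\<lambda>(v, k). step v (snd (\<omega> v k))) (rings_until N \<omega> t) \<sigma> \<in> A}"
proof -
  let ?C = "clock_space N"
  interpret C: prob_space ?C by (rule prob_space_clock)
  define B where "B A = {\<omega> \<in> space ?C. fold (\<lambda>(v, k). step v (snd (\<omega> v k))) (rings_until N \<omega> t) \<sigma> \<in> A}" for A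
  define a where "a A n = exp (- (N * t)) * t ^ n / fact n * (total N ^^ n) (indicator A) \<sigma>" for A n
  have B: "B A \<in> sets ?C" for A
  proof -
    note measurable_fold_rings_until[of "\<lambda>_. t" N \<sigma> A, measurable]
    show ?thesis unfolding B_def by measurable
  qed
  have a0: "0 \<le> a A n" for A n
    using t by (simp add: a_def total_pow_nonneg)
  have le: "(\<Sum>n<m. a A n) \<le> measure ?C (B A)" for A m
    unfolding a_def
  proof (rule measure_ge_path_sum[OF B t])
    fix vs \<omega>
    assume "\<omega> \<in> space ?C" and pos: "\<And>v k. v \<in> {1..N} \<Longrightarrow> 0 < fst (\<omega> v k)" and vs: "set vs \<subseteq> {1..N}"
      and f: "follows N t vs 0 (\<lambda>_. 0) \<omega>" and "replay vs \<sigma> \<omega> \<in> A"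
    then show "\<omega> \<in> B A"
      using follows_rings(2)[OF pos vs f] rings_until_eq[OF follows_rings(1)[OF pos vs f]]
      by (simp add: B_def)
  qed
  have summ: "summable (a A)" for A
    by (rule summableI_nonneg_bounded[OF a0 le])
  have up: "suminf (a A) \<le> measure ?C (B A)" for A
    by (rule suminf_le_const[OF summ le])
  have "(total N ^^ n) (indicator A) \<sigma> + (total N ^^ n) (indicator (- A)) \<sigma> = real N ^ n" for n
  proof -
    have "(\<lambda>\<sigma>. indicator A \<sigma> + indicator (- A) \<sigma>) = (\<lambda>_. 1 :: real)"
      by (auto simp: fun_eq_iff indicator_def)
    then show ?thesis
      using total_pow_add[of n N "indicator A" "indicator (- A)"] total_pow_const[of n N 1]
      by (simp add: fun_eq_iff)
  qed
  then have "a A n + a (- A) n = exp (- (N * t)) * ((N * t) ^ n /\<^sub>R fact n)" for n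
    unfolding a_def distrib_left[symmetric] by (simp add: power_mult_distrib divide_inverse mult_ac)
  then have "(\<lambda>n. a A n + a (- A) n) sums (exp (- (N * t)) * exp (N * t))"
    using sums_mult[OF exp_converges[of "N * t"]] by simp
  then have "(\<lambda>n. a A n + a (- A) n) sums 1"
    by (simp add: exp_add[symmetric])
  then have "suminf (a A) + suminf (a (- A)) = 1"
    using sums_unique suminf_add[OF summ summ] by metis
  moreover have "measure ?C (B A) + measure ?C (B (- A)) = 1"
  proof -
    have "B (- A) = space ?C - B A" by (auto simp: B_def)
    then show ?thesis using C.prob_compl[OF B[of A]] by simp
  qed
  ultimately have "suminf (a A) = measure ?C (B A)"
    using up[of A] up[of "- A"] by linarith
  then have "a A sums measure ?C (B A)"
    using summable_sums[OF summ, of A] by simp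
  then show ?thesis unfolding a_def[abs_def] B_def .
qed

end

section \<open>Staying in a set during a whole time interval\<close>

lemma rings_until_cong: "rings_set N \<omega> t = rings_set N \<omega> t' \<Longrightarrow> rings_until N \<omega> t = rings_until N \<omega> t'"
  by (simp add: rings_until_alt is_rings_def[abs_def])

lemma rings_set_mono: "t \<le> t' \<Longrightarrow> rings_set N \<omega> t \<subseteq> rings_set N \<omega> t'"
  by (auto simp: rings_set_def)

lemma is_rings_finite: "is_rings N \<omega> t rs \<Longrightarrow> finite (rings_set N \<omega> t)"
  using finite_set[of rs] by (simp add: is_rings_def)

text \<open>\<open>rings_until\<close> is a step function of time. With finitely many rings up to
  \<open>t\<close> it has the value of the last ring time, or that of time 0 if no ring has a
  nonnegative time; with infinitely many it is the default list from \<open>t\<close> on, so a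
  rational between \<open>t\<close> and \<open>s\<close> serves. The equivalence covers every sample
  point, also those with negative waits, which is why nonnegative ring times are singled
  out.\<close>

lemma all_rings_until_countable:
  fixes P :: "(nat \<times> nat) list \<Rightarrow> bool"
  shows "(\<forall>t. 0 \<le> t \<longrightarrow> t < s \<longrightarrow> P (rings_until N \<omega> t)) \<longleftrightarrow>
     (\<forall>q::rat. 0 \<le> q \<longrightarrow> of_rat q < s \<longrightarrow> P (rings_until N \<omega> (of_rat q))) \<and>
     (\<forall>x. fst x \<in> {1..N} \<longrightarrow> 0 \<le> ring_time \<omega> x \<longrightarrow> ring_time \<omega> x < s \<longrightarrow>
        P (rings_until N \<omega> (ring_time \<omega> x)))" (is "?L \<longleftrightarrow> ?Q \<and> ?T")
proof
  assume R: "?Q \<and> ?T"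
  show ?L
  proof (intro allI impI)
    fix t assume t: "0 \<le> t" "t < s"
    let ?R = "rings_set N \<omega> t"
    show "P (rings_until N \<omega> t)"
    proof (cases "finite ?R")
      case fin: True
      show ?thesis
      proof (cases "\<exists>x\<in>?R. 0 \<le> ring_time \<omega> x")
        case True
        then have "Max (ring_time \<omega> ` ?R) \<in> ring_time \<omega> ` ?R"
          using fin by (intro Max_in) auto
        then obtain x where x: "x \<in> ?R" "ring_time \<omega> x = Max (ring_time \<omega> ` ?R)" by auto
        then have max: "ring_time \<omega> y \<le> ring_time \<omega> x" if "y \<in> ?R" for y
          using fin that by simp
        have "rings_set N \<omega> (ring_time \<omega> x) = ?R"
        proof (rule antisym)
          show "rings_set N \<omega> (ring_time \<omega> x) \<subseteq> ?R"
            using x(1) by (auto simp: rings_set_def)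
          show "?R \<subseteq> rings_set N \<omega> (ring_time \<omega> x)"
            using max by (auto simp: rings_set_def)
        qed
        moreover have "P (rings_until N \<omega> (ring_time \<omega> x))"
        proof (rule R[THEN conjunct2, rule_format])
          show "fst x \<in> {1..N}" "ring_time \<omega> x < s"
            using x(1) t by (auto simp: rings_set_def)
          obtain y where "y \<in> ?R" "0 \<le> ring_time \<omega> y" using True by blast
          then show "0 \<le> ring_time \<omega> x" using max[of y] by linarith
        qed
        ultimately show ?thesis using rings_until_cong[of N \<omega> "ring_time \<omega> x" t] by simp
      next
        case False
        have "?R \<subseteq> rings_set N \<omega> (of_rat 0)"
        proof
          fix x assume x: "x \<in> ?R"
          then have "ring_time \<omega> x \<le> 0" using False by force
          with x show "x \<in> rings_set N \<omega> (of_rat 0)" by (auto simp: rings_set_def)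
        qed
        then have "rings_set N \<omega> (of_rat 0) = ?R"
          using rings_set_mono[OF t(1)] by (intro antisym) auto
        then have "rings_until N \<omega> t = rings_until N \<omega> (of_rat 0)" by (intro rings_until_cong) simp
        moreover have "P (rings_until N \<omega> (of_rat 0))"
          using R[THEN conjunct1, rule_format, of 0] t by simp
        ultimately show ?thesis by simp
      qed
    next
      case False
      obtain q where q: "t < of_rat q" "of_rat q < s" using of_rat_dense[OF t(2)] by auto
      then have "infinite (rings_set N \<omega> (of_rat q))"
        using False finite_subset[OF rings_set_mono[of t "of_rat q"]] by auto
      then have "rings_until N \<omega> t = (THE rs. False)" "rings_until N \<omega> (of_rat q) = (THE rs. False)"
        using False is_rings_finite by (metis rings_until_eq_iff)+
      then have "rings_until N \<omega> t = rings_until N \<omega> (of_rat q)" by simp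
      moreover have "0 < (of_rat q :: real)" using q(1) t(1) by linarith
      then have "0 \<le> q" by simp
      ultimately show ?thesis using R[THEN conjunct1, rule_format, of q] q(2) by simp
    qed
  qed
next
  assume L: ?L
  have "P (rings_until N \<omega> (of_rat q))" if "0 \<le> q" "of_rat q < s" for q :: rat
    using L[rule_format, of "of_rat q"] that by simp
  then show "?Q \<and> ?T" using L by blast
qed

lemma (in two_way_step) sets_stay:
  "{\<omega> \<in> space (clock_space N). \<forall>t. 0 \<le> t \<longrightarrow> t < s \<longrightarrow>
      fold (\<lambda>(v, k). step v (snd (\<omega> v k))) (rings_until N \<omega> t) \<sigma> \<in> A} \<in> sets (clock_space N)"
proof -
  let ?P = "\<lambda>\<omega> t. fold (\<lambda>(v, k). step v (snd (\<omega> v k))) (rings_until N \<omega> t) \<sigma> \<in> A"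
  have eq: "(\<forall>t. 0 \<le> t \<longrightarrow> t < s \<longrightarrow> ?P \<omega> t) \<longleftrightarrow>
     (\<forall>q::rat. 0 \<le> q \<longrightarrow> of_rat q < s \<longrightarrow> ?P \<omega> (of_rat q)) \<and>
     (\<forall>x. fst x \<in> {1..N} \<longrightarrow> 0 \<le> ring_time \<omega> x \<longrightarrow> ring_time \<omega> x < s \<longrightarrow> ?P \<omega> (ring_time \<omega> x))" for \<omega>
    by (rule all_rings_until_countable)
  have rat: "Measurable.pred (clock_space N) (\<lambda>\<omega>. ?P \<omega> (of_rat q))" for q
    by (rule measurable_fold_rings_until) simp
  have ring: "Measurable.pred (clock_space N) (\<lambda>\<omega>. ?P \<omega> (ring_time \<omega> x))" for x
    by (rule measurable_fold_rings_until) (rule borel_measurable_ring_time)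
  have time: "Measurable.pred (clock_space N) (\<lambda>\<omega>. ring_time \<omega> x < s)"
    "Measurable.pred (clock_space N) (\<lambda>\<omega>. \<not> ring_time \<omega> x < 0)" for x
    by (intro pred_intros_logic(2) borel_measurable_pred_less borel_measurable_ring_time; simp)+
  have "Measurable.pred (clock_space N) (\<lambda>\<omega>.
     (\<forall>q::rat. 0 \<le> q \<longrightarrow> of_rat q < s \<longrightarrow> ?P \<omega> (of_rat q)) \<and>
     (\<forall>x. fst x \<in> {1..N} \<longrightarrow> \<not> ring_time \<omega> x < 0 \<longrightarrow> ring_time \<omega> x < s \<longrightarrow> ?P \<omega> (ring_time \<omega> x)))"
    by (intro pred_intros_logic(3,4) pred_intros_countable(1) rat ring time) simp_all
  then show ?thesis
    unfolding eq by (simp only: not_less pred_def)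
qed

text \<open>A chain on \<open>bool\<close> remembers whether some update has used a uniform variable
  from a bad set of probability \<open>q\<close>. The bad set is an upper interval for sites in
  \<open>hi\<close> and a lower one for the others; in the application it contains every value that
  can flip a frozen plus or minus spin, whatever the rest of the configuration.\<close>

locale spoiling =
  fixes q :: real and hi :: "nat set"
  assumes q: "0 \<le> q" "q \<le> 1"
begin

definition spoilt :: "nat \<Rightarrow> real \<Rightarrow> bool" where
  "spoilt v u \<longleftrightarrow> (if v \<in> hi then 1 - q < u else u \<le> q)"

text \<open>The first outcome is taken when the variable is at most the threshold: for sites in
  \<open>hi\<close> this is the good case, for the others the bad one.\<close>

sublocale two_way_step "\<lambda>v (_ :: bool). if v \<in> hi then 1 - q else q"
    "\<lambda>v b. v \<in> hi \<and> b" "\<lambda>v b. v \<notin> hi \<and> b"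
  by standard (use q in auto)

lemma step_iff: "step v u b \<longleftrightarrow> b \<and> \<not> spoilt v u"
  by (auto simp: step_def spoilt_def)

lemma fold_step_iff:
  "fold (\<lambda>(v, k). step v (snd (\<omega> v k))) rs b \<longleftrightarrow> b \<and> (\<forall>(v, k)\<in>set rs. \<not> spoilt v (snd (\<omega> v k)))"
  by (induction rs arbitrary: b) (auto simp: step_iff)

lemma total_pow_unspoilt:
  "(total N ^^ n) (indicator {True}) b = (if b then (real N * (1 - q)) ^ n else 0)"
proof (induction n arbitrary: b)
  case (Suc n)
  let ?f = "(total N ^^ n) (indicator {True})"
  have "avg v ?f b = (if b then (1 - q) * (real N * (1 - q)) ^ n else 0)" for v
    by (simp add: avg_def Suc)
  then show ?case
    unfolding funpow.simps o_apply total_def[of N ?f b] by (simp add: mult_ac)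
qed simp

end

text \<open>The path sum of the flag chain is
  \<open>exp (- N s) * exp (N s (1 - q)) = exp (- N s q)\<close>, the probability that thinned
  clocks show no bad ring. Initial segments of a good list are good, so one event controls all times
  before \<open>s\<close>.\<close>

lemma (in two_way_step) prob_stay_ge:
  assumes \<sigma>: "\<sigma> \<in> A" and q: "0 \<le> q" "q \<le> 1" and s: "0 \<le> s"
    and inv: "\<And>v u \<tau>. v \<in> {1..N} \<Longrightarrow> \<tau> \<in> A \<Longrightarrow> \<not> (if v \<in> hi then 1 - q < u else u \<le> q) \<Longrightarrow> step v u \<tau> \<in> A"
  shows "1 - N * s * q \<le> measure (clock_space N) {\<omega> \<in> space (clock_space N). \<forall>t. 0 \<le> t \<longrightarrow> t < s \<longrightarrow>
      fold (\<lambda>(v, k). step v (snd (\<omega> v k))) (rings_until N \<omega> t) \<sigma> \<in> A}"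
proof -
  interpret sp: spoiling q hi by standard (use q in auto)
  let ?B = "{\<omega> \<in> space (clock_space N). \<forall>t. 0 \<le> t \<longrightarrow> t < s \<longrightarrow>
      fold (\<lambda>(v, k). step v (snd (\<omega> v k))) (rings_until N \<omega> t) \<sigma> \<in> A}"
  have stays: "fold (\<lambda>(v, k). step v (snd (\<omega> v k))) rs \<tau> \<in> A"
    if "\<forall>(v, k)\<in>set rs. v \<in> {1..N} \<and> \<not> sp.spoilt v (snd (\<omega> v k))" "\<tau> \<in> A" for rs \<omega> \<tau>
    using that
  proof (induction rs arbitrary: \<tau>)
    case (Cons x rs)
    obtain v k where x: "x = (v, k)" by (cases x)
    have "step v (snd (\<omega> v k)) \<tau> \<in> A"
      using Cons.prems x by (intro inv) (auto simp: sp.spoilt_def)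
    then show ?case using Cons x by simp
  qed simp
  \<comment> \<open>The paths are those of the flag chain, the event belongs to the original chain;
    both read the same clocks.\<close>
  have "(\<Sum>n<m. exp (- (N * s)) * s ^ n / fact n * (sp.total N ^^ n) (indicator {True}) True)
     \<le> measure (clock_space N) ?B" for m
  proof (rule sp.measure_ge_path_sum[OF sets_stay s])
    fix vs \<omega>
    assume sp: "\<omega> \<in> space (clock_space N)" and pos: "\<And>v k. v \<in> {1..N} \<Longrightarrow> 0 < fst (\<omega> v k)"
      and vs: "set vs \<subseteq> {1..N}" and f: "follows N s vs 0 (\<lambda>_. 0) \<omega>"
      and "sp.replay vs True \<omega> \<in> {True}"
    let ?rs = "label (\<lambda>_. 0) vs"
    have rs: "is_rings N \<omega> s ?rs" by (rule follows_rings(1)[OF pos vs f])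
    have "fold (\<lambda>(v, k). sp.step v (snd (\<omega> v k))) ?rs True"
      using sp.follows_rings(2)[OF pos vs f, of True] \<open>sp.replay vs True \<omega> \<in> {True}\<close> by simp
    then have ok: "\<forall>(v, k)\<in>set ?rs. v \<in> {1..N} \<and> \<not> sp.spoilt v (snd (\<omega> v k))"
      using rs unfolding sp.fold_step_iff by (auto simp: is_rings_def rings_set_def)
    show "\<omega> \<in> ?B"
    proof (intro CollectI conjI allI impI sp)
      fix t assume "0 \<le> t" "t < s"
      then have "rings_until N \<omega> t = filter (\<lambda>x. ring_time \<omega> x \<le> t) ?rs"
        using rings_until_eq[OF rings_until_prefix[OF rs]] by simp
      then show "fold (\<lambda>(v, k). step v (snd (\<omega> v k))) (rings_until N \<omega> t) \<sigma> \<in> A"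
        using stays[OF _ \<sigma>, of "filter (\<lambda>x. ring_time \<omega> x \<le> t) ?rs" \<omega>] ok by auto
    qed
  qed
  moreover have "(\<lambda>n. exp (- (N * s)) * s ^ n / fact n * (sp.total N ^^ n) (indicator {True}) True)
     sums (exp (- (N * s)) * exp (N * s * (1 - q)))"
    using sums_mult[OF exp_converges[of "N * s * (1 - q)"], of "exp (- (N * s))"]
    by (simp add: sp.total_pow_unspoilt power_mult_distrib divide_inverse mult_ac)
  ultimately have "exp (- (N * s)) * exp (N * s * (1 - q)) \<le> measure (clock_space N) ?B"
    using LIMSEQ_le_const2[of _ "exp (- (N * s)) * exp (N * s * (1 - q))"] unfolding sums_def by blast
  moreover have "exp (- (N * s)) * exp (N * s * (1 - q)) = exp (- (N * s * q))"
    by (simp add: exp_add[symmetric] algebra_simps)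
  ultimately show ?thesis
    using exp_ge_add_one_self[of "- (N * s * q)"] by linarith
qed

section \<open>Heavy-tailed couplings\<close>

definition levy_law :: "real \<Rightarrow> nat \<Rightarrow> real measure" where
  "levy_law \<alpha> N = density lborel (\<lambda>x. ennreal (levy_density \<alpha> N x))"

lemma sets_levy_law [simp, measurable_cong]: "sets (levy_law \<alpha> N) = sets borel"
  and space_levy_law [simp]: "space (levy_law \<alpha> N) = UNIV"
  by (simp_all add: levy_law_def)

lemma borel_measurable_levy_density [measurable]: "levy_density \<alpha> N \<in> borel_measurable borel"
  unfolding levy_density_def[abs_def] by measurable

lemma levy_density_minus: "levy_density \<alpha> N (- x) = levy_density \<alpha> N x"
  by (simp add: levy_density_def)

lemma nn_integral_even:
  fixes G :: "real \<Rightarrow> ennreal"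
  assumes [measurable]: "G \<in> borel_measurable borel" and even: "\<And>x. G (- x) = G x"
  shows "(\<integral>\<^sup>+ x. G x \<partial>lborel) = 2 * (\<integral>\<^sup>+ x. G x * indicator {0<..} x \<partial>lborel)"
proof -
  have "(\<integral>\<^sup>+ x. G x \<partial>lborel) =
     (\<integral>\<^sup>+ x. G x * indicator {0<..} x + G x * indicator {..<0} x \<partial>lborel)"
    by (rule nn_integral_cong_AE)
       (use AE_lborel_singleton[of 0] in eventually_elim, auto split: split_indicator)
  also have "\<dots> = (\<integral>\<^sup>+ x. G x * indicator {0<..} x \<partial>lborel) + (\<integral>\<^sup>+ x. G x * indicator {..<0} x \<partial>lborel)"
    by (rule nn_integral_add) auto
  also have "(\<integral>\<^sup>+ x. G x * indicator {..<0} x \<partial>lborel) = (\<integral>\<^sup>+ x. G x * indicator {0<..} x \<partial>lborel)"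
    by (subst nn_integral_real_affine[where c = "-1" and t = 0])
       (auto simp: even intro!: nn_integral_cong split: split_indicator)
  finally show ?thesis by (simp add: mult_2)
qed

lemma levy_tail:
  assumes \<alpha>: "0 < \<alpha>" and N: "1 \<le> N" and y: "real N powr (- 1 / \<alpha>) \<le> y"
  shows "emeasure (levy_law \<alpha> N) {x. y \<le> \<bar>x\<bar>} = ennreal (y powr (- \<alpha>) / N)"
proof -
  have "0 < real N powr (- 1 / \<alpha>)" using N by simp
  then have y0: "0 < y" using y by linarith
  define A where "A = {x. y \<le> \<bar>x\<bar>}"
  have [measurable]: "A \<in> sets borel" unfolding A_def by measurable
  let ?f = "\<lambda>x. \<alpha> / (2 * real N) * x powr (- (1 + \<alpha>))" and ?F = "\<lambda>x. - (x powr (- \<alpha>) / (2 * real N))"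
  define I where "I = (\<integral>\<^sup>+ x. ennreal (levy_density \<alpha> N x) * indicator A x * indicator {0<..} x \<partial>lborel)"
  have "emeasure (levy_law \<alpha> N) A = (\<integral>\<^sup>+ x. ennreal (levy_density \<alpha> N x) * indicator A x \<partial>lborel)"
    unfolding levy_law_def by (rule emeasure_density) auto
  also have "\<dots> = 2 * I"
    unfolding I_def by (rule nn_integral_even) (auto simp: levy_density_minus indicator_def A_def)
  finally have eq: "emeasure (levy_law \<alpha> N) A = 2 * I" .
  have "I = (\<integral>\<^sup>+ x. ennreal (?f x) * indicator {y..} x \<partial>lborel)"
    unfolding I_def
  proof (rule nn_integral_cong)
    fix x
    show "ennreal (levy_density \<alpha> N x) * indicator A x * indicator {0<..} x = ennreal (?f x) * indicator {y..} x"
    proof (cases "y \<le> x")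
      case True
      then show ?thesis using y y0 by (simp add: levy_density_def A_def)
    next
      case False
      then have "indicator A x * indicator {0<..} x = (0 :: ennreal)"
        by (auto simp: A_def indicator_def)
      then show ?thesis using False by (simp add: mult.assoc)
    qed
  qed
  also have "\<dots> = ennreal (0 - ?F y)"
  proof (rule nn_integral_FTC_atLeast)
    show "(?F has_real_derivative ?f x) (at x)" if "y \<le> x" for x
    proof -
      have "0 < x" using that y0 by linarith
      from DERIV_minus[OF DERIV_cdivide[OF has_real_derivative_powr[OF this, of "- \<alpha>"], of "2 * real N"]]
      have "(?F has_real_derivative - (- \<alpha> * x powr (- \<alpha> - 1) / (2 * real N))) (at x)" .
      moreover have "- \<alpha> - 1 = - (1 + \<alpha>)" by simp
      ultimately show ?thesis by simp
    qed
    have "((\<lambda>x::real. x powr (- \<alpha>)) \<longlongrightarrow> 0) at_top"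
      by (rule tendsto_neg_powr[OF _ filterlim_ident]) (use \<alpha> in simp)
    from tendsto_minus[OF tendsto_divide[OF this tendsto_const, of "2 * real N"]]
    show "(?F \<longlongrightarrow> 0) at_top" using N by simp
  qed (use \<alpha> in auto)
  finally have "2 * I = ennreal 2 * ennreal (0 - ?F y)" by (simp only: ennreal_numeral)
  moreover have "ennreal 2 * ennreal (0 - ?F y) = ennreal (2 * (0 - ?F y))"
    by (intro ennreal_mult[symmetric]) auto
  moreover have "2 * (0 - ?F y) = y powr (- \<alpha>) / N" by simp
  ultimately show ?thesis
    by (simp only: eq A_def[symmetric])
qed

lemma prob_space_levy:
  assumes \<alpha>: "0 < \<alpha>" and N: "1 \<le> N"
  shows "prob_space (levy_law \<alpha> N)"
proof
  let ?y = "real N powr (- 1 / \<alpha>)"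
  have "emeasure (levy_law \<alpha> N) UNIV = emeasure (levy_law \<alpha> N) {x. ?y \<le> \<bar>x\<bar>}"
    unfolding levy_law_def
    by (subst (1 2) emeasure_density) (auto intro!: nn_integral_cong simp: levy_density_def split: split_indicator)
  also have "\<dots> = ennreal (?y powr (- \<alpha>) / N)"
    by (rule levy_tail[OF \<alpha> N order_refl])
  also have "?y powr (- \<alpha>) = N" using \<alpha> N by (simp add: powr_powr)
  finally show "emeasure (levy_law \<alpha> N) (space (levy_law \<alpha> N)) = 1" using N by simp
qed

text \<open>The power law decreases in the modulus and the cutoff only removes mass, so the value of
  the power law at \<open>l\<close> bounds the density on both intervals.\<close>

lemma levy_window:
  assumes \<alpha>: "0 < \<alpha>" and N: "1 \<le> N" and l: "0 < l" "l \<le> h"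
  shows "emeasure (levy_law \<alpha> N) {x. l \<le> \<bar>x\<bar> \<and> \<bar>x\<bar> \<le> h} \<le> ennreal (\<alpha> / N * l powr (- (1 + \<alpha>)) * (h - l))"
proof -
  define c where "c = \<alpha> / (2 * real N) * l powr (- (1 + \<alpha>))"
  define A where "A = {x. l \<le> \<bar>x\<bar> \<and> \<bar>x\<bar> \<le> h}"
  have [measurable]: "A \<in> sets borel" unfolding A_def by measurable
  have c: "0 \<le> c" using \<alpha> by (simp add: c_def)
  define I where "I = (\<integral>\<^sup>+ x. ennreal (levy_density \<alpha> N x) * indicator A x * indicator {0<..} x \<partial>lborel)"
  have "emeasure (levy_law \<alpha> N) A = (\<integral>\<^sup>+ x. ennreal (levy_density \<alpha> N x) * indicator A x \<partial>lborel)"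
    unfolding levy_law_def by (rule emeasure_density) auto
  also have "\<dots> = 2 * I"
    unfolding I_def by (rule nn_integral_even) (auto simp: levy_density_minus indicator_def A_def)
  finally have eq: "emeasure (levy_law \<alpha> N) A = 2 * I" .
  have "I \<le> (\<integral>\<^sup>+ x. ennreal c * indicator {l..h} x \<partial>lborel)"
    unfolding I_def
  proof (rule nn_integral_mono)
    fix x
    show "ennreal (levy_density \<alpha> N x) * indicator A x * indicator {0<..} x \<le> ennreal c * indicator {l..h} x"
    proof (cases "l \<le> x \<and> x \<le> h")
      case True
      then have "x powr (- (1 + \<alpha>)) \<le> l powr (- (1 + \<alpha>))"
        using l \<alpha> by (intro powr_mono2') auto
      then have "\<alpha> / (2 * real N) * x powr (- (1 + \<alpha>)) \<le> c"
        unfolding c_def using \<alpha> by (intro mult_left_mono) auto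
      then have "levy_density \<alpha> N x \<le> c"
        using True l c by (simp add: levy_density_def)
      then show ?thesis using True l by (auto simp: A_def intro: ennreal_leI)
    next
      case False
      then have "indicator A x * indicator {0<..} x = (0 :: ennreal)"
        by (auto simp: A_def indicator_def)
      then show ?thesis by (simp only: mult.assoc mult_zero_right zero_le)
    qed
  qed
  also have "\<dots> = ennreal c * ennreal (h - l)"
    using l by (subst nn_integral_cmult_indicator) auto
  also have "\<dots> = ennreal (c * (h - l))"
    using c l by (intro ennreal_mult[symmetric]) auto
  finally have "2 * I \<le> ennreal 2 * ennreal (c * (h - l))"
    by (simp only: ennreal_numeral mult_left_mono zero_le)
  moreover have "ennreal 2 * ennreal (c * (h - l)) = ennreal (2 * (c * (h - l)))"
    using c l by (intro ennreal_mult[symmetric]) auto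
  moreover have "2 * (c * (h - l)) = \<alpha> / N * l powr (- (1 + \<alpha>)) * (h - l)"
    by (simp add: c_def)
  ultimately show ?thesis
    by (simp only: eq A_def[symmetric])
qed

lemma levy_truncated_moment:
  assumes \<alpha>: "0 < \<alpha>" "\<alpha> < 1" and N: "1 \<le> N" and b: "1 \<le> b"
  shows "(\<integral>\<^sup>+ x. ennreal (if \<bar>x\<bar> < b then \<bar>x\<bar> else 0) \<partial>levy_law \<alpha> N)
      \<le> ennreal (\<alpha> / (1 - \<alpha>) * b powr (1 - \<alpha>) / N)"
proof -
  let ?y = "real N powr (- 1 / \<alpha>)"
  have y: "0 < ?y" "?y \<le> b"
  proof -
    show "0 < ?y" using N by simp
    have "?y \<le> real N powr 0" using N \<alpha> by (intro powr_mono) auto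
    then show "?y \<le> b" using b N by simp
  qed
  let ?g = "\<lambda>x. ennreal (levy_density \<alpha> N x) * ennreal (if \<bar>x\<bar> < b then \<bar>x\<bar> else 0)"
  let ?f = "\<lambda>x. \<alpha> / (2 * N) * x powr (- \<alpha>)" and ?F = "\<lambda>x. \<alpha> / (2 * N) * (x powr (1 - \<alpha>) / (1 - \<alpha>))"
  have "(\<integral>\<^sup>+ x. ennreal (if \<bar>x\<bar> < b then \<bar>x\<bar> else 0) \<partial>levy_law \<alpha> N) = (\<integral>\<^sup>+ x. ?g x \<partial>lborel)"
    unfolding levy_law_def by (rule nn_integral_density) auto
  also have "\<dots> = 2 * (\<integral>\<^sup>+ x. ?g x * indicator {0<..} x \<partial>lborel)"
    by (rule nn_integral_even) (auto simp: levy_density_minus)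
  also have "\<dots> \<le> 2 * (\<integral>\<^sup>+ x. ennreal (?f x) * indicator {?y..b} x \<partial>lborel)"
  proof (intro mult_left_mono nn_integral_mono)
    fix x
    show "?g x * indicator {0<..} x \<le> ennreal (?f x) * indicator {?y..b} x"
    proof (cases "?y \<le> x \<and> x < b")
      case True
      then have x: "0 < x" using y(1) less_le_trans by blast
      then have "x powr (- (1 + \<alpha>)) * x = x powr (- \<alpha>)"
        using powr_mult_base[of x "- (1 + \<alpha>)"]
        by (simp only: mult.commute) simp
      then show ?thesis
        using True x \<alpha> by (simp add: levy_density_def ennreal_mult[symmetric] mult.assoc)
    next
      case False
      then show ?thesis using y(1) by (auto simp: levy_density_def split: split_indicator)
    qed
  qed auto
  also have "(\<integral>\<^sup>+ x. ennreal (?f x) * indicator {?y..b} x \<partial>lborel) = ennreal (?F b - ?F ?y)"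
  proof (rule nn_integral_FTC_Icc)
    show "(?F has_real_derivative ?f x) (at x)" if "x \<in> {?y..b}" for x
    proof -
      have x: "0 < x" using that y(1) by (meson atLeastAtMost_iff less_le_trans)
      have "((\<lambda>x. x powr (1 - \<alpha>)) has_real_derivative (1 - \<alpha>) * x powr (1 - \<alpha> - 1)) (at x)"
        by (rule has_real_derivative_powr[OF x])
      from DERIV_cmult[OF DERIV_cdivide[OF this, of "1 - \<alpha>"], of "\<alpha> / (2 * N)"]
      show ?thesis using \<alpha> by simp
    qed
  qed (use \<alpha> y in auto)
  also have "2 * ennreal (?F b - ?F ?y) \<le> 2 * ennreal (?F b)"
    using \<alpha> by (intro mult_left_mono ennreal_leI) auto
  also have "\<dots> = ennreal (2 * ?F b)"
    using \<alpha> by (subst ennreal_mult) auto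
  finally have "(\<integral>\<^sup>+ x. ennreal (if \<bar>x\<bar> < b then \<bar>x\<bar> else 0) \<partial>levy_law \<alpha> N) \<le> ennreal (2 * ?F b)" .
  moreover have "2 * (\<alpha> / (2 * n) * (p / q)) = \<alpha> / q * p / n" for n p q :: real
    by simp
  ultimately show ?thesis by (simp only: of_nat_mult of_nat_numeral)
qed

definition touch :: "nat \<times> nat \<Rightarrow> nat \<times> nat \<Rightarrow> bool" where
  "touch e f \<longleftrightarrow> {fst e, snd e} \<inter> {fst f, snd f} \<noteq> {}"

text \<open>Used with \<open>b = N^d\<close>, with \<open>l\<close> and \<open>h\<close> at distance
  \<open>N^k\<close> below and above the threshold, and with \<open>c = N^r\<close>. An edge touches
  itself, which is why the first clause concludes \<open>e = f\<close>.\<close>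

definition typical :: "nat \<Rightarrow> real \<Rightarrow> real \<Rightarrow> real \<Rightarrow> real \<Rightarrow> (nat \<times> nat \<Rightarrow> real) \<Rightarrow> bool" where
  "typical N b l h c J \<longleftrightarrow>
     (\<forall>e\<in>pairs N. \<forall>f\<in>pairs N. b \<le> \<bar>J e\<bar> \<longrightarrow> b \<le> \<bar>J f\<bar> \<longrightarrow> touch e f \<longrightarrow> e = f) \<and>
     (\<forall>e\<in>pairs N. \<not> (l \<le> \<bar>J e\<bar> \<and> \<bar>J e\<bar> \<le> h)) \<and>
     (\<Sum>e\<in>pairs N. if \<bar>J e\<bar> < b then \<bar>J e\<bar> else 0) < c"

section \<open>Probability of the typical event\<close>

lemma pairs_subset: "pairs N \<subseteq> {1..N} \<times> {1..N}"
  by (auto simp: pairs_def)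

lemma finite_pairs [simp]: "finite (pairs N)"
  by (rule finite_subset[OF pairs_subset]) simp

lemma card_pairs_le: "card (pairs N) \<le> N * N"
  using card_mono[OF _ pairs_subset[of N]] by simp

lemma card_touch_le: "card {f \<in> pairs N. touch e f} \<le> 4 * N"
proof -
  have "{f \<in> pairs N. touch e f} \<subseteq> {fst e, snd e} \<times> {1..N} \<union> {1..N} \<times> {fst e, snd e}"
    using pairs_subset[of N] by (auto simp: touch_def)
  then have "card {f \<in> pairs N. touch e f} \<le> card ({fst e, snd e} \<times> {1..N} \<union> {1..N} \<times> {fst e, snd e})"
    by (rule card_mono[rotated]) simp
  also have "\<dots> \<le> card ({fst e, snd e} \<times> {1..N}) + card ({1..N} \<times> {fst e, snd e})"
    by (rule card_Un_le)
  also have "\<dots> \<le> 2 * N + N * 2"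
    unfolding card_cartesian_product using card_insert_le_m1[of 2 "{snd e}" "fst e"]
    by (intro add_mono mult_mono) (auto simp: card_insert_if)
  finally show ?thesis by simp
qed

lemma coupling_law_eq: "coupling_law \<alpha> N = (\<Pi>\<^sub>M e\<in>pairs N. levy_law \<alpha> N)"
  by (simp add: coupling_law_def levy_law_def)

lemma measurable_coupling: "e \<in> pairs N \<Longrightarrow> (\<lambda>J. J e) \<in> borel_measurable (coupling_law \<alpha> N)"
  unfolding coupling_law_eq
  using measurable_component_singleton[of e "pairs N" "\<lambda>_. levy_law \<alpha> N"]
  by (simp cong: measurable_cong_sets)

lemma sets_typical: "{J \<in> space (coupling_law \<alpha> N). typical N b l h c J} \<in> sets (coupling_law \<alpha> N)"
proof -
  note measurable_coupling[measurable]
  show ?thesis unfolding typical_def by measurable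
qed

text \<open>A union bound over at most \<open>4 * N^3\<close> ordered pairs of distinct touching
  edges, each with two independent tails, and over at most \<open>N^2\<close> edges in the window;
  then Markov's inequality for the light sum, whose mean is at most \<open>N^2\<close> truncated
  moments.\<close>

lemma prob_typical_ge:
  assumes \<alpha>: "0 < \<alpha>" "\<alpha> < 1" and N: "1 \<le> N" and b: "1 \<le> b" and l: "0 < l" "l \<le> h" and c: "0 < c"
  shows "1 - (4 * real N * b powr (- 2 * \<alpha>) + \<alpha> * N * l powr (- (1 + \<alpha>)) * (h - l)
        + \<alpha> / (1 - \<alpha>) * N * b powr (1 - \<alpha>) / c)
    \<le> measure (coupling_law \<alpha> N) {J \<in> space (coupling_law \<alpha> N). typical N b l h c J}"
proof -
  let ?P = "coupling_law \<alpha> N" and ?L = "levy_law \<alpha> N"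
  interpret L: prob_space ?L by (rule prob_space_levy[OF \<alpha>(1) N])
  interpret pp: product_prob_space "\<lambda>_. ?L" "pairs N"
    by (intro product_prob_spaceI L.prob_space_axioms)
  interpret P: prob_space ?P
    unfolding coupling_law_eq by (rule prob_space_PiM) (rule L.prob_space_axioms)
  note measurable_coupling[of _ N \<alpha>, measurable]
  define X where "X = {(e, f) \<in> pairs N \<times> pairs N. e \<noteq> f \<and> touch e f}"
  define D where "D = (\<lambda>(e, f). {J \<in> space ?P. b \<le> \<bar>J e\<bar> \<and> b \<le> \<bar>J f\<bar>})"
  define W where "W e = {J \<in> space ?P. l \<le> \<bar>J e\<bar> \<and> \<bar>J e\<bar> \<le> h}" for e
  define S where "S J = (\<Sum>e\<in>pairs N. if \<bar>J e\<bar> < b then \<bar>J e\<bar> else 0)" for J :: "nat \<times> nat \<Rightarrow> real"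
  define T where "T = {J \<in> space ?P. c \<le> S J}"
  let ?G = "{J \<in> space ?P. typical N b l h c J}"
  have X: "finite X" "card X \<le> N * N * (4 * N)"
  proof -
    show "finite X" unfolding X_def by (rule finite_subset[of _ "pairs N \<times> pairs N"]) auto
    have "X \<subseteq> (SIGMA e:pairs N. {f \<in> pairs N. touch e f})" by (auto simp: X_def)
    then have "card X \<le> card (SIGMA e:pairs N. {f \<in> pairs N. touch e f})"
      by (rule card_mono[rotated]) simp
    also have "\<dots> = (\<Sum>e\<in>pairs N. card {f \<in> pairs N. touch e f})" by simp
    also have "\<dots> \<le> (\<Sum>e\<in>pairs N. 4 * N)" by (rule sum_mono) (rule card_touch_le)
    also have "\<dots> \<le> N * N * (4 * N)" using card_pairs_le[of N] by simp
    finally show "card X \<le> N * N * (4 * N)" .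
  qed
  have D_sets: "D ` X \<subseteq> P.events"
  proof -
    have "{J \<in> space ?P. b \<le> \<bar>J e\<bar> \<and> b \<le> \<bar>J f\<bar>} \<in> P.events" if "e \<in> pairs N" "f \<in> pairs N" for e f
      using that by measurable
    then show ?thesis by (auto simp: X_def D_def)
  qed
  have W_sets: "W ` pairs N \<subseteq> P.events"
  proof -
    have "W e \<in> P.events" if "e \<in> pairs N" for e
      unfolding W_def using that by measurable
    then show ?thesis by auto
  qed
  have S_meas [measurable]: "S \<in> borel_measurable ?P"
    unfolding S_def by (intro borel_measurable_sum) measurable
  have T_sets: "T \<in> P.events" unfolding T_def by measurable
  have b_y: "real N powr (- 1 / \<alpha>) \<le> b"
  proof -
    have "real N powr (- 1 / \<alpha>) \<le> real N powr 0" using N \<alpha> by (intro powr_mono) auto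
    then show ?thesis using b N by simp
  qed
  have D: "P.prob (D x) \<le> (b powr (- \<alpha>) / N)\<^sup>2" if "x \<in> X" for x
  proof -
    obtain e f where ef: "x = (e, f)" by (cases x)
    have x: "x = (e, f)" "e \<in> pairs N" "f \<in> pairs N" "e \<noteq> f"
      using that unfolding X_def ef by blast+
    have "emeasure ?P {J \<in> space ?P. \<forall>i\<in>{e, f}. J i \<in> {x. b \<le> \<bar>x\<bar>}}
        = (\<Prod>i\<in>{e, f}. emeasure ?L {x. b \<le> \<bar>x\<bar>})"
      unfolding coupling_law_eq
      by (rule pp.emeasure_PiM_Collect[of "{e, f}" "\<lambda>_. {x. b \<le> \<bar>x\<bar>}"]) (use x in auto)
    also have "\<dots> = ennreal (b powr (- \<alpha>) / N) * ennreal (b powr (- \<alpha>) / N)"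
      unfolding levy_tail[OF \<alpha>(1) N b_y] using x(4) by simp
    also have "\<dots> = ennreal ((b powr (- \<alpha>) / N)\<^sup>2)"
      unfolding power2_eq_square by (intro ennreal_mult[symmetric]) auto
    finally have "emeasure ?P {J \<in> space ?P. \<forall>i\<in>{e, f}. J i \<in> {x. b \<le> \<bar>x\<bar>}} = ennreal ((b powr (- \<alpha>) / N)\<^sup>2)" .
    moreover have "{J \<in> space ?P. \<forall>i\<in>{e, f}. J i \<in> {x. b \<le> \<bar>x\<bar>}} = D x"
      by (simp add: D_def x(1))
    ultimately show ?thesis
      by (simp only: P.emeasure_eq_measure ennreal_inj measure_nonneg zero_le_power2 order_refl)
  qed
  have W: "P.prob (W e) \<le> \<alpha> / N * l powr (- (1 + \<alpha>)) * (h - l)" if "e \<in> pairs N" for e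
  proof -
    have "emeasure ?P {J \<in> space ?P. J e \<in> {x. l \<le> \<bar>x\<bar> \<and> \<bar>x\<bar> \<le> h}} = emeasure ?L {x. l \<le> \<bar>x\<bar> \<and> \<bar>x\<bar> \<le> h}"
      unfolding coupling_law_eq
      by (rule pp.emeasure_PiM_Collect_single) (use that in auto)
    also have "\<dots> \<le> ennreal (\<alpha> / N * l powr (- (1 + \<alpha>)) * (h - l))"
      by (rule levy_window[OF \<alpha>(1) N l])
    finally have "emeasure ?P (W e) \<le> ennreal (\<alpha> / N * l powr (- (1 + \<alpha>)) * (h - l))"
      by (simp add: W_def)
    then show ?thesis using \<alpha> l by (simp add: P.emeasure_eq_measure)
  qed
  have T: "P.prob T \<le> \<alpha> / (1 - \<alpha>) * N * b powr (1 - \<alpha>) / c"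
  proof -
    let ?u = "\<lambda>x. if \<bar>x\<bar> < b then \<bar>x\<bar> else 0 :: real"
    let ?m = "\<alpha> / (1 - \<alpha>) * b powr (1 - \<alpha>) / real N"
    have m: "0 \<le> ?m" using \<alpha> by simp
    have "(\<integral>\<^sup>+ J. ennreal (S J) \<partial>?P) = (\<integral>\<^sup>+ J. (\<Sum>e\<in>pairs N. ennreal (?u (J e))) \<partial>?P)"
      unfolding S_def by (intro nn_integral_cong sum_ennreal[symmetric]) auto
    also have "\<dots> = (\<Sum>e\<in>pairs N. \<integral>\<^sup>+ J. ennreal (?u (J e)) \<partial>?P)"
      by (rule nn_integral_sum) measurable
    also have "\<dots> = (\<Sum>e\<in>pairs N. \<integral>\<^sup>+ x. ennreal (?u x) \<partial>?L)"
    proof (rule sum.cong[OF refl])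
      fix e assume e: "e \<in> pairs N"
      have "(\<integral>\<^sup>+ x. ennreal (?u x) \<partial>?L) = (\<integral>\<^sup>+ x. ennreal (?u x) \<partial>distr ?P ?L (\<lambda>J. J e))"
        unfolding coupling_law_eq by (simp only: pp.PiM_component[OF e])
      also have "\<dots> = (\<integral>\<^sup>+ J. ennreal (?u (J e)) \<partial>?P)"
        by (rule nn_integral_distr) (use measurable_coupling[OF e] in \<open>simp_all cong: measurable_cong_sets\<close>)
      finally show "(\<integral>\<^sup>+ J. ennreal (?u (J e)) \<partial>?P) = (\<integral>\<^sup>+ x. ennreal (?u x) \<partial>?L)" ..
    qed
    also have "\<dots> \<le> (\<Sum>e\<in>pairs N. ennreal ?m)"
      by (intro sum_mono levy_truncated_moment[OF \<alpha> N b])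
    also have "\<dots> = ennreal (\<Sum>e\<in>pairs N. ?m)"
      using m by (intro sum_ennreal) simp
    also have "\<dots> \<le> ennreal (real (N * N) * ?m)"
    proof (rule ennreal_leI)
      have "real (card (pairs N)) * ?m \<le> real (N * N) * ?m"
        using card_pairs_le[of N] m by (intro mult_right_mono) (simp_all only: of_nat_le_iff)
      then show "(\<Sum>e\<in>pairs N. ?m) \<le> real (N * N) * ?m" by simp
    qed
    finally have S_mean: "(\<integral>\<^sup>+ J. ennreal (S J) \<partial>?P) \<le> ennreal (real (N * N) * ?m)" .
    have S0: "0 \<le> S J" for J by (auto simp: S_def intro!: sum_nonneg)
    \<comment> \<open>Rescaled to the form \<open>1 \<le> k * u\<close> in which Markov's inequality
      is available for nonnegative integrals.\<close>
    have "c \<le> S J \<longleftrightarrow> 1 \<le> ennreal (1 / c) * ennreal (S J)" for J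
    proof -
      have "1 \<le> ennreal (1 / c) * ennreal (S J) \<longleftrightarrow> ennreal 1 \<le> ennreal (1 / c * S J)"
        using c S0 by (subst ennreal_mult) auto
      also have "\<dots> \<longleftrightarrow> 1 \<le> 1 / c * S J"
        using c S0[of J] by (intro ennreal_le_iff) simp
      finally show ?thesis using c by (simp add: field_simps)
    qed
    then have "T = {J \<in> space ?P. 1 \<le> ennreal (1 / c) * ennreal (S J)}"
      by (simp only: T_def)
    then have "emeasure ?P T \<le> ennreal (1 / c) * (\<integral>\<^sup>+ J. ennreal (S J) * indicator (space ?P) J \<partial>?P)"
      using nn_integral_Markov_inequality[of "\<lambda>J. ennreal (S J)" "space ?P" ?P "ennreal (1 / c)"]
      by simp
    also have "\<dots> = ennreal (1 / c) * (\<integral>\<^sup>+ J. ennreal (S J) \<partial>?P)"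
      by (intro arg_cong[where f = "(*) (ennreal (1 / c))"] nn_integral_cong) simp
    also have "\<dots> \<le> ennreal (1 / c) * ennreal (real (N * N) * ?m)"
      by (rule mult_left_mono[OF S_mean]) simp
    also have "\<dots> = ennreal (1 / c * (real (N * N) * ?m))"
      by (intro ennreal_mult[symmetric] mult_nonneg_nonneg m) (use c in simp_all)
    finally have em: "emeasure ?P T \<le> ennreal (1 / c * (real (N * N) * ?m))" .
    have "0 \<le> 1 / c * (real (N * N) * ?m)"
      by (intro mult_nonneg_nonneg m) (use c in simp_all)
    with em have "P.prob T \<le> 1 / c * (real (N * N) * ?m)"
      by (simp only: P.emeasure_eq_measure ennreal_le_iff)
    then show ?thesis using N by (simp add: mult_ac)
  qed
  have "space ?P - ?G \<subseteq> (\<Union>x\<in>X. D x) \<union> (\<Union>e\<in>pairs N. W e) \<union> T"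
    by (auto simp: typical_def X_def D_def W_def T_def S_def not_less)
  then have "P.prob (space ?P - ?G) \<le> P.prob ((\<Union>x\<in>X. D x) \<union> (\<Union>e\<in>pairs N. W e) \<union> T)"
    using D_sets W_sets T_sets X(1) by (intro P.finite_measure_mono sets.Un sets.finite_UN) auto
  also have "\<dots> \<le> P.prob ((\<Union>x\<in>X. D x) \<union> (\<Union>e\<in>pairs N. W e)) + P.prob T"
    using D_sets W_sets T_sets X(1) by (intro measure_Un_le sets.Un sets.finite_UN) auto
  also have "\<dots> \<le> P.prob (\<Union>x\<in>X. D x) + P.prob (\<Union>e\<in>pairs N. W e) + P.prob T"
    using D_sets W_sets X(1) by (intro add_right_mono measure_Un_le sets.finite_UN) auto
  also have "\<dots> \<le> (\<Sum>x\<in>X. P.prob (D x)) + (\<Sum>e\<in>pairs N. P.prob (W e)) + P.prob T"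
    using D_sets W_sets X(1) by (intro add_right_mono add_mono P.finite_measure_subadditive_finite) auto
  also have "\<dots> \<le> card X * (b powr (- \<alpha>) / N)\<^sup>2 + card (pairs N) * (\<alpha> / N * l powr (- (1 + \<alpha>)) * (h - l))
      + \<alpha> / (1 - \<alpha>) * N * b powr (1 - \<alpha>) / c"
    using D W by (intro add_mono T sum_bounded_above) auto
  also have "\<dots> \<le> real (N * N * (4 * N)) * (b powr (- \<alpha>) / N)\<^sup>2 + real (N * N) * (\<alpha> / N * l powr (- (1 + \<alpha>)) * (h - l))
      + \<alpha> / (1 - \<alpha>) * N * b powr (1 - \<alpha>) / c"
    using X(2) card_pairs_le[of N] \<alpha> l
    by (intro add_mono mult_right_mono order_refl) (simp_all only: of_nat_le_iff, simp_all)
  also have "\<dots> = 4 * real N * b powr (- 2 * \<alpha>) + \<alpha> * N * l powr (- (1 + \<alpha>)) * (h - l)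
        + \<alpha> / (1 - \<alpha>) * N * b powr (1 - \<alpha>) / c"
  proof -
    have "b powr (- 2 * \<alpha>) = (b powr (- \<alpha>))\<^sup>2"
      by (simp add: power2_eq_square powr_add[symmetric])
    then show ?thesis using N by (simp add: power2_eq_square)
  qed
  finally show ?thesis
    using P.prob_compl[OF sets_typical[of \<alpha> N b l h c]] by linarith
qed

section \<open>Energy barriers inside a well\<close>

lemma finite_configs [simp]: "finite (configs N)"
  by (simp add: configs_def finite_PiE)

lemma configs_vals: "\<sigma> \<in> configs N \<Longrightarrow> v \<in> {1..N} \<Longrightarrow> \<sigma> v = -1 \<or> \<sigma> v = 1"
  by (auto simp: configs_def PiE_iff)

lemma configs_upd: "\<sigma> \<in> configs N \<Longrightarrow> v \<in> {1..N} \<Longrightarrow> x = -1 \<or> x = 1 \<Longrightarrow> \<sigma>(v := x) \<in> configs N"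
  by (auto simp: configs_def PiE_iff extensional_def)

lemma pairs_ends: "e \<in> pairs N \<Longrightarrow> fst e \<in> {1..N}" "e \<in> pairs N \<Longrightarrow> snd e \<in> {1..N}"
    "e \<in> pairs N \<Longrightarrow> fst e < snd e"
  by (auto simp: pairs_def)

lemma hamiltonian_eq: "hamiltonian N J \<sigma> = (\<Sum>e\<in>pairs N. J e * (\<sigma> (fst e) * \<sigma> (snd e)))"
  by (simp add: hamiltonian_def case_prod_unfold mult.assoc)

lemma spin_product: "\<sigma> \<in> configs N \<Longrightarrow> e \<in> pairs N \<Longrightarrow> \<sigma> (fst e) * \<sigma> (snd e) = -1 \<or> \<sigma> (fst e) * \<sigma> (snd e) = 1"
  using configs_vals[of \<sigma> N "fst e"] configs_vals[of \<sigma> N "snd e"] pairs_ends[of e N] by auto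

text \<open>\<open>\<sigma>\<^sub>0\<close> is any member of the well under study; it prescribes the
  spins of the heavy edges. The threshold lies in the interval from \<open>l\<close> to
  \<open>h\<close>, which contains no modulus of a coupling, so medium couplings are below
  \<open>l\<close> and heavy ones above \<open>h\<close>.\<close>

locale typical_couplings =
  fixes N :: nat and \<beta> :: real and J :: "nat \<times> nat \<Rightarrow> real" and thr b l h c :: real
    and \<sigma>\<^sub>0 :: "nat \<Rightarrow> real"
  assumes \<beta>: "0 < \<beta>" and N: "1 \<le> N" and c: "0 < c"
    and b: "0 < b" "b \<le> l" and thr: "l \<le> thr" "thr \<le> h"
    and typical: "typical N b l h c J"
    and \<sigma>\<^sub>0: "\<sigma>\<^sub>0 \<in> configs N" "{e \<in> pairs N. thr \<le> \<bar>J e\<bar>} \<subseteq> Sat N J \<sigma>\<^sub>0"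
begin

definition heavy :: "(nat \<times> nat) set" where
  "heavy = {e \<in> pairs N. thr \<le> \<bar>J e\<bar>}"

definition medium :: "(nat \<times> nat) set" where
  "medium = {e \<in> pairs N. b \<le> \<bar>J e\<bar> \<and> \<bar>J e\<bar> < thr}"

definition frozen_sites :: "nat set" where
  "frozen_sites = (\<Union>e\<in>heavy. {fst e, snd e})"

text \<open>The subcube form of the connected component of \<open>\<sigma>\<^sub>0\<close>;
  \<open>component_eq\<close> proves that they coincide.\<close>

definition well :: "(nat \<Rightarrow> real) set" where
  "well = {\<tau> \<in> configs N. \<forall>v\<in>frozen_sites. \<tau> v = \<sigma>\<^sub>0 v}"

definition weight :: "(nat \<Rightarrow> real) \<Rightarrow> real" where
  "weight \<sigma> = exp (\<beta> * hamiltonian N J \<sigma>)"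

definition light :: "nat \<times> nat \<Rightarrow> real" where
  "light e = (if \<bar>J e\<bar> < b then \<bar>J e\<bar> else 0)"

lemma well_subset: "well \<subseteq> configs N"
  by (auto simp: well_def)

lemma wellD: "\<sigma> \<in> well \<Longrightarrow> \<sigma> \<in> configs N"
  by (simp add: well_def)

lemma \<sigma>\<^sub>0_in_well: "\<sigma>\<^sub>0 \<in> well"
  using \<sigma>\<^sub>0 by (simp add: well_def)

lemma weight_pos: "0 < weight \<sigma>"
  by (simp add: weight_def)

lemma light_nonneg: "0 \<le> light e"
  by (simp add: light_def)

lemma sum_light: "(\<Sum>e\<in>pairs N. light e) < c"
  using typical by (simp add: typical_def light_def)

lemma big_matching:
  "e \<in> pairs N \<Longrightarrow> f \<in> pairs N \<Longrightarrow> b \<le> \<bar>J e\<bar> \<Longrightarrow> b \<le> \<bar>J f\<bar> \<Longrightarrow>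
   v \<in> {fst e, snd e} \<Longrightarrow> v \<in> {fst f, snd f} \<Longrightarrow> e = f"
  using typical unfolding typical_def touch_def by blast

lemma medium_matching:
  "e \<in> medium \<Longrightarrow> f \<in> medium \<Longrightarrow> v \<in> {fst e, snd e} \<Longrightarrow> v \<in> {fst f, snd f} \<Longrightarrow> e = f"
  using big_matching[of e f v] by (auto simp: medium_def)

lemma medium_less: "e \<in> medium \<Longrightarrow> \<bar>J e\<bar> < l"
  using typical thr by (auto simp: medium_def typical_def)

lemma heavy_greater: "e \<in> heavy \<Longrightarrow> h < \<bar>J e\<bar>"
  using typical thr by (force simp: heavy_def typical_def)

lemma frozen_pair:
  assumes "\<sigma> \<in> well" "e \<in> heavy"
  shows "\<sigma> (fst e) * \<sigma> (snd e) = sgn (J e)"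
proof -
  have "\<sigma> (fst e) = \<sigma>\<^sub>0 (fst e)" "\<sigma> (snd e) = \<sigma>\<^sub>0 (snd e)"
    using assms by (auto simp: well_def frozen_sites_def)
  moreover have "e \<in> Sat N J \<sigma>\<^sub>0" using assms(2) \<sigma>\<^sub>0(2) by (auto simp: heavy_def)
  ultimately show ?thesis by (auto simp: Sat_def)
qed

text \<open>The well is a subcube, so sitewise mixtures of members are members; canonical paths and
  their encodings therefore stay inside.\<close>

lemma well_mix: "\<sigma> \<in> well \<Longrightarrow> \<tau> \<in> well \<Longrightarrow> override_on \<sigma> \<tau> S \<in> well"
  by (auto simp: well_def configs_def PiE_iff extensional_def override_on_def)

sublocale heat_bath "{1..N}" well weight
  by unfold_locales (auto intro: finite_subset[OF well_subset] weight_pos)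

section \<open>An order of the sites adapted to the medium matching\<close>

definition ends :: "nat \<times> nat \<Rightarrow> nat set" where
  "ends e = {fst e, snd e}"

text \<open>A label shared by exactly the two ends of a medium edge, namely its first end; any other
  site is its own label. Ordering lexicographically by label and site, written in base
  \<open>Suc N\<close>, gives the key.\<close>

definition mate_min :: "nat \<Rightarrow> nat" where
  "mate_min w = (if \<exists>e\<in>medium. w \<in> ends e then fst (SOME e. e \<in> medium \<and> w \<in> ends e) else w)"

text \<open>Sites matched by a medium coupling are consecutive in the order of \<open>site_key\<close>.\<close>

definition site_key :: "nat \<Rightarrow> nat" where
  "site_key w = w + mate_min w * Suc N"

lemma medium_unique: "e \<in> medium \<Longrightarrow> f \<in> medium \<Longrightarrow> v \<in> ends e \<Longrightarrow> v \<in> ends f \<Longrightarrow> f = e"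
  unfolding ends_def by (rule medium_matching)

lemma mate_min_eq:
  assumes "e \<in> medium" "w \<in> ends e"
  shows "mate_min w = fst e"
proof -
  have "(SOME e. e \<in> medium \<and> w \<in> ends e) = e"
    by (rule some_equality) (use assms medium_unique in blast)+
  then show ?thesis using assms by (auto simp: mate_min_def)
qed

lemma mate_min_fst:
  assumes "e \<in> medium" "mate_min w = fst e"
  shows "w \<in> ends e"
proof (cases "\<exists>f\<in>medium. w \<in> ends f")
  case True
  then obtain f where f: "f \<in> medium" "w \<in> ends f" by blast
  then have "fst f = fst e" using mate_min_eq assms(2) by metis
  then have "e = f" using medium_matching[OF assms(1) f(1), of "fst e"] by simp
  then show ?thesis using f by simp
next
  case False
  then show ?thesis using assms by (simp add: mate_min_def ends_def)
qed

lemma mate_min_le: "w \<le> N \<Longrightarrow> mate_min w \<le> N"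
proof (cases "\<exists>f\<in>medium. w \<in> ends f")
  case True
  then obtain f where f: "f \<in> medium" "w \<in> ends f" by blast
  then have "fst f \<in> {1..N}" using pairs_ends(1)[of f N] by (simp add: medium_def)
  then show ?thesis using mate_min_eq[OF f] by simp
next
  case False
  then show "w \<le> N \<Longrightarrow> ?thesis" by (simp add: mate_min_def)
qed

lemma site_key_div: "w \<le> N \<Longrightarrow> site_key w div Suc N = mate_min w"
  unfolding site_key_def by (subst div_mult_self1) (simp_all del: mult_Suc_right)

lemma site_key_mod: "w \<le> N \<Longrightarrow> site_key w mod Suc N = w"
  unfolding site_key_def by (subst mod_mult_self1) (simp_all del: mult_Suc_right)

lemma inj_site_key: "inj_on site_key {1..N}"
proof (rule inj_onI)
  fix x y assume "x \<in> {1..N}" "y \<in> {1..N}" and eq: "site_key x = site_key y"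
  then have "x \<le> N" "y \<le> N" by simp_all
  from site_key_mod[OF this(1)] site_key_mod[OF this(2)] show "x = y" unfolding eq by (rule trans[OF sym])
qed

lemma site_key_less: "w \<le> N \<Longrightarrow> site_key w < Suc N * Suc N"
  using mult_le_mono1[OF mate_min_le, of w "Suc N"] unfolding site_key_def mult_Suc by linarith

lemma site_key_iff:
  assumes "u \<le> N" "v \<le> N" "mate_min u \<noteq> mate_min v"
  shows "site_key u < site_key v \<longleftrightarrow> mate_min u < mate_min v"
  using div_le_mono[of "site_key u" "site_key v" "Suc N"] div_le_mono[of "site_key v" "site_key u" "Suc N"]
    site_key_div[OF assms(1)] site_key_div[OF assms(2)] assms(3) by linarith

text \<open>No third site has the label of the edge, so both ends compare with \<open>v\<close>
  through the label alone. A prefix of the order thus separates no medium edge except possibly the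
  one at its boundary.\<close>

lemma medium_consecutive:
  assumes e: "e \<in> medium" and v: "v \<in> {1..N}" "v \<notin> ends e"
  shows "site_key (fst e) < site_key v \<longleftrightarrow> site_key (snd e) < site_key v"
proof -
  have "fst e \<le> N" "snd e \<le> N" using e pairs_ends[of e N] by (auto simp: medium_def)
  moreover have "mate_min (fst e) = fst e" "mate_min (snd e) = fst e"
    using mate_min_eq[OF e] by (auto simp: ends_def)
  moreover have "mate_min v \<noteq> fst e" using mate_min_fst[OF e] v(2) by blast
  ultimately show ?thesis using v(1) site_key_iff[of "fst e" v] site_key_iff[of "snd e" v] by simp
qed

text \<open>The energies are compared edge by edge. Heavy edges have the same bond in all four
  configurations and cancel, whatever their size; light edges cost at most \<open>4 * c\<close> in
  total; among the medium edges only \<open>e\<^sub>0\<close>, the one being crossed, may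
  cost.\<close>

lemma exchange_energy:
  assumes C: "\<sigma> \<in> well" "\<tau> \<in> well" "\<xi> \<in> well" "\<eta> \<in> well"
    and med: "\<And>e. e \<in> medium \<Longrightarrow> J e * (\<sigma> (fst e) * \<sigma> (snd e) + \<tau> (fst e) * \<tau> (snd e)
        - \<eta> (fst e) * \<eta> (snd e) - \<xi> (fst e) * \<xi> (snd e)) \<le> (if e = e\<^sub>0 then 2 * l else 0)"
  shows "weight \<sigma> * weight \<tau> \<le> exp (2 * \<beta> * l + 4 * \<beta> * c) * weight \<eta> * weight \<xi>"
proof -
  let ?p = "\<lambda>\<sigma> e. \<sigma> (fst e) * \<sigma> (snd e) :: real"
  let ?d = "\<lambda>e. J e * (?p \<sigma> e + ?p \<tau> e - ?p \<eta> e - ?p \<xi> e)"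
  have l0: "0 \<le> l" using b by simp
  have "?d e \<le> (if e = e\<^sub>0 then 2 * l else 0) + 4 * light e" if e: "e \<in> pairs N" for e
  proof -
    consider "e \<in> heavy" | "e \<in> medium" | "\<bar>J e\<bar> < b"
      using e by (force simp: heavy_def medium_def)
    then show ?thesis
    proof cases
      case 1
      then have "?d e = 0" using frozen_pair C by simp
      moreover have "0 \<le> (if e = e\<^sub>0 then 2 * l else 0)" using l0 by simp
      ultimately show ?thesis using light_nonneg[of e] by linarith
    next
      case 2
      then show ?thesis using med[OF 2] light_nonneg[of e] by linarith
    next
      case 3
      have p1: "?p x e \<le> 1" "- 1 \<le> ?p x e" if "x \<in> well" for x
        using spin_product[OF wellD[OF that] e] by auto
      have "\<bar>?p \<sigma> e + ?p \<tau> e - ?p \<eta> e - ?p \<xi> e\<bar> \<le> 4"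
        using p1[OF C(1)] p1[OF C(2)] p1[OF C(3)] p1[OF C(4)] by (intro abs_leI) linarith+
      then have "\<bar>J e\<bar> * \<bar>?p \<sigma> e + ?p \<tau> e - ?p \<eta> e - ?p \<xi> e\<bar> \<le> \<bar>J e\<bar> * 4"
        by (rule mult_left_mono) simp
      then have "?d e \<le> \<bar>J e\<bar> * 4"
        unfolding abs_mult[symmetric] by (rule order_trans[OF abs_ge_self])
      moreover have "light e = \<bar>J e\<bar>" using 3 by (simp add: light_def)
      moreover have "0 \<le> (if e = e\<^sub>0 then 2 * l else 0)" using l0 by simp
      ultimately show ?thesis by linarith
    qed
  qed
  then have "(\<Sum>e\<in>pairs N. ?d e) \<le> (\<Sum>e\<in>pairs N. (if e = e\<^sub>0 then 2 * l else 0) + 4 * light e)"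
    by (rule sum_mono)
  also have "\<dots> = (\<Sum>e\<in>pairs N. if e = e\<^sub>0 then 2 * l else 0) + 4 * (\<Sum>e\<in>pairs N. light e)"
    by (simp add: sum.distrib sum_distrib_left)
  also have "\<dots> \<le> 2 * l + 4 * c"
    using sum_light l0 by (simp add: sum.delta')
  finally have "hamiltonian N J \<sigma> + hamiltonian N J \<tau> - hamiltonian N J \<eta> - hamiltonian N J \<xi> \<le> 2 * l + 4 * c"
    by (simp add: hamiltonian_eq sum.distrib sum_subtractf distrib_left right_diff_distrib)
  then have "\<beta> * (hamiltonian N J \<sigma> + hamiltonian N J \<tau> - hamiltonian N J \<eta> - hamiltonian N J \<xi>) \<le> \<beta> * (2 * l + 4 * c)"
    using \<beta> by (intro mult_left_mono) auto
  then have "\<beta> * hamiltonian N J \<sigma> + \<beta> * hamiltonian N J \<tau>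
      \<le> (2 * \<beta> * l + 4 * \<beta> * c) + \<beta> * hamiltonian N J \<eta> + \<beta> * hamiltonian N J \<xi>"
    by (simp add: algebra_simps)
  then show ?thesis
    unfolding weight_def exp_add[symmetric] by simp
qed

text \<open>If \<open>S\<close> contains both ends of the medium edge at \<open>v\<close> or
  neither, the encoding has on this edge the bond of \<open>\<sigma>\<close> or of
  \<open>\<tau>\<close>, which cancels. What remains is a difference of two signs, so the cost is
  \<open>2 * l\<close> instead of \<open>4 * l\<close>; this brings the relaxation bound below the
  time scale set by the threshold.\<close>

lemma path_energy:
  assumes v: "v \<in> {1..N}"
  defines "P \<equiv> {u \<in> {1..N}. site_key u < site_key v}"
  shows "\<exists>S\<in>{P, insert v P}. \<forall>\<sigma>\<in>well. \<forall>\<tau>\<in>well. weight \<sigma> * weight \<tau>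
     \<le> exp (2 * \<beta> * l + 4 * \<beta> * c) * weight (override_on \<tau> \<sigma> S) *
        min (weight (override_on \<sigma> \<tau> P)) (weight (override_on \<sigma> \<tau> (insert v P)))"
proof -
  \<comment> \<open>The pair \<open>(0, 0)\<close> stands for an unmatched \<open>v\<close>. It is
    no edge, and its end 0 lies outside \<open>P\<close>, so then \<open>S = P\<close>.\<close>
  define e\<^sub>0 where "e\<^sub>0 = (if \<exists>e\<in>medium. v \<in> ends e then SOME e. e \<in> medium \<and> v \<in> ends e else (0, 0))"
  \<comment> \<open>If the partner of \<open>v\<close> has already been flipped, \<open>v\<close>
    joins it in the cut; otherwise both stay out.\<close>
  define S where "S = (if ends e\<^sub>0 \<inter> P \<noteq> {} then insert v P else P)"
  have e\<^sub>0: "e = e\<^sub>0" if "e \<in> medium" "v \<in> ends e" for e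
  proof -
    have "(SOME e. e \<in> medium \<and> v \<in> ends e) = e"
      by (rule some_equality) (use that medium_unique in blast)+
    then show ?thesis using that by (auto simp: e\<^sub>0_def)
  qed
  have vP: "v \<notin> P" by (simp add: P_def)
  have bound: "weight \<sigma> * weight \<tau> \<le> exp (2 * \<beta> * l + 4 * \<beta> * c) * weight (override_on \<tau> \<sigma> S) *
      weight (override_on \<sigma> \<tau> Q)"
    if st: "\<sigma> \<in> well" "\<tau> \<in> well" and Q: "Q = P \<or> Q = insert v P" for \<sigma> \<tau> Q
  proof (rule exchange_energy[OF st well_mix[OF st] well_mix[OF st(2,1)], where e\<^sub>0 = e\<^sub>0])
    fix e assume e: "e \<in> medium"
    then have ep: "e \<in> pairs N" by (simp add: medium_def)
    let ?p = "\<lambda>\<sigma>. \<sigma> (fst e) * \<sigma> (snd e) :: real"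
    let ?\<eta> = "override_on \<tau> \<sigma> S" and ?\<xi> = "override_on \<sigma> \<tau> Q"
    show "J e * (?p \<sigma> + ?p \<tau> - ?p ?\<eta> - ?p ?\<xi>) \<le> (if e = e\<^sub>0 then 2 * l else 0)"
    proof (cases "v \<in> ends e")
      case False
      then have ne: "fst e \<noteq> v" "snd e \<noteq> v" by (auto simp: ends_def)
      have "fst e \<in> P \<longleftrightarrow> snd e \<in> P"
        using medium_consecutive[OF e v False] pairs_ends[OF ep] by (simp add: P_def)
      then have "fst e \<in> S \<longleftrightarrow> fst e \<in> P" "snd e \<in> S \<longleftrightarrow> fst e \<in> P"
        "fst e \<in> Q \<longleftrightarrow> fst e \<in> P" "snd e \<in> Q \<longleftrightarrow> fst e \<in> P"
        using ne Q by (auto simp: S_def)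
      then have "?p \<sigma> + ?p \<tau> - ?p ?\<eta> - ?p ?\<xi> = 0"
        by (cases "fst e \<in> P") (simp_all add: override_on_def)
      then show ?thesis using b by simp
    next
      case True
      then have e0: "e = e\<^sub>0" using e\<^sub>0[OF e] by simp
      have same: "fst e \<in> S \<longleftrightarrow> snd e \<in> S"
      proof (cases "ends e \<inter> P = {}")
        case True
        then show ?thesis using e0 by (auto simp: S_def ends_def)
      next
        case False
        then have "S = insert v P" using e0 by (simp add: S_def)
        then show ?thesis using False True vP by (auto simp: ends_def)
      qed
      have pm: "?p x \<in> {-1, 1}" if "x \<in> well" for x
        using spin_product[OF wellD[OF that] ep] by auto
      have "?p ?\<eta> = ?p \<sigma> \<or> ?p ?\<eta> = ?p \<tau>"
        using same by (auto simp: override_on_def)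
      then have "\<bar>?p \<sigma> + ?p \<tau> - ?p ?\<eta> - ?p ?\<xi>\<bar> \<le> 2"
        using pm[OF st(1)] pm[OF st(2)] pm[OF well_mix[OF st, of Q]] by auto
      then have "\<bar>J e\<bar> * \<bar>?p \<sigma> + ?p \<tau> - ?p ?\<eta> - ?p ?\<xi>\<bar> \<le> l * 2"
        using medium_less[OF e] by (intro mult_mono) auto
      then show ?thesis
        using e0 abs_ge_self[of "J e * (?p \<sigma> + ?p \<tau> - ?p ?\<eta> - ?p ?\<xi>)"] by (simp add: abs_mult)
    qed
  qed
  have "S \<in> {P, insert v P}" by (simp add: S_def)
  moreover have "weight \<sigma> * weight \<tau> \<le> exp (2 * \<beta> * l + 4 * \<beta> * c) * weight (override_on \<tau> \<sigma> S) *
        min (weight (override_on \<sigma> \<tau> P)) (weight (override_on \<sigma> \<tau> (insert v P)))"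
    if "\<sigma> \<in> well" "\<tau> \<in> well" for \<sigma> \<tau>
    using bound[OF that, of P] bound[OF that, of "insert v P"] by (simp add: min_def)
  ultimately show ?thesis by blast
qed

text \<open>An upper bound for the relaxation time: the factor \<open>2 * B * M\<close> of the
  canonical paths, with \<open>B = (N+1)^2\<close> bounding the site keys.\<close>

definition relax :: real where
  "relax = 2 * real (Suc N * Suc N) * exp (2 * \<beta> * l + 4 * \<beta> * c)"

lemma relax_ge: "1 \<le> relax"
proof -
  have "1 \<le> 2 * real (Suc N * Suc N)" by simp
  moreover have "1 \<le> exp (2 * \<beta> * l + 4 * \<beta> * c)"
    using \<beta> b c by (subst one_le_exp_iff) (intro add_nonneg_nonneg mult_nonneg_nonneg, auto)
  ultimately have "1 * 1 \<le> relax" unfolding relax_def by (intro mult_mono) auto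
  then show ?thesis by simp
qed

lemma well_outside:
  assumes "\<sigma> \<in> well" "\<tau> \<in> well" "v \<notin> {1..N}"
  shows "\<sigma> v = \<tau> v"
  using wellD[OF assms(1)] wellD[OF assms(2)] assms(3)
  by (auto simp: configs_def PiE_iff extensional_def)

lemma poincare:
  assumes "(\<Sum>\<sigma>\<in>well. weight \<sigma> * f \<sigma>) = 0"
  shows "1 / relax * (\<Sum>\<sigma>\<in>well. weight \<sigma> * (f \<sigma>)\<^sup>2)
     \<le> (\<Sum>v\<in>{1..N}. \<Sum>\<sigma>\<in>well. weight \<sigma> * f \<sigma> * (f \<sigma> - heat v f \<sigma>))" (is "_ \<le> ?D")
proof -
  let ?M = "exp (2 * \<beta> * l + 4 * \<beta> * c)"
  have "(\<Sum>\<sigma>\<in>well. weight \<sigma> * (f \<sigma>)\<^sup>2) \<le> 2 * real (Suc N * Suc N) * ?M * ?D"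
  proof (rule poincare_canonical_paths[where key = site_key and f = f, OF inj_site_key])
    show "site_key v < Suc N * Suc N" if "v \<in> {1..N}" for v
      using that site_key_less by simp
    show "\<sigma> v \<in> {-1, 1}" if "\<sigma> \<in> well" "v \<in> {1..N}" for \<sigma> v
      using configs_vals[OF wellD[OF that(1)] that(2)] by auto
  qed (use well_outside well_mix path_energy assms in auto)
  then have "(\<Sum>\<sigma>\<in>well. weight \<sigma> * (f \<sigma>)\<^sup>2) \<le> relax * ?D" by (simp only: relax_def)
  then have "1 / relax * (\<Sum>\<sigma>\<in>well. weight \<sigma> * (f \<sigma>)\<^sup>2) \<le> 1 / relax * (relax * ?D)"
    using relax_ge by (intro mult_left_mono) auto
  then show ?thesis using relax_ge by simp
qed

end

section \<open>Mixing and escape\<close>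

lemma gibbs_nonneg: "0 \<le> gibbs N \<beta> J \<sigma>"
  by (simp add: gibbs_def sum_nonneg)

text \<open>Stated for every \<open>\<sigma>\<close>, since \<open>two_way_step\<close> asks for a
  threshold in \<open>[0,1]\<close> at every state; where the conditioning set is empty the quotient
  is \<open>0 / 0 = 0\<close>.\<close>

lemma prob_plus_bounds: "0 \<le> prob_plus N \<beta> J v \<sigma>" "prob_plus N \<beta> J v \<sigma> \<le> 1"
proof -
  have "finite {\<tau> \<in> configs N. \<forall>w. w \<noteq> v \<longrightarrow> \<tau> w = \<sigma> w}" by simp
  then have "(\<Sum>\<tau>\<in>{\<tau> \<in> configs N. \<forall>w. w \<noteq> v \<longrightarrow> \<tau> w = \<sigma> w} \<inter> {\<tau>. \<tau> v = 1}. gibbs N \<beta> J \<tau>)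
      \<le> (\<Sum>\<tau>\<in>{\<tau> \<in> configs N. \<forall>w. w \<noteq> v \<longrightarrow> \<tau> w = \<sigma> w}. gibbs N \<beta> J \<tau>)"
    by (rule sum_mono2) (auto simp: gibbs_nonneg)
  then show "0 \<le> prob_plus N \<beta> J v \<sigma>" "prob_plus N \<beta> J v \<sigma> \<le> 1"
    unfolding prob_plus_def gibbs_given_def
    by (auto intro!: divide_nonneg_nonneg sum_nonneg gibbs_nonneg divide_le_eq_1[THEN iffD2] simp: less_le)
qed

lemma gibbs_given_eq:
  assumes "A \<subseteq> configs N"
  shows "gibbs_given N \<beta> J A B =
    (\<Sum>\<sigma>\<in>A \<inter> B. exp (\<beta> * hamiltonian N J \<sigma>)) / (\<Sum>\<sigma>\<in>A. exp (\<beta> * hamiltonian N J \<sigma>))"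
proof (cases "configs N = {}")
  case False
  then have "0 < (\<Sum>\<tau>\<in>configs N. exp (\<beta> * hamiltonian N J \<tau>))"
    by (intro sum_pos) auto
  then show ?thesis
    by (simp add: gibbs_given_def gibbs_def sum_divide_distrib[symmetric])
qed (use assms in \<open>simp add: gibbs_given_def\<close>)

lemma prob_plus_eq:
  assumes \<sigma>: "\<sigma> \<in> configs N" and v: "v \<in> {1..N}"
  shows "prob_plus N \<beta> J v \<sigma> = exp (\<beta> * hamiltonian N J (\<sigma>(v := 1))) /
     (exp (\<beta> * hamiltonian N J (\<sigma>(v := 1))) + exp (\<beta> * hamiltonian N J (\<sigma>(v := -1))))"
proof -
  let ?A = "{\<tau> \<in> configs N. \<forall>w. w \<noteq> v \<longrightarrow> \<tau> w = \<sigma> w}"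
  have A: "?A = {\<sigma>(v := 1), \<sigma>(v := -1)}"
  proof (intro set_eqI iffI)
    fix \<tau> assume "\<tau> \<in> ?A"
    then have "\<tau> = \<sigma>(v := \<tau> v)" "\<tau> v = -1 \<or> \<tau> v = 1"
      using configs_vals[of \<tau> N v] v by (auto simp: fun_eq_iff)
    then show "\<tau> \<in> {\<sigma>(v := 1), \<sigma>(v := -1)}" by auto
  qed (use configs_upd[OF \<sigma> v] in auto)
  have B: "?A \<inter> {\<tau>. \<tau> v = 1} = {\<sigma>(v := 1)}"
    unfolding A by auto
  have "\<sigma>(v := 1) \<noteq> \<sigma>(v := -1)" by (auto simp: fun_eq_iff)
  then show ?thesis
    unfolding prob_plus_def by (subst gibbs_given_eq) (simp_all add: B, simp add: A)
qed

locale restricted_glauber =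
  fixes N :: nat and \<beta> :: real and J :: "nat \<times> nat \<Rightarrow> real" and C :: "(nat \<Rightarrow> real) set"
begin

sublocale two_way_step "prob_plus N \<beta> J"
    "\<lambda>v \<sigma>. if \<sigma>(v := 1) \<in> C then \<sigma>(v := 1) else \<sigma>"
    "\<lambda>v \<sigma>. if \<sigma>(v := -1) \<in> C then \<sigma>(v := -1) else \<sigma>"
  by standard (rule prob_plus_bounds)+

lemma step_eq: "step v u \<sigma> = resample N \<beta> J C v u \<sigma>"
  by (simp add: step_def resample_def)

lemma glauber_eq:
  "glauber N \<beta> J C x \<omega> t = fold (\<lambda>(v, k). step v (snd (\<omega> v k))) (rings_until N \<omega> t) x"
  unfolding glauber_def step_eq ..

end

lemma two_point_mean:
  fixes y z :: real
  assumes "y + z \<noteq> 0"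
  shows "y / (y + z) * r + (1 - y / (y + z)) * s = (y * r + z * s) / (y + z)"
proof -
  have "1 - y / (y + z) = z / (y + z)" using assms by (simp add: field_simps)
  then show ?thesis by (simp add: add_divide_distrib)
qed

lemma exp_series_sums:
  fixes t q r k :: real
  shows "(\<lambda>n. r * t ^ n / fact n * (q ^ n * k)) sums (r * k * exp (t * q))"
  using sums_mult[OF exp_converges[of "t * q"], of "r * k"]
  by (simp add: power_mult_distrib divide_inverse mult_ac)

lemma le_Inf_ereal_iff:
  fixes s :: real
  shows "ereal s \<le> Inf (ereal ` {t. 0 \<le> t \<and> \<not> P t}) \<longleftrightarrow> (\<forall>t. 0 \<le> t \<longrightarrow> t < s \<longrightarrow> P t)"
  unfolding le_Inf_iff by (auto simp: not_less[symmetric])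

section \<open>Convergence to equilibrium in a well, and escape from it\<close>

context typical_couplings
begin

text \<open>If the flip leaves the well, both outcomes equal \<open>\<sigma>\<close>. Otherwise
  \<open>prob_plus\<close> is the share of the plus weight in the flip pair, and conditioning on the
  well does not change this ratio.\<close>

lemma avg_eq_heat:
  assumes \<sigma>: "\<sigma> \<in> well" and v: "v \<in> {1..N}"
  shows "two_way_step.avg (prob_plus N \<beta> J)
    (\<lambda>v \<sigma>. if \<sigma>(v := 1) \<in> well then \<sigma>(v := 1) else \<sigma>)
    (\<lambda>v \<sigma>. if \<sigma>(v := -1) \<in> well then \<sigma>(v := -1) else \<sigma>) v f \<sigma> = heat v f \<sigma>"
proof -
  interpret R: restricted_glauber N \<beta> J well .
  have p: "prob_plus N \<beta> J v \<sigma> = weight (\<sigma>(v := 1)) / (weight (\<sigma>(v := 1)) + weight (\<sigma>(v := -1)))"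
    unfolding weight_def by (rule prob_plus_eq[OF wellD[OF \<sigma>] v])
  have pos: "weight (\<sigma>(v := 1)) + weight (\<sigma>(v := -1)) \<noteq> 0"
    using weight_pos[of "\<sigma>(v := 1)"] weight_pos[of "\<sigma>(v := -1)"] by simp
  consider "\<sigma> v = 1" | "\<sigma> v = -1" using configs_vals[OF wellD[OF \<sigma>] v] by blast
  then show ?thesis
  proof cases
    case 1
    then have e: "\<sigma>(v := 1) = \<sigma>" "\<sigma>(v := -1) = flip v \<sigma>" by (auto simp: flip_def)
    show ?thesis
      using \<sigma> two_point_mean[OF pos, of "f \<sigma>" "f (flip v \<sigma>)"] two_point_mean[OF pos, of "f \<sigma>" "f \<sigma>"] pos
      unfolding R.avg_def p heat_def e by (simp add: distrib_right[symmetric])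
  next
    case 2
    then have e: "\<sigma>(v := -1) = \<sigma>" "\<sigma>(v := 1) = flip v \<sigma>" by (auto simp: flip_def)
    show ?thesis
      using \<sigma> two_point_mean[OF pos, of "f (flip v \<sigma>)" "f \<sigma>"] two_point_mean[OF pos, of "f \<sigma>" "f \<sigma>"] pos
      unfolding R.avg_def p heat_def e by (simp add: distrib_right[symmetric] add.commute)
  qed
qed

text \<open>The operators are compared at points of the well only; this passes to powers because
  \<open>heat\<close> at such a point evaluates its argument inside the well.\<close>

lemma total_pow_eq_sweep:
  assumes "\<sigma> \<in> well"
  shows "(two_way_step.total (prob_plus N \<beta> J)
    (\<lambda>v \<sigma>. if \<sigma>(v := 1) \<in> well then \<sigma>(v := 1) else \<sigma>)
    (\<lambda>v \<sigma>. if \<sigma>(v := -1) \<in> well then \<sigma>(v := -1) else \<sigma>) N ^^ n) f \<sigma> = (sweep ^^ n) f \<sigma>"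
  using assms
proof (induction n arbitrary: \<sigma>)
  case (Suc n)
  interpret R: restricted_glauber N \<beta> J well .
  have "R.total N ((R.total N ^^ n) f) \<sigma> = (\<Sum>v\<in>{1..N}. heat v ((R.total N ^^ n) f) \<sigma>)"
    unfolding R.total_def[of N "(R.total N ^^ n) f"] by (intro sum.cong refl avg_eq_heat Suc.prems)
  also have "\<dots> = (\<Sum>v\<in>{1..N}. heat v ((sweep ^^ n) f) \<sigma>)"
  proof (intro sum.cong refl)
    fix v
    show "heat v ((R.total N ^^ n) f) \<sigma> = heat v ((sweep ^^ n) f) \<sigma>"
      unfolding heat_def by (cases "flip v \<sigma> \<in> well") (simp_all only: if_True if_False Suc.IH Suc.prems)
  qed
  also have "\<dots> = sweep ((sweep ^^ n) f) \<sigma>" by (rule sweep_def[symmetric])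
  finally show ?case unfolding funpow.simps o_apply .
qed simp

definition partition_sum :: real where
  "partition_sum = (\<Sum>\<sigma>\<in>well. weight \<sigma>)"

lemma partition_sum_pos: "0 < partition_sum"
  unfolding partition_sum_def using \<sigma>\<^sub>0_in_well finite_C weight_pos by (intro sum_pos) auto

text \<open>The indicator of \<open>A\<close> splits into its stationary mean and a mean zero part.
  In the Poisson series the mean sums to itself, and the rest is dominated by powers of
  \<open>N - 1 / (2 * relax)\<close>, whose series gives the exponential decay.\<close>

lemma law_close:
  assumes x: "x \<in> well" and t: "0 \<le> t"
  shows "\<bar>measure (clock_space N) {\<omega> \<in> space (clock_space N). glauber N \<beta> J well x \<omega> t \<in> A}
      - gibbs_given N \<beta> J well A\<bar> \<le> exp (- (t / (2 * relax))) * sqrt (partition_sum / weight x)"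
proof -
  interpret R: restricted_glauber N \<beta> J well .
  let ?K = "sqrt (partition_sum / weight x)" and ?q = "real N - 1 / relax / 2"
  let ?P = "measure (clock_space N) {\<omega> \<in> space (clock_space N). glauber N \<beta> J well x \<omega> t \<in> A}"
  define \<pi> where "\<pi> = gibbs_given N \<beta> J well A"
  define f where "f \<sigma> = indicator A \<sigma> - \<pi>" for \<sigma> :: "nat \<Rightarrow> real"
  have \<pi>: "\<pi> = (\<Sum>\<sigma>\<in>well. weight \<sigma> * indicator A \<sigma>) / partition_sum"
    unfolding \<pi>_def gibbs_given_eq[OF well_subset] partition_sum_def weight_def
    using finite_C by (simp add: sum.inter_restrict indicator_def if_distrib cong: if_cong)
  have \<pi>01: "0 \<le> \<pi>" "\<pi> \<le> 1"
  proof -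
    show "0 \<le> \<pi>" unfolding \<pi> using partition_sum_pos weight_pos
      by (intro divide_nonneg_nonneg sum_nonneg) (auto simp: less_imp_le)
    have "(\<Sum>\<sigma>\<in>well. weight \<sigma> * indicator A \<sigma>) \<le> partition_sum"
      unfolding partition_sum_def using weight_pos
      by (intro sum_mono) (auto simp: less_imp_le split: split_indicator)
    then show "\<pi> \<le> 1" unfolding \<pi> using partition_sum_pos by simp
  qed
  have mean: "(\<Sum>\<sigma>\<in>well. weight \<sigma> * f \<sigma>) = 0"
  proof -
    have "(\<Sum>\<sigma>\<in>well. weight \<sigma> * f \<sigma>) = (\<Sum>\<sigma>\<in>well. weight \<sigma> * indicator A \<sigma>) - partition_sum * \<pi>"
      by (simp add: f_def right_diff_distrib sum_subtractf partition_sum_def sum_distrib_right)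
    then show ?thesis using partition_sum_pos by (simp add: \<pi>)
  qed
  have le1: "\<bar>f \<sigma>\<bar> \<le> 1" for \<sigma>
    using \<pi>01 by (auto simp: f_def split: split_indicator)
  have r: "0 \<le> 1 / relax" "1 / relax \<le> card {1..N}" "0 \<le> ?q"
  proof -
    have "1 / relax \<le> 1" using relax_ge by simp
    moreover have "0 \<le> 1 / relax" using relax_ge by simp
    ultimately show "0 \<le> 1 / relax" "1 / relax \<le> card {1..N}" "0 \<le> ?q" using N by auto
  qed
  have f_bound: "\<bar>(R.total N ^^ n) f x\<bar> \<le> ?q ^ n * ?K" for n
    using sweep_powers_pointwise[OF poincare r(1,2) mean le1 x, of n]
    unfolding total_pow_eq_sweep[OF x] partition_sum_def by simp
  have ind: "(R.total N ^^ n) (indicator A) x = \<pi> * real N ^ n + (R.total N ^^ n) f x" for n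
  proof -
    have "indicator A = (\<lambda>\<sigma>. \<pi> + f \<sigma>)" by (simp add: f_def fun_eq_iff)
    then show ?thesis
      using R.total_pow_add[of n N "\<lambda>_. \<pi>" f] R.total_pow_const[of n N \<pi>] by (simp only:)
  qed
  let ?a = "\<lambda>n. exp (- (N * t)) * t ^ n / fact n"
  have "(\<lambda>n. ?a n * (R.total N ^^ n) (indicator A) x) sums ?P"
    using R.fold_rings_law[OF t, of N A x] by (simp only: R.glauber_eq)
  moreover have "(\<lambda>n. ?a n * (\<pi> * real N ^ n)) sums \<pi>"
  proof -
    have "(\<lambda>n. ?a n * (real N ^ n * \<pi>)) sums (exp (- (N * t)) * \<pi> * exp (t * N))"
      by (rule exp_series_sums)
    moreover have "exp (- (N * t)) * \<pi> * exp (t * N) = \<pi>"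
      by (simp add: exp_minus mult.commute)
    ultimately show ?thesis by (simp only: mult.commute[of \<pi>])
  qed
  ultimately have "(\<lambda>n. ?a n * (R.total N ^^ n) (indicator A) x - ?a n * (\<pi> * real N ^ n)) sums (?P - \<pi>)"
    by (rule sums_diff)
  then have d: "(\<lambda>n. ?a n * (R.total N ^^ n) f x) sums (?P - \<pi>)"
    by (simp add: ind distrib_left)
  have "(\<lambda>n. ?a n * (?q ^ n * ?K)) sums (exp (- (N * t)) * ?K * exp (t * ?q))"
    by (rule exp_series_sums)
  moreover have "exp (- (N * t)) * ?K * exp (t * ?q) = exp (- (t / (2 * relax))) * ?K"
  proof -
    have "- (N * t) + t * ?q = - (t / (2 * relax))" by (simp add: algebra_simps)
    then have "exp (- (N * t)) * exp (t * ?q) = exp (- (t / (2 * relax)))"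
      by (simp only: exp_add[symmetric])
    then show ?thesis by (simp add: mult_ac)
  qed
  ultimately have u: "(\<lambda>n. ?a n * (?q ^ n * ?K)) sums (exp (- (t / (2 * relax))) * ?K)" by (simp only:)
  have le: "\<bar>?a n * (R.total N ^^ n) f x\<bar> \<le> ?a n * (?q ^ n * ?K)" for n
    using t f_bound[of n] by (simp only: abs_mult, intro mult_mono) auto
  have "?P - \<pi> \<le> exp (- (t / (2 * relax))) * ?K"
    by (rule sums_le[OF order_trans[OF abs_ge_self le] d u])
  moreover have "- (?P - \<pi>) \<le> exp (- (t / (2 * relax))) * ?K"
    by (rule sums_le[OF order_trans[OF abs_ge_minus_self le] sums_minus[OF d] u])
  ultimately show ?thesis unfolding \<pi>_def by (simp add: abs_le_iff)
qed

text \<open>Heavy couplings have no upper bound, but contribute equally to both energies. Each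
  remaining coupling has modulus at most \<open>l\<close> and changes its term by at most
  \<open>2 * l\<close>.\<close>

lemma weight_ratio:
  assumes "\<sigma> \<in> well" "x \<in> well"
  shows "weight \<sigma> \<le> exp (2 * \<beta> * (real N * real N * l)) * weight x"
proof -
  let ?p = "\<lambda>\<sigma> e. \<sigma> (fst e) * \<sigma> (snd e) :: real"
  have l0: "0 \<le> l" using b by simp
  have "J e * (?p \<sigma> e - ?p x e) \<le> 2 * l" if e: "e \<in> pairs N" for e
  proof (cases "e \<in> heavy")
    case True
    then show ?thesis using frozen_pair assms l0 by simp
  next
    case False
    then have "\<bar>J e\<bar> \<le> l"
      using e medium_less[of e] b by (cases "\<bar>J e\<bar> < b") (auto simp: heavy_def medium_def)
    moreover have "\<bar>?p \<sigma> e - ?p x e\<bar> \<le> 2"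
      using spin_product[OF wellD[OF assms(1)] e] spin_product[OF wellD[OF assms(2)] e] by auto
    ultimately have "\<bar>J e\<bar> * \<bar>?p \<sigma> e - ?p x e\<bar> \<le> l * 2"
      using l0 by (intro mult_mono) auto
    then show ?thesis
      using abs_ge_self[of "J e * (?p \<sigma> e - ?p x e)"] by (simp add: abs_mult)
  qed
  then have "(\<Sum>e\<in>pairs N. J e * (?p \<sigma> e - ?p x e)) \<le> (\<Sum>e\<in>pairs N. 2 * l)"
    by (rule sum_mono)
  also have "\<dots> \<le> real N * real N * (2 * l)"
  proof -
    have "real (card (pairs N)) \<le> real N * real N"
      using card_pairs_le[of N] by (simp only: of_nat_mult[symmetric] of_nat_le_iff)
    then show ?thesis using l0 by (simp add: mult_right_mono)
  qed
  finally have "hamiltonian N J \<sigma> - hamiltonian N J x \<le> real N * real N * (2 * l)"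
    by (simp add: hamiltonian_eq sum_subtractf right_diff_distrib)
  then have "\<beta> * (hamiltonian N J \<sigma> - hamiltonian N J x) \<le> \<beta> * (real N * real N * (2 * l))"
    using \<beta> by (intro mult_left_mono) auto
  then have "\<beta> * hamiltonian N J \<sigma> \<le> 2 * \<beta> * (real N * real N * l) + \<beta> * hamiltonian N J x"
    by (simp add: algebra_simps)
  then show ?thesis unfolding weight_def exp_add[symmetric] by simp
qed

lemma partition_ratio:
  assumes "x \<in> well"
  shows "partition_sum / weight x \<le> exp (real N + 2 * \<beta> * (real N * real N * l))"
proof -
  have "card (configs N) = 2 ^ N"
    by (simp add: configs_def card_PiE numeral_2_eq_2)
  then have "card well \<le> 2 ^ N"
    using card_mono[OF finite_configs well_subset] by simp
  then have card: "real (card well) \<le> 2 ^ N"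
    by (metis of_nat_le_iff of_nat_numeral of_nat_power)
  also have "(2 :: real) ^ N \<le> exp 1 ^ N"
    using exp_ge_add_one_self[of 1] by (intro power_mono) auto
  also have "\<dots> = exp (real N)" by (simp add: exp_of_nat_mult[symmetric])
  finally have card: "real (card well) \<le> exp (real N)" .
  have "partition_sum \<le> (\<Sum>\<sigma>\<in>well. exp (2 * \<beta> * (real N * real N * l)) * weight x)"
    unfolding partition_sum_def by (intro sum_mono weight_ratio assms)
  also have "\<dots> = card well * (exp (2 * \<beta> * (real N * real N * l)) * weight x)" by simp
  also have "\<dots> \<le> exp (real N) * (exp (2 * \<beta> * (real N * real N * l)) * weight x)"
    using card weight_pos[of x] by (intro mult_right_mono) auto
  finally show ?thesis
    using weight_pos[of x] by (simp add: exp_add pos_divide_le_eq mult.assoc)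
qed

text \<open>Half of the exponent in \<open>partition_ratio\<close> is the cost of the worst starting
  point after taking the root; the 3 is added because \<open>exp (- 3) < 1 / 4\<close>.\<close>

lemma mixing_time_le:
  assumes t: "0 < t" "(real N + 2 * \<beta> * (real N * real N * l)) / 2 + 3 \<le> t / (2 * relax)"
  shows "mixing_time N \<beta> J well \<le> ereal t"
proof -
  let ?E = "real N + 2 * \<beta> * (real N * real N * l)"
  have small: "\<bar>measure (clock_space N) {\<omega> \<in> space (clock_space N). glauber N \<beta> J well x \<omega> t \<in> A}
      - gibbs_given N \<beta> J well A\<bar> < 1 / 4" if x: "x \<in> well" for x A
  proof -
    have "sqrt (partition_sum / weight x) \<le> sqrt (exp ?E)"
      by (rule real_sqrt_le_mono[OF partition_ratio[OF x]])
    also have "\<dots> = exp (?E / 2)"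
      by (rule real_sqrt_unique) (simp_all add: power2_eq_square exp_add[symmetric])
    finally have "exp (- (t / (2 * relax))) * sqrt (partition_sum / weight x)
        \<le> exp (- (t / (2 * relax))) * exp (?E / 2)"
      by (intro mult_left_mono) auto
    also have "\<dots> \<le> exp (- 3)"
      unfolding exp_add[symmetric] using t(2) by simp
    also have "exp (- 3) < (1 / 4 :: real)"
    proof -
      have "2 ^ 3 \<le> exp (1 :: real) ^ 3"
        using exp_ge_add_one_self[of 1] by (intro power_mono) auto
      also have "\<dots> = exp 3" by (simp add: exp_of_nat_mult[symmetric, where n = 3, simplified])
      finally have "8 \<le> exp (3 :: real)" by simp
      then show ?thesis by (simp add: exp_minus field_simps)
    qed
    finally show ?thesis using law_close[OF x, of t A] t(1) by linarith
  qed
  have "tv_dist (configs N)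
          (\<lambda>A. measure (clock_space N) {\<omega>\<in>space (clock_space N). glauber N \<beta> J well x \<omega> t \<in> A})
          (gibbs_given N \<beta> J well) < 1 / 4" if "x \<in> well" for x
    unfolding tv_dist_def using small[OF that] by (subst Max_less_iff) auto
  then have "(MAX x\<in>well. tv_dist (configs N)
          (\<lambda>A. measure (clock_space N) {\<omega>\<in>space (clock_space N). glauber N \<beta> J well x \<omega> t \<in> A})
          (gibbs_given N \<beta> J well)) < 1 / 4"
    using finite_C \<sigma>\<^sub>0_in_well by (subst Max_less_iff) auto
  then show ?thesis
    unfolding mixing_time_def using t(1) by (intro Inf_lower imageI) simp
qed

text \<open>Breaking the heavy edge at \<open>v\<close> lowers the Hamiltonian by more than
  \<open>2 * h\<close>. Any other edge at \<open>v\<close> meets this one, so it is light by the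
  matching property and gives back at most twice its modulus.\<close>

lemma flip_weight:
  assumes \<tau>: "\<tau> \<in> well" and v: "v \<in> frozen_sites"
  shows "weight (flip v \<tau>) \<le> exp (- (2 * \<beta> * (h - c))) * weight \<tau>"
proof -
  let ?p = "\<lambda>\<sigma> e. \<sigma> (fst e) * \<sigma> (snd e) :: real"
  obtain e\<^sub>0 where e\<^sub>0: "e\<^sub>0 \<in> heavy" "v \<in> {fst e\<^sub>0, snd e\<^sub>0}"
    using v by (auto simp: frozen_sites_def)
  have e\<^sub>0_pairs: "e\<^sub>0 \<in> pairs N" using e\<^sub>0 by (simp add: heavy_def)
  have "J e * (?p (flip v \<tau>) e - ?p \<tau> e) \<le> (if e = e\<^sub>0 then - (2 * h) else 0) + 2 * light e"
    if e: "e \<in> pairs N" for e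
  proof (cases "v \<in> {fst e, snd e}")
    case False
    then have "?p (flip v \<tau>) e = ?p \<tau> e" by (simp add: flip_def)
    moreover have "e \<noteq> e\<^sub>0" using False e\<^sub>0(2) by blast
    ultimately show ?thesis using light_nonneg[of e] by simp
  next
    case True
    then have "?p (flip v \<tau>) e = - ?p \<tau> e"
      using pairs_ends(3)[OF e] by (auto simp: flip_def)
    then have d: "J e * (?p (flip v \<tau>) e - ?p \<tau> e) = - 2 * (J e * ?p \<tau> e)" by simp
    show ?thesis
    proof (cases "e = e\<^sub>0")
      case e: True
      have "J e * ?p \<tau> e = \<bar>J e\<bar>"
        using frozen_pair[OF \<tau> e\<^sub>0(1)] e by (simp add: abs_sgn)
      then show ?thesis
        using d e heavy_greater[OF e\<^sub>0(1)] light_nonneg[of e] by simp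
    next
      case False
      have "\<bar>J e\<bar> < b"
      proof (rule ccontr)
        assume "\<not> \<bar>J e\<bar> < b"
        moreover have "b \<le> \<bar>J e\<^sub>0\<bar>" using heavy_greater[OF e\<^sub>0(1)] thr b by simp
        ultimately have "e = e\<^sub>0"
          using big_matching[OF e e\<^sub>0_pairs _ _ True e\<^sub>0(2)] by simp
        then show False using False by simp
      qed
      moreover have "- (J e * ?p \<tau> e) \<le> \<bar>J e\<bar>"
        using spin_product[OF wellD[OF \<tau>] e] by (auto simp: abs_if)
      ultimately show ?thesis using d False by (simp add: light_def)
    qed
  qed
  then have "(\<Sum>e\<in>pairs N. J e * (?p (flip v \<tau>) e - ?p \<tau> e))
      \<le> (\<Sum>e\<in>pairs N. (if e = e\<^sub>0 then - (2 * h) else 0) + 2 * light e)"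
    by (rule sum_mono)
  also have "\<dots> = - (2 * h) + 2 * (\<Sum>e\<in>pairs N. light e)"
    using e\<^sub>0_pairs by (simp add: sum.distrib sum_distrib_left sum.delta')
  also have "\<dots> \<le> - (2 * (h - c))" using sum_light by simp
  finally have "hamiltonian N J (flip v \<tau>) - hamiltonian N J \<tau> \<le> - (2 * (h - c))"
    by (simp add: hamiltonian_eq sum_subtractf right_diff_distrib)
  then have "\<beta> * (hamiltonian N J (flip v \<tau>) - hamiltonian N J \<tau>) \<le> \<beta> * - (2 * (h - c))"
    using \<beta> by (intro mult_left_mono) auto
  then have "\<beta> * hamiltonian N J (flip v \<tau>) \<le> - (2 * \<beta> * (h - c)) + \<beta> * hamiltonian N J \<tau>"
    by (simp add: algebra_simps)
  then show ?thesis unfolding weight_def exp_add[symmetric] by simp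
qed

text \<open>Updates of free sites never leave the well, and an update of a frozen site does so with
  probability at most \<open>?q\<close> from every configuration of the well. An exit thus requires
  a bad variable in the sense of \<open>spoiling\<close>.\<close>

lemma escape_ge:
  fixes s :: real
  assumes x: "x \<in> well" and s: "0 \<le> s" and ch: "c \<le> h"
  shows "1 - N * s * exp (- (2 * \<beta> * (h - c)))
    \<le> measure (clock_space N) {\<omega> \<in> space (clock_space N). ereal s \<le> escape_time N \<beta> J well x \<omega>}"
proof -
  interpret R: restricted_glauber N \<beta> J "configs N" .
  let ?q = "exp (- (2 * \<beta> * (h - c)))" and ?hi = "{v \<in> frozen_sites. \<sigma>\<^sub>0 v = 1}"
  have ratio: "y / (z + y) \<le> ?q" if "y \<le> ?q * z" "0 < y" "0 < z" for y z :: real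
  proof -
    have "y \<le> ?q * (z + y)" using that by (simp add: distrib_left add_increasing2)
    then show ?thesis using that by (simp add: pos_divide_le_eq)
  qed
  have stay: "1 - N * s * ?q \<le> measure (clock_space N) {\<omega> \<in> space (clock_space N). \<forall>t. 0 \<le> t \<longrightarrow> t < s \<longrightarrow>
      fold (\<lambda>(v, k). R.step v (snd (\<omega> v k))) (rings_until N \<omega> t) x \<in> well}"
  proof (rule R.prob_stay_ge[OF x _ _ s, where hi = ?hi])
    show "?q \<le> 1" using \<beta> ch by simp
    fix v u \<tau>
    assume v: "v \<in> {1..N}" and \<tau>: "\<tau> \<in> well" and good: "\<not> (if v \<in> ?hi then 1 - ?q < u else u \<le> ?q)"
    have \<tau>c: "\<tau> \<in> configs N" by (rule wellD[OF \<tau>])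
    have p: "prob_plus N \<beta> J v \<tau> = weight (\<tau>(v := 1)) / (weight (\<tau>(v := 1)) + weight (\<tau>(v := -1)))"
      unfolding weight_def by (rule prob_plus_eq[OF \<tau>c v])
    let ?\<tau>' = "\<tau>(v := if u \<le> prob_plus N \<beta> J v \<tau> then 1 else - 1)"
    have "?\<tau>' \<in> configs N" using configs_upd[OF \<tau>c v] by simp
    then have st: "R.step v u \<tau> = ?\<tau>'" by (simp add: R.step_eq resample_def)
    show "R.step v u \<tau> \<in> well"
    proof (cases "v \<in> frozen_sites")
      case False
      then show ?thesis using \<tau> \<open>?\<tau>' \<in> configs N\<close> unfolding st well_def by auto
    next
      case True
      then have \<tau>v: "\<tau> v = \<sigma>\<^sub>0 v" using \<tau> by (simp add: well_def)
      have fw: "weight (flip v \<tau>) \<le> ?q * weight \<tau>" by (rule flip_weight[OF \<tau> True])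
      consider "\<tau> v = 1" | "\<tau> v = -1" using configs_vals[OF \<tau>c v] by blast
      then have "?\<tau>' = \<tau>"
      proof cases
        case 1
        then have e: "\<tau>(v := 1) = \<tau>" "\<tau>(v := -1) = flip v \<tau>" by (auto simp: flip_def)
        have "1 - prob_plus N \<beta> J v \<tau> = weight (flip v \<tau>) / (weight \<tau> + weight (flip v \<tau>))"
          unfolding p e using weight_pos[of \<tau>] weight_pos[of "flip v \<tau>"] by (simp add: field_simps)
        then have "1 - prob_plus N \<beta> J v \<tau> \<le> ?q"
          using ratio[OF fw weight_pos weight_pos] by simp
        then have "u \<le> prob_plus N \<beta> J v \<tau>" using good True 1 \<tau>v by simp
        then show ?thesis using e by simp
      next
        case 2
        then have e: "\<tau>(v := -1) = \<tau>" "\<tau>(v := 1) = flip v \<tau>" by (auto simp: flip_def)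
        have "prob_plus N \<beta> J v \<tau> \<le> ?q"
          unfolding p e using ratio[OF fw weight_pos weight_pos] by (simp add: add.commute)
        then have "\<not> u \<le> prob_plus N \<beta> J v \<tau>" using good True 2 \<tau>v by simp
        then show ?thesis using e by simp
      qed
      then show ?thesis using st \<tau> by simp
    qed
  qed simp
  have "{\<omega> \<in> space (clock_space N). \<forall>t. 0 \<le> t \<longrightarrow> t < s \<longrightarrow>
      fold (\<lambda>(v, k). R.step v (snd (\<omega> v k))) (rings_until N \<omega> t) x \<in> well}
    = {\<omega> \<in> space (clock_space N). ereal s \<le> escape_time N \<beta> J well x \<omega>}"
  proof (rule Collect_cong, rule conj_cong[OF refl])
    fix \<omega>
    show "(\<forall>t. 0 \<le> t \<longrightarrow> t < s \<longrightarrow> fold (\<lambda>(v, k). R.step v (snd (\<omega> v k))) (rings_until N \<omega> t) x \<in> well)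
        \<longleftrightarrow> ereal s \<le> escape_time N \<beta> J well x \<omega>"
      unfolding escape_time_def R.glauber_eq by (rule le_Inf_ereal_iff[symmetric])
  qed
  with stay show ?thesis by simp
qed

end

text \<open>Flipping a single end point of an edge of \<open>H\<close> breaks that edge.\<close>

lemma component_eq:
  assumes H: "H \<subseteq> pairs N" "\<And>e. e \<in> H \<Longrightarrow> J e \<noteq> 0"
  defines "S \<equiv> {\<sigma> \<in> configs N. H \<subseteq> Sat N J \<sigma>}"
  defines "R \<equiv> {(\<tau>, \<rho>). \<tau> \<in> S \<and> \<rho> \<in> S \<and> (\<exists>v\<in>{1..N}. \<rho> = \<tau>(v := - \<tau> v))}"
  defines "F \<equiv> (\<Union>e\<in>H. {fst e, snd e})"
  assumes \<sigma>: "\<sigma> \<in> S"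
  shows "R\<^sup>* `` {\<sigma>} = {\<tau> \<in> configs N. \<forall>v\<in>F. \<tau> v = \<sigma> v}"
proof (rule set_eqI, rule iffI)
  fix \<tau> assume "\<tau> \<in> R\<^sup>* `` {\<sigma>}"
  then have "(\<sigma>, \<tau>) \<in> R\<^sup>*" by simp
  then show "\<tau> \<in> {\<tau> \<in> configs N. \<forall>v\<in>F. \<tau> v = \<sigma> v}"
  proof induction
    case base
    then show ?case using \<sigma> by (simp add: S_def)
  next
    case (step \<tau> \<rho>)
    then obtain v where v: "\<rho> = \<tau>(v := - \<tau> v)" and S: "\<tau> \<in> S" "\<rho> \<in> S" by (auto simp: R_def)
    have "v \<notin> F"
    proof
      assume "v \<in> F"
      then obtain e where e: "e \<in> H" "v \<in> {fst e, snd e}" by (auto simp: F_def)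
      then have ne: "fst e \<noteq> snd e" using H(1) pairs_ends(3)[of e N] by auto
      have sat: "x (fst e) * x (snd e) = sgn (J e)" if "x \<in> S" for x
        using that e(1) by (auto simp: S_def Sat_def)
      have "\<rho> (fst e) * \<rho> (snd e) = - (\<tau> (fst e) * \<tau> (snd e))"
        using e(2) ne by (auto simp: v)
      then have "sgn (J e) = 0" using sat[OF S(1)] sat[OF S(2)] by simp
      then show False using H(2)[OF e(1)] by (simp add: sgn_zero_iff)
    qed
    then have "\<rho> u = \<sigma> u" if "u \<in> F" for u
      using that step.IH by (cases "u = v") (auto simp: v)
    moreover have "\<rho> \<in> configs N" using S(2) by (simp add: S_def)
    ultimately show ?case by simp
  qed
next
  fix \<tau> assume "\<tau> \<in> {\<tau> \<in> configs N. \<forall>v\<in>F. \<tau> v = \<sigma> v}"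
  then have \<tau>: "\<tau> \<in> configs N" "\<forall>v\<in>F. \<tau> v = \<sigma> v" by auto
  \<comment> \<open>Induction on the number of disagreements with \<open>\<tau>\<close>. They all
    lie off the ends of \<open>H\<close>, so removing them one at a time keeps every edge of
    \<open>H\<close> satisfied.\<close>
  have "(\<rho>, \<tau>) \<in> R\<^sup>*" if "\<rho> \<in> S" "\<forall>v\<in>F. \<rho> v = \<sigma> v" "card {v \<in> {1..N}. \<rho> v \<noteq> \<tau> v} = n" for \<rho> n
    using that
  proof (induction n arbitrary: \<rho>)
    case 0
    then have "\<rho> v = \<tau> v" for v
    proof (cases "v \<in> {1..N}")
      case False
      then show ?thesis using 0(1) \<tau>(1) by (auto simp: S_def configs_def PiE_iff extensional_def)
    qed (use 0 in auto)
    then have "\<rho> = \<tau>" by (simp add: fun_eq_iff)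
    then show ?case by simp
  next
    case (Suc n)
    then obtain v where v: "v \<in> {1..N}" "\<rho> v \<noteq> \<tau> v"
      by (metis (mono_tags, lifting) Collect_empty_eq card.empty nat.simps(3))
    have \<rho>c: "\<rho> \<in> configs N" using Suc.prems(1) by (simp add: S_def)
    have neg: "\<tau> v = - \<rho> v"
      using configs_vals[OF \<rho>c v(1)] configs_vals[OF \<tau>(1) v(1)] v(2) by auto
    have vF: "v \<notin> F" using v(2) Suc.prems(2) \<tau>(2) by auto
    let ?\<rho> = "\<rho>(v := - \<rho> v)"
    have "?\<rho> \<in> configs N"
      using configs_upd[OF \<rho>c v(1), of "- \<rho> v"] configs_vals[OF \<rho>c v(1)] by auto
    moreover have "H \<subseteq> Sat N J ?\<rho>"
    proof
      fix e assume e: "e \<in> H"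
      then have "v \<noteq> fst e" "v \<noteq> snd e" using vF by (auto simp: F_def)
      moreover have "e \<in> Sat N J \<rho>" using Suc.prems(1) e by (auto simp: S_def)
      ultimately show "e \<in> Sat N J ?\<rho>" by (auto simp: Sat_def)
    qed
    ultimately have "?\<rho> \<in> S" by (simp add: S_def)
    moreover have "\<forall>u\<in>F. ?\<rho> u = \<sigma> u" using vF Suc.prems(2) by auto
    moreover have "{u \<in> {1..N}. ?\<rho> u \<noteq> \<tau> u} = {u \<in> {1..N}. \<rho> u \<noteq> \<tau> u} - {v}"
      using neg by auto
    then have "card {u \<in> {1..N}. ?\<rho> u \<noteq> \<tau> u} = n"
      using Suc.prems(3) v by (simp add: card_Diff_singleton)
    ultimately have "(?\<rho>, \<tau>) \<in> R\<^sup>*" by (rule Suc.IH)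
    moreover have "(\<rho>, ?\<rho>) \<in> R"
      using Suc.prems(1) \<open>?\<rho> \<in> S\<close> v(1) by (auto simp: R_def)
    ultimately show ?case by (rule converse_rtrancl_into_rtrancl[rotated])
  qed
  then show "\<tau> \<in> R\<^sup>* `` {\<sigma>}" using \<sigma> by blast
qed

section \<open>Choice of exponents\<close>

lemma matching_error_tendsto:
  fixes \<alpha> d :: real
  assumes "1 - 2 * \<alpha> * d < 0"
  shows "(\<lambda>n. 4 * real n * (real n powr d) powr (- 2 * \<alpha>)) \<longlonglongrightarrow> 0"
proof -
  have "(\<lambda>n. 4 * real n powr (1 - 2 * \<alpha> * d)) \<longlonglongrightarrow> 0"
    using assms by real_asymp
  moreover have "\<forall>\<^sub>F n in sequentially. 4 * real n powr (1 - 2 * \<alpha> * d) = 4 * real n * (real n powr d) powr (- 2 * \<alpha>)"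
    using eventually_gt_at_top[of 0]
    by eventually_elim (simp add: powr_powr powr_diff powr_minus divide_inverse mult_ac)
  ultimately show ?thesis by (rule Lim_transform_eventually)
qed

lemma window_error_tendsto:
  fixes \<alpha> K k g :: real
  assumes "0 < \<alpha>" "0 < K" "k < g" "1 + k < g * (1 + \<alpha>)"
  shows "(\<lambda>n. \<alpha> * real n * (K * real n powr g - real n powr k) powr (- (1 + \<alpha>)) * (2 * real n powr k)) \<longlonglongrightarrow> 0"
proof (rule tendsto_sandwich[OF _ _ tendsto_const])
  define C where "C = 2 * \<alpha> * (K / 2) powr (- (1 + \<alpha>))"
  have "1 + k - g * (1 + \<alpha>) < 0" using assms by simp
  then show "(\<lambda>n. C * real n powr (1 + k - g * (1 + \<alpha>))) \<longlonglongrightarrow> 0"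
    by real_asymp
  show "\<forall>\<^sub>F n in sequentially. 0 \<le> \<alpha> * real n * (K * real n powr g - real n powr k) powr (- (1 + \<alpha>)) * (2 * real n powr k)"
    using assms by (intro always_eventually) simp
  \<comment> \<open>As \<open>k < g\<close>, the window is eventually narrow compared with its
    position, and half the threshold bounds its lower end from below; this leaves a pure power of
    \<open>n\<close>.\<close>
  have "\<forall>\<^sub>F n in sequentially. K / 2 * real n powr g \<le> K * real n powr g - real n powr k"
    using assms by real_asymp
  with eventually_gt_at_top[of 0]
  show "\<forall>\<^sub>F n in sequentially. \<alpha> * real n * (K * real n powr g - real n powr k) powr (- (1 + \<alpha>)) * (2 * real n powr k)
      \<le> C * real n powr (1 + k - g * (1 + \<alpha>))"
  proof eventually_elim
    fix n :: nat
    assume n: "0 < n" and le: "K / 2 * real n powr g \<le> K * real n powr g - real n powr k"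
    have "(K * real n powr g - real n powr k) powr (- (1 + \<alpha>)) \<le> (K / 2 * real n powr g) powr (- (1 + \<alpha>))"
      using le n assms by (intro powr_mono2') auto
    then have "\<alpha> * real n * (K * real n powr g - real n powr k) powr (- (1 + \<alpha>)) * (2 * real n powr k)
      \<le> \<alpha> * real n * (K / 2 * real n powr g) powr (- (1 + \<alpha>)) * (2 * real n powr k)"
      using assms by (intro mult_right_mono mult_left_mono) auto
    also have "(K / 2 * real n powr g) powr (- (1 + \<alpha>)) = (K / 2) powr (- (1 + \<alpha>)) * real n powr (- (g * (1 + \<alpha>)))"
    proof -
      have "(K / 2 * real n powr g) powr (- (1 + \<alpha>)) = (K / 2) powr (- (1 + \<alpha>)) * (real n powr g) powr (- (1 + \<alpha>))"
        by (rule powr_mult)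
      then show ?thesis by (simp only: powr_powr mult_minus_right)
    qed
    also have "\<alpha> * real n * ((K / 2) powr (- (1 + \<alpha>)) * real n powr (- (g * (1 + \<alpha>)))) * (2 * real n powr k)
       = C * (real n powr 1 * real n powr k * real n powr (- (g * (1 + \<alpha>))))"
      using n by (simp add: C_def)
    also have "real n powr 1 * real n powr k * real n powr (- (g * (1 + \<alpha>))) = real n powr (1 + k - g * (1 + \<alpha>))"
      using n unfolding powr_add[symmetric] by simp
    finally show "\<alpha> * real n * (K * real n powr g - real n powr k) powr (- (1 + \<alpha>)) * (2 * real n powr k)
      \<le> C * real n powr (1 + k - g * (1 + \<alpha>))" .
  qed
qed

lemma light_error_tendsto:
  fixes \<alpha> d r :: real
  assumes "1 + d * (1 - \<alpha>) < r"
  shows "(\<lambda>n. \<alpha> / (1 - \<alpha>) * real n * (real n powr d) powr (1 - \<alpha>) / (real n powr r)) \<longlonglongrightarrow> 0"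
  using assms by real_asymp

lemma escape_error_tendsto:
  fixes \<beta> r k :: real
  assumes "0 < \<beta>" "0 < r" "r < k"
  shows "(\<lambda>n. real n * exp (- (2 * \<beta> * (real n powr k - real n powr r)))) \<longlonglongrightarrow> 0"
  using assms by real_asymp

text \<open>On the left stands the polynomial cost of the starting point, on the right the claimed
  time divided by twice the relaxation bound. Since \<open>r < k\<close>, the right side is a
  stretched exponential up to a polynomial factor.\<close>

lemma mixing_exponent_eventually:
  fixes \<beta> r k g a :: real
  assumes "0 < \<beta>" "0 < r" "r < k" "0 < g" "0 < a"
  shows "\<forall>\<^sub>F n in sequentially. (real n + a * real n * real n * real n powr g) / 2 + 3
     \<le> exp (2 * \<beta> * real n powr k - (4 * \<beta> + 1) * real n powr r) / (4 * (real n + 1) ^ 2)"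
  using assms by real_asymp

lemma threshold_eventually:
  fixes K d k g :: real
  assumes "0 < K" "k < g" "d < g"
  shows "\<forall>\<^sub>F n in sequentially. real n powr d \<le> K * real n powr g - real n powr k"
  using assms by real_asymp

text \<open>\<open>y = 1 / (2 * \<alpha>)\<close> is the limiting value of \<open>d\<close>,
  \<open>x = 1 + y * (1 - \<alpha>)\<close> that of \<open>r\<close>, and \<open>g\<close> is the
  room between \<open>x\<close> and \<open>\<gamma> * (1 + \<alpha>) - 1\<close>, shared out in
  quarters. The bound \<open>\<gamma> * \<alpha> < 1\<close> turns
  \<open>1 + k < \<gamma> * (1 + \<alpha>)\<close> into \<open>k < \<gamma>\<close>.\<close>

lemma exponents_exist:
  fixes \<alpha> \<gamma> :: real
  assumes \<alpha>: "0 < \<alpha>" "\<alpha> < 1" and \<gamma>: "(5 * \<alpha> + 1) / (2 * \<alpha> * (2 * \<alpha> + 1)) < \<gamma>" "\<gamma> < 1 / \<alpha>"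
  obtains d r k where "0 < d" "1 - 2 * \<alpha> * d < 0" "1 + d * (1 - \<alpha>) < r" "d < r" "0 < r" "r < k"
    "1 + k < \<gamma> * (1 + \<alpha>)" "k < \<gamma>"
proof -
  define x where "x = (1 + \<alpha>) / (2 * \<alpha>)"
  define g where "g = \<gamma> * (1 + \<alpha>) - 1 - x"
  \<comment> \<open>This compares the value of \<open>\<gamma>\<close> at which \<open>g\<close>
    vanishes, \<open>(1 + 3 * \<alpha>) / (2 * \<alpha> * (1 + \<alpha>))\<close>, with the assumed
    lower bound for \<open>\<gamma>\<close>.\<close>
  have "(1 + 3 * \<alpha>) * (2 * \<alpha> + 1) < (5 * \<alpha> + 1) * (1 + \<alpha>)"
  proof -
    have "(5 * \<alpha> + 1) * (1 + \<alpha>) - (1 + 3 * \<alpha>) * (2 * \<alpha> + 1) = \<alpha> * (1 - \<alpha>)"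
      by (simp add: algebra_simps)
    moreover have "0 < \<alpha> * (1 - \<alpha>)" using \<alpha> by simp
    ultimately show ?thesis by linarith
  qed
  then have "(1 + 3 * \<alpha>) / (2 * \<alpha>) < (5 * \<alpha> + 1) / (2 * \<alpha> * (2 * \<alpha> + 1)) * (1 + \<alpha>)"
    using \<alpha> by (simp add: divide_simps)
  also have "\<dots> < \<gamma> * (1 + \<alpha>)"
    using \<gamma>(1) \<alpha> by (intro mult_strict_right_mono) auto
  finally have "(1 + 3 * \<alpha>) / (2 * \<alpha>) < \<gamma> * (1 + \<alpha>)" .
  moreover have "(1 + 3 * \<alpha>) / (2 * \<alpha>) = 1 + x"
    using \<alpha> by (simp add: x_def field_simps)
  ultimately have g: "0 < g" by (simp add: g_def)
  define y where "y = 1 / (2 * \<alpha>)"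
  have y: "0 < y" "2 * \<alpha> * y = 1" "x = y + 1 / 2"
    using \<alpha> by (simp_all add: x_def y_def field_simps)
  have ag: "0 < \<alpha> * g" using \<alpha> g by simp
  have ay: "\<alpha> * y = 1 / 2" using y(2) by simp
  have "\<gamma> * \<alpha> < 1" using \<gamma>(2) \<alpha> by (simp add: field_simps)
  show ?thesis
  proof (rule that[of "y + g / 4" "x + g / 2" "x + 3 * g / 4"])
    show "1 - 2 * \<alpha> * (y + g / 4) < 0"
      using y(2) ag by (simp add: distrib_left)
    have "(y + g / 4) * (1 - \<alpha>) = y + g / 4 - \<alpha> * y - \<alpha> * g / 4"
      by (simp add: field_simps)
    then show "1 + (y + g / 4) * (1 - \<alpha>) < x + g / 2"
      using ay ag g unfolding y(3) by linarith
    have sum: "\<gamma> * (1 + \<alpha>) = 1 + x + g" by (simp add: g_def)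
    then show "1 + (x + 3 * g / 4) < \<gamma> * (1 + \<alpha>)"
      using g by linarith
    show "x + 3 * g / 4 < \<gamma>"
      using g sum \<open>\<gamma> * \<alpha> < 1\<close> unfolding distrib_left by linarith
  qed (use y g in auto)
qed

section \<open>Assembling the estimates\<close>

lemma metastable_well_cases:
  assumes C: "C \<in> metastable_wells N \<beta> J a \<gamma>" and thr: "0 < a / (2 * \<beta>) * real N powr \<gamma>"
  obtains \<sigma>\<^sub>0 where "\<sigma>\<^sub>0 \<in> configs N" "heavy_edges N \<beta> J a \<gamma> \<subseteq> Sat N J \<sigma>\<^sub>0"
    "C = {\<tau> \<in> configs N. \<forall>v\<in>(\<Union>e\<in>heavy_edges N \<beta> J a \<gamma>. {fst e, snd e}). \<tau> v = \<sigma>\<^sub>0 v}"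
proof -
  let ?H = "heavy_edges N \<beta> J a \<gamma>"
  obtain \<sigma>\<^sub>0 where \<sigma>\<^sub>0: "\<sigma>\<^sub>0 \<in> {\<sigma> \<in> configs N. ?H \<subseteq> Sat N J \<sigma>}"
    and eq: "C = {(\<tau>, \<rho>). \<tau> \<in> {\<sigma> \<in> configs N. ?H \<subseteq> Sat N J \<sigma>} \<and> \<rho> \<in> {\<sigma> \<in> configs N. ?H \<subseteq> Sat N J \<sigma>} \<and>
       (\<exists>v\<in>{1..N}. \<rho> = \<tau>(v := - \<tau> v))}\<^sup>* `` {\<sigma>\<^sub>0}"
    using C unfolding metastable_wells_def hypercube_components_def by (rule imageE)
  have "?H \<subseteq> pairs N" "\<And>e. e \<in> ?H \<Longrightarrow> J e \<noteq> 0"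
    using thr by (auto simp: heavy_edges_def)
  from component_eq[OF this \<sigma>\<^sub>0] \<sigma>\<^sub>0 that show ?thesis unfolding eq by blast
qed

theorem theorem1p6:
  fixes \<alpha> \<beta> \<gamma> a :: real
  assumes "0 < \<alpha>" and "\<alpha> < 1" and "\<beta> > 0"
    and "(5 * \<alpha> + 1) / (2 * \<alpha> * (2 * \<alpha> + 1)) < \<gamma>" and "\<gamma> < 1 / \<alpha>"
    and "a > 0"
  shows "\<exists>\<eta>>0. \<exists>c>0. \<exists>\<epsilon>. \<epsilon> \<longlonglongrightarrow> 0 \<and>
    with_prob_tending_to_1 (coupling_law \<alpha>) (\<lambda>N J.
      \<forall>C\<in>metastable_wells N \<beta> J a \<gamma>.
        mixing_time N \<beta> J C \<le> ereal (exp (- (real N powr \<eta>)) * t_scale a \<gamma> N) \<and>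
        (\<forall>x\<in>C. measure (clock_space N)
           {\<omega>\<in>space (clock_space N). escape_time N \<beta> J C x \<omega> \<ge> ereal (c * t_scale a \<gamma> N)}
             \<ge> 1 - \<epsilon> N))"
proof -
  obtain d r k where ex: "0 < d" "1 - 2 * \<alpha> * d < 0" "1 + d * (1 - \<alpha>) < r" "d < r" "0 < r" "r < k"
    "1 + k < \<gamma> * (1 + \<alpha>)" "k < \<gamma>"
    using exponents_exist[OF assms(1,2,4,5)] .
  have \<gamma>: "0 < \<gamma>" "d < \<gamma>" "0 < k" using ex by linarith+
  define K where "K = a / (2 * \<beta>)"
  have K: "0 < K" "2 * \<beta> * K = a" using assms by (simp_all add: K_def)
  define thr where "thr N = K * real N powr \<gamma>" for N :: nat
  define l where "l N = thr N - real N powr k" for N :: nat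
  define h where "h N = thr N + real N powr k" for N :: nat
  define \<epsilon> where "\<epsilon> N = real N * exp (- (2 * \<beta> * (real N powr k - real N powr r)))" for N :: nat
  define Big where "Big N \<longleftrightarrow> 0 < N \<and> real N powr d \<le> l N \<and> real N powr r \<le> K * real N powr \<gamma> \<and>
     (real N + a * real N * real N * real N powr \<gamma>) / 2 + 3
     \<le> exp (2 * \<beta> * real N powr k - (4 * \<beta> + 1) * real N powr r) / (4 * (real N + 1) ^ 2)" for N :: nat
  define T where "T N = {J \<in> space (coupling_law \<alpha> N). typical N (real N powr d) (l N) (h N) (real N powr r) J}" for N
  \<comment> \<open>The finitely many \<open>N\<close> that are not \<open>Big\<close> get the empty
    event, which does not affect the limit.\<close>
  define E where "E N = (if Big N then T N else {})" for N
  have Big: "\<forall>\<^sub>F N in sequentially. Big N"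
  proof -
    have "\<forall>\<^sub>F N in sequentially. real N powr r \<le> K * real N powr \<gamma> - real N powr k"
      using threshold_eventually[OF K(1), of k \<gamma> r] ex by linarith
    then have "\<forall>\<^sub>F N in sequentially. real N powr r \<le> K * real N powr \<gamma>"
      by (rule eventually_mono) (metis add_increasing diff_add_cancel add.commute powr_ge_zero)
    with eventually_gt_at_top[of 0] threshold_eventually[OF K(1) ex(8) \<gamma>(2)]
      mixing_exponent_eventually[OF assms(3) ex(5,6) \<gamma>(1) assms(6)]
    show ?thesis unfolding Big_def l_def thr_def by eventually_elim simp
  qed
  \<comment> \<open>The witnesses are \<open>\<eta> = r\<close> and \<open>c = 1\<close>.
    \<open>typical\<close> does not mention a well, so one event serves all wells at once.\<close>
  have ok: "mixing_time N \<beta> J C \<le> ereal (exp (- (real N powr r)) * t_scale a \<gamma> N) \<and>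
        (\<forall>x\<in>C. measure (clock_space N)
           {\<omega>\<in>space (clock_space N). escape_time N \<beta> J C x \<omega> \<ge> ereal (1 * t_scale a \<gamma> N)}
             \<ge> 1 - \<epsilon> N)"
    if N: "Big N" and J: "typical N (real N powr d) (l N) (h N) (real N powr r) J"
      and C: "C \<in> metastable_wells N \<beta> J a \<gamma>" for N J C
  proof -
    have N0: "0 < real N" using N by (simp add: Big_def)
    have thr0: "0 < a / (2 * \<beta>) * real N powr \<gamma>" using N0 assms by simp
    have H: "heavy_edges N \<beta> J a \<gamma> = {e \<in> pairs N. thr N \<le> \<bar>J e\<bar>}"
      by (simp add: heavy_edges_def thr_def K_def)
    obtain \<sigma>\<^sub>0 where \<sigma>\<^sub>0: "\<sigma>\<^sub>0 \<in> configs N" "heavy_edges N \<beta> J a \<gamma> \<subseteq> Sat N J \<sigma>\<^sub>0"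
      "C = {\<tau> \<in> configs N. \<forall>v\<in>(\<Union>e\<in>heavy_edges N \<beta> J a \<gamma>. {fst e, snd e}). \<tau> v = \<sigma>\<^sub>0 v}"
      using metastable_well_cases[OF C thr0] .
    interpret W: typical_couplings N \<beta> J "thr N" "real N powr d" "l N" "h N" "real N powr r" \<sigma>\<^sub>0
    proof
      show "{e \<in> pairs N. thr N \<le> \<bar>J e\<bar>} \<subseteq> Sat N J \<sigma>\<^sub>0" using \<sigma>\<^sub>0(2) H by simp
    qed (use N N0 J \<sigma>\<^sub>0(1) assms(3) in \<open>auto simp: Big_def l_def h_def\<close>)
    have well: "W.well = C"
      using \<sigma>\<^sub>0(3) by (simp add: W.well_def W.frozen_sites_def W.heavy_def H)
    let ?t = "exp (- (real N powr r)) * t_scale a \<gamma> N"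
    have a_thr: "2 * \<beta> * thr N = a * real N powr \<gamma>"
      using K(2) by (simp add: thr_def mult.assoc[symmetric])
    have "mixing_time N \<beta> J W.well \<le> ereal ?t"
    proof (rule W.mixing_time_le)
      show "0 < ?t" by (simp add: t_scale_def)
      have "2 * \<beta> * l N \<le> a * real N powr \<gamma>"
        using a_thr assms(3) by (simp add: l_def right_diff_distrib)
      then have "real N * real N * (2 * \<beta> * l N) \<le> real N * real N * (a * real N powr \<gamma>)"
        by (intro mult_left_mono) auto
      then have "(real N + 2 * \<beta> * (real N * real N * l N)) / 2 + 3
          \<le> (real N + a * real N * real N * real N powr \<gamma>) / 2 + 3"
        by (simp add: mult_ac)
      also have "\<dots> \<le> exp (2 * \<beta> * real N powr k - (4 * \<beta> + 1) * real N powr r) / (4 * (real N + 1) ^ 2)"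
        using N by (simp add: Big_def)
      also have "\<dots> = ?t / (2 * W.relax)"
      proof -
        \<comment> \<open>In the coefficient \<open>4 * \<beta> + 1\<close>, the part
          \<open>4 * \<beta>\<close> comes from the light couplings in \<open>relax\<close> and the
          1 from the factor \<open>exp (- N^r)\<close> gained over \<open>t_scale\<close>.\<close>
        have "2 * \<beta> * real N powr k - (4 * \<beta> + 1) * real N powr r =
           (- (real N powr r) + a * real N powr \<gamma>) - (2 * \<beta> * l N + 4 * \<beta> * real N powr r)"
          using a_thr by (simp add: l_def algebra_simps)
        then have e: "exp (2 * \<beta> * real N powr k - (4 * \<beta> + 1) * real N powr r) =
           ?t / exp (2 * \<beta> * l N + 4 * \<beta> * real N powr r)"
          by (simp only: exp_diff exp_add t_scale_def)
        have n: "4 * (real N + 1) ^ 2 = 2 * (2 * real (Suc N * Suc N))"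
          by (simp add: power2_eq_square algebra_simps)
        show ?thesis unfolding e n W.relax_def by (simp only: divide_divide_eq_left mult_ac)
      qed
      finally show "(real N + 2 * \<beta> * (real N * real N * l N)) / 2 + 3 \<le> ?t / (2 * W.relax)" .
    qed
    moreover have "1 - \<epsilon> N \<le> measure (clock_space N)
           {\<omega>\<in>space (clock_space N). ereal (1 * t_scale a \<gamma> N) \<le> escape_time N \<beta> J W.well x \<omega>}"
      if "x \<in> W.well" for x
    proof -
      have "real N powr r \<le> h N" using N by (simp add: Big_def h_def thr_def add_increasing2)
      moreover have "0 \<le> t_scale a \<gamma> N" by (simp add: t_scale_def)
      ultimately have "1 - N * t_scale a \<gamma> N * exp (- (2 * \<beta> * (h N - real N powr r)))
        \<le> measure (clock_space N) {\<omega> \<in> space (clock_space N). ereal (t_scale a \<gamma> N) \<le> escape_time N \<beta> J W.well x \<omega>}"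
        using W.escape_ge[OF that] by blast
      \<comment> \<open>The threshold part of \<open>h N\<close> cancels \<open>t_scale\<close>
        exactly. The surplus \<open>N^k\<close>, less the light error \<open>N^r\<close>, makes the
        error vanish even at the full time scale.\<close>
      moreover have "t_scale a \<gamma> N * exp (- (2 * \<beta> * (h N - real N powr r))) =
          exp (- (2 * \<beta> * (real N powr k - real N powr r)))"
      proof -
        have "a * real N powr \<gamma> + - (2 * \<beta> * (h N - real N powr r)) = - (2 * \<beta> * (real N powr k - real N powr r))"
          using a_thr by (simp add: h_def algebra_simps)
        then show ?thesis by (simp only: t_scale_def exp_add[symmetric])
      qed
      ultimately show ?thesis by (simp add: \<epsilon>_def mult.assoc)
    qed
    ultimately show ?thesis unfolding well by blast
  qed
  have E_sets: "E N \<in> sets (coupling_law \<alpha> N)" for N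
    using sets_typical by (simp add: E_def T_def)
  define err where "err N = 4 * real N * (real N powr d) powr (- 2 * \<alpha>)
      + \<alpha> * real N * (K * real N powr \<gamma> - real N powr k) powr (- (1 + \<alpha>)) * (2 * real N powr k)
      + \<alpha> / (1 - \<alpha>) * real N * (real N powr d) powr (1 - \<alpha>) / (real N powr r)" for N :: nat
  have "err \<longlonglongrightarrow> 0 + 0 + 0"
    unfolding err_def
    by (intro tendsto_add matching_error_tendsto window_error_tendsto light_error_tendsto ex K(1) assms(1))
  then have "(\<lambda>N. 1 - err N) \<longlonglongrightarrow> 1 - (0 + 0 + 0)"
    by (intro tendsto_diff tendsto_const)
  then have lower: "(\<lambda>N. 1 - err N) \<longlonglongrightarrow> 1" by simp
  have "\<forall>\<^sub>F N in sequentially. 1 - err N \<le> measure (coupling_law \<alpha> N) (E N)"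
    using Big
  proof eventually_elim
    fix N assume N: "Big N"
    then have N1: "1 \<le> N" by (simp add: Big_def)
    have "1 - (4 * real N * (real N powr d) powr (- 2 * \<alpha>) + \<alpha> * N * l N powr (- (1 + \<alpha>)) * (h N - l N)
        + \<alpha> / (1 - \<alpha>) * N * (real N powr d) powr (1 - \<alpha>) / real N powr r) \<le> measure (coupling_law \<alpha> N) (T N)"
      unfolding T_def
    proof (rule prob_typical_ge[OF assms(1,2) N1])
      show "1 \<le> real N powr d" using N1 ex(1) by (simp add: ge_one_powr_ge_zero)
      moreover have "real N powr d \<le> l N" using N by (simp add: Big_def)
      ultimately show "0 < l N" by linarith
      show "l N \<le> h N" by (simp add: l_def h_def)
      show "0 < real N powr r" using N1 by simp
    qed
    moreover have "h N - l N = 2 * real N powr k" by (simp add: h_def l_def)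
    moreover have "l N = K * real N powr \<gamma> - real N powr k" by (simp add: l_def thr_def)
    ultimately show "1 - err N \<le> measure (coupling_law \<alpha> N) (E N)"
      using N by (simp only: E_def err_def if_True)
  qed
  moreover have "\<forall>\<^sub>F N in sequentially. measure (coupling_law \<alpha> N) (E N) \<le> 1"
    using eventually_gt_at_top[of 0]
  proof eventually_elim
    fix N :: nat assume "0 < N"
    then have "prob_space (coupling_law \<alpha> N)"
      unfolding coupling_law_eq using assms(1) by (intro prob_space_PiM prob_space_levy) auto
    then show "measure (coupling_law \<alpha> N) (E N) \<le> 1" by (rule prob_space.prob_le_1)
  qed
  ultimately have lim: "(\<lambda>N. measure (coupling_law \<alpha> N) (E N)) \<longlonglongrightarrow> 1"
    by (rule tendsto_sandwich[OF _ _ lower tendsto_const])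
  have "\<epsilon> \<longlonglongrightarrow> 0"
    unfolding \<epsilon>_def by (rule escape_error_tendsto[OF assms(3) ex(5,6)])
  moreover have "with_prob_tending_to_1 (coupling_law \<alpha>) (\<lambda>N J.
      \<forall>C\<in>metastable_wells N \<beta> J a \<gamma>.
        mixing_time N \<beta> J C \<le> ereal (exp (- (real N powr r)) * t_scale a \<gamma> N) \<and>
        (\<forall>x\<in>C. measure (clock_space N)
           {\<omega>\<in>space (clock_space N). escape_time N \<beta> J C x \<omega> \<ge> ereal (1 * t_scale a \<gamma> N)}
             \<ge> 1 - \<epsilon> N))"
    unfolding with_prob_tending_to_1_def
  proof (intro exI[of _ E] conjI allI ballI)
    fix N J C assume "J \<in> E N" "C \<in> metastable_wells N \<beta> J a \<gamma>"
    then have "Big N" "typical N (real N powr d) (l N) (h N) (real N powr r) J"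
      by (auto simp: E_def T_def split: if_splits)
    then show "mixing_time N \<beta> J C \<le> ereal (exp (- (real N powr r)) * t_scale a \<gamma> N)"
      using ok \<open>C \<in> metastable_wells N \<beta> J a \<gamma>\<close> by blast
    fix x assume "x \<in> C"
    then show "1 - \<epsilon> N \<le> measure (clock_space N)
           {\<omega>\<in>space (clock_space N). escape_time N \<beta> J C x \<omega> \<ge> ereal (1 * t_scale a \<gamma> N)}"
      using ok \<open>C \<in> metastable_wells N \<beta> J a \<gamma>\<close> \<open>Big N\<close>
        \<open>typical N (real N powr d) (l N) (h N) (real N powr r) J\<close> by blast
  qed (use E_sets lim in auto)
  ultimately show ?thesis
    using ex(5) zero_less_one by blast
qed

end
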